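(* Let $R$ be a one-dimensional quasilocal domain. Then $R$ is a bad stable ring if and only if there is a nonzero prime ideal $P$ of $\widetilde R$ such that $P^2=0$ and $\widetilde R/P$ is a DVR.
   Context: All rings are commutative with identity. A quasilocal ring is a ring with a unique maximal ideal (not necessarily Noetherian). For a domain $R$, $\widetilde R:=\varprojlim R/rR$, where $r$ ranges over all nonzero elements of $R$, is the completion of $R$ in the ideal topology (the $R$-topology). An ideal is stable if it is projective over its ring of endomorphisms; a domain is stable if every nonzero ideal is stable. A ring has finite normalization if its integral closure in its total ring of quotients is a finite module over it. A bad stable domain (bad stable ring) is a quasilocal stable domain of Krull dimension $1$ that does not have finite normalization. *)

theory Defs
  imports
    "HOL-Algebra.Polynomials"
    "HOL-Algebra.Embedded_Algebras"
    "HOL-Algebra.Ideal_Product"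
    "HOL-Library.Extended_Nat"
begin

section \<open>Quasilocal rings, Krull dimension, discrete valuation rings\<close>

definition quasilocal :: "('a, 'm) ring_scheme \<Rightarrow> bool"
  where "quasilocal R \<longleftrightarrow> cring R \<and> (\<exists>!M. maximalideal M R)"

text \<open>The supremum of the lengths \<open>n\<close> of the chains \<open>P 0 \<subset> \<dots> \<subset> P n\<close> of prime ideals
  (it is \<open>0\<close> for the zero ring, which has no primes).\<close>

definition krull_dim :: "('a, 'm) ring_scheme \<Rightarrow> enat"
  where "krull_dim R =
    Sup {enat n | n. \<exists>P. (\<forall>i\<le>n. primeideal (P i) R) \<and> (\<forall>i<n. P i \<subset> P (Suc i))}"

definition dvr :: "('a, 'm) ring_scheme \<Rightarrow> bool"
  where "dvr R \<longleftrightarrow> principal_domain R \<and> quasilocal R \<and> \<not> field R"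


section \<open>Completion in the ideal topology\<close>

text \<open>The inverse limit of the rings \<open>R/rR\<close>, with \<open>r\<close> ranging over the nonzero elements. An
  element is a family \<open>x\<close> of cosets, and for \<open>sR \<subseteq> rR\<close> the transition map \<open>R/sR \<rightarrow> R/rR\<close> sends
  the coset \<open>C\<close> to \<open>rR + C\<close>.\<close>

definition completion :: "('a, 'm) ring_scheme \<Rightarrow> ('a \<Rightarrow> 'a set) ring"
  where "completion R =
    (let D = carrier R - {\<zero>\<^bsub>R\<^esub>}; Q = (\<lambda>r. R Quot (PIdl\<^bsub>R\<^esub> r)) in
     \<lparr>carrier = {x \<in> (\<Pi>\<^sub>E r\<in>D. carrier (Q r)).
        \<forall>r\<in>D. \<forall>s\<in>D. PIdl\<^bsub>R\<^esub> s \<subseteq> PIdl\<^bsub>R\<^esub> r \<longrightarrow> PIdl\<^bsub>R\<^esub> r <+>\<^bsub>R\<^esub> x s = x r},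
      mult = (\<lambda>x y. \<lambda>r\<in>D. x r \<otimes>\<^bsub>Q r\<^esub> y r),
      one = (\<lambda>r\<in>D. \<one>\<^bsub>Q r\<^esub>),
      zero = (\<lambda>r\<in>D. \<zero>\<^bsub>Q r\<^esub>),
      add = (\<lambda>x y. \<lambda>r\<in>D. x r \<oplus>\<^bsub>Q r\<^esub> y r)\<rparr>)"


section \<open>Stable ideals\<close>

text \<open>In the records below that are used only as modules, the fields \<open>mult\<close> and \<open>one\<close>, inherited
  by the type of modules from that of rings, carry no meaning.\<close>

definition module_homs ::
    "('e, 'k) ring_scheme \<Rightarrow> ('e, 'b, 'm) module_scheme \<Rightarrow> ('e, 'c, 'n) module_scheme \<Rightarrow> ('b \<Rightarrow> 'c) set"
  where "module_homs E M N = {f \<in> carrier M \<rightarrow> carrier N.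
    (\<forall>x\<in>carrier M. \<forall>y\<in>carrier M. f (x \<oplus>\<^bsub>M\<^esub> y) = f x \<oplus>\<^bsub>N\<^esub> f y) \<and>
    (\<forall>a\<in>carrier E. \<forall>x\<in>carrier M. f (a \<odot>\<^bsub>M\<^esub> x) = a \<odot>\<^bsub>N\<^esub> f x)}"

text \<open>Endomorphisms are made extensional, so that equality in the carrier is equality of maps on
  \<open>carrier M\<close>.\<close>

definition endo_ring ::
    "('e, 'k) ring_scheme \<Rightarrow> ('e, 'b, 'm) module_scheme \<Rightarrow> ('b \<Rightarrow> 'b) ring"
  where "endo_ring R M =
    \<lparr>carrier = module_homs R M M \<inter> extensional (carrier M),
     mult = compose (carrier M),
     one = (\<lambda>x\<in>carrier M. x),
     zero = (\<lambda>x\<in>carrier M. \<zero>\<^bsub>M\<^esub>),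
     add = (\<lambda>f g. \<lambda>x\<in>carrier M. f x \<oplus>\<^bsub>M\<^esub> g x)\<rparr>"

text \<open>The module \<open>M\<close> regarded as a module over its endomorphism ring.\<close>

definition endo_module :: "('e, 'b, 'm) module_scheme \<Rightarrow> ('b \<Rightarrow> 'b, 'b) module"
  where "endo_module M =
    \<lparr>carrier = carrier M, mult = mult M, one = one M, zero = zero M, add = add M,
     smult = (\<lambda>f x. f x)\<rparr>"

definition ideal_module :: "('a, 'm) ring_scheme \<Rightarrow> 'a set \<Rightarrow> ('a, 'a) module"
  where "ideal_module R I =
    \<lparr>carrier = I, mult = mult R, one = one R, zero = zero R, add = add R, smult = mult R\<rparr>"

text \<open>The free module with basis indexed by \<open>J\<close>: finitely supported functions from \<open>J\<close> to \<open>E\<close>.\<close>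

definition free_module :: "('e, 'k) ring_scheme \<Rightarrow> 'x set \<Rightarrow> ('e, 'x \<Rightarrow> 'e) module"
  where "free_module E J =
    \<lparr>carrier = {f \<in> J \<rightarrow>\<^sub>E carrier E. finite {x \<in> J. f x \<noteq> \<zero>\<^bsub>E\<^esub>}},
     mult = (\<lambda>f g. \<lambda>x\<in>J. f x \<otimes>\<^bsub>E\<^esub> g x),
     one = (\<lambda>x\<in>J. \<one>\<^bsub>E\<^esub>),
     zero = (\<lambda>x\<in>J. \<zero>\<^bsub>E\<^esub>),
     add = (\<lambda>f g. \<lambda>x\<in>J. f x \<oplus>\<^bsub>E\<^esub> g x),
     smult = (\<lambda>a f. \<lambda>x\<in>J. a \<otimes>\<^bsub>E\<^esub> f x)\<rparr>"

text \<open>A module is projective if it is (isomorphic to) a direct summand of a free module, i.e. if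
  there are homomorphisms \<open>i\<close> into and \<open>p\<close> out of a free module with \<open>p \<circ> i\<close> the identity. Taking
  the basis of the free module in the type of the elements of \<open>M\<close> is no restriction: \<open>M\<close> is a
  quotient of the free module on its own elements, and that quotient map splits if \<open>M\<close> is
  projective.\<close>

definition projective_module :: "('e, 'k) ring_scheme \<Rightarrow> ('e, 'b, 'm) module_scheme \<Rightarrow> bool"
  where "projective_module E M \<longleftrightarrow>
    (\<exists>(J :: 'b set) i p. i \<in> module_homs E M (free_module E J) \<and>
       p \<in> module_homs E (free_module E J) M \<and> (\<forall>x\<in>carrier M. p (i x) = x))"

definition stable_ideal :: "('a, 'm) ring_scheme \<Rightarrow> 'a set \<Rightarrow> bool"
  where "stable_ideal R I \<longleftrightarrow> ideal I R \<and>
    projective_module (endo_ring R (ideal_module R I)) (endo_module (ideal_module R I))"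

definition stable_domain :: "('a, 'm) ring_scheme \<Rightarrow> bool"
  where "stable_domain R \<longleftrightarrow>
    domain R \<and> (\<forall>I. ideal I R \<and> I \<noteq> {\<zero>\<^bsub>R\<^esub>} \<longrightarrow> stable_ideal R I)"


section \<open>Total ring of quotients and finite normalization\<close>

definition regular_elems :: "('a, 'm) ring_scheme \<Rightarrow> 'a set"
  where "regular_elems R =
    {s \<in> carrier R. \<forall>x\<in>carrier R. s \<otimes>\<^bsub>R\<^esub> x = \<zero>\<^bsub>R\<^esub> \<longrightarrow> x = \<zero>\<^bsub>R\<^esub>}"

text \<open>The fraction \<open>a / s\<close>, as the set of all pairs representing it.\<close>

definition fraction :: "('a, 'm) ring_scheme \<Rightarrow> 'a \<Rightarrow> 'a \<Rightarrow> ('a \<times> 'a) set"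
  where "fraction R a s =
    {(b, t). b \<in> carrier R \<and> t \<in> regular_elems R \<and> a \<otimes>\<^bsub>R\<^esub> t = b \<otimes>\<^bsub>R\<^esub> s}"

definition total_quot_ring :: "('a, 'm) ring_scheme \<Rightarrow> ('a \<times> 'a) set ring"
  where "total_quot_ring R =
    \<lparr>carrier = {fraction R a s | a s. a \<in> carrier R \<and> s \<in> regular_elems R},
     mult = (\<lambda>A B. \<Union>(a, s)\<in>A. \<Union>(b, t)\<in>B. fraction R (a \<otimes>\<^bsub>R\<^esub> b) (s \<otimes>\<^bsub>R\<^esub> t)),
     one = fraction R \<one>\<^bsub>R\<^esub> \<one>\<^bsub>R\<^esub>,
     zero = fraction R \<zero>\<^bsub>R\<^esub> \<one>\<^bsub>R\<^esub>,
     add = (\<lambda>A B. \<Union>(a, s)\<in>A. \<Union>(b, t)\<in>B.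
       fraction R ((a \<otimes>\<^bsub>R\<^esub> t) \<oplus>\<^bsub>R\<^esub> (b \<otimes>\<^bsub>R\<^esub> s)) (s \<otimes>\<^bsub>R\<^esub> t))\<rparr>"

text \<open>The image of \<open>R\<close> in its total ring of quotients.\<close>

definition frac_image :: "('a, 'm) ring_scheme \<Rightarrow> ('a \<times> 'a) set set"
  where "frac_image R = (\<lambda>a. fraction R a \<one>\<^bsub>R\<^esub>) ` carrier R"

text \<open>The witness \<open>p\<close> is a monic polynomial with coefficients in the subring \<open>K\<close> of \<open>Q\<close>: in the
  library, polynomials are coefficient lists, the leading coefficient first.\<close>

definition integral_over :: "('a, 'm) ring_scheme \<Rightarrow> 'a set \<Rightarrow> 'a \<Rightarrow> bool"
  where "integral_over Q K x \<longleftrightarrow>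
    (\<exists>p. polynomial\<^bsub>Q\<^esub> K p \<and> p \<noteq> [] \<and> lead_coeff p = \<one>\<^bsub>Q\<^esub> \<and> ring.eval Q p x = \<zero>\<^bsub>Q\<^esub>)"

definition normalization :: "('a, 'm) ring_scheme \<Rightarrow> ('a \<times> 'a) set set"
  where "normalization R =
    {x \<in> carrier (total_quot_ring R). integral_over (total_quot_ring R) (frac_image R) x}"

text \<open>\<open>ring.Span Q K us\<close> is the set of all \<open>K\<close>-linear combinations of the list \<open>us\<close>, that is, for a
  subring \<open>K\<close> of \<open>Q\<close>, the \<open>K\<close>-submodule generated by it.\<close>

definition finite_normalization :: "('a, 'm) ring_scheme \<Rightarrow> bool"
  where "finite_normalization R \<longleftrightarrow>
    (\<exists>us. set us \<subseteq> normalization R \<and>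
       normalization R = ring.Span (total_quot_ring R) (frac_image R) us)"


section \<open>Bad stable rings\<close>

definition bad_stable_ring :: "('a, 'm) ring_scheme \<Rightarrow> bool"
  where "bad_stable_ring R \<longleftrightarrow>
    quasilocal R \<and> stable_domain R \<and> krull_dim R = 1 \<and> \<not> finite_normalization R"

end

theory Submission
  imports Defs "HOL-Decision_Procs.Commutative_Ring"
begin

text \<open>The sufficiency proof exploits that \<open>P\<^sup>2 = 0\<close>: if \<open>a - s u\<close> and \<open>b - s v\<close> lie in \<open>P\<close>, their product
  vanishes, which turns into a quadratic relation in \<open>R\<close>. Choosing \<open>x\<close> in an ideal \<open>I\<close> with minimal
  value in the DVR \<open>C / P\<close>, with \<open>C\<close> the completion, one finds \<open>I\<^sup>2 = x I\<close>, hence \<open>I\<close> is stable.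
  Approximating a nonzero element of \<open>P\<close> by elements of \<open>R\<close> produces quadratic integral elements
  whose denominators are unbounded, so the normalization is not finite.

  For necessity, work in the field of fractions. Let \<open>S\<^sub>0 = R\<close> and let \<open>S\<^sub>n\<^sub>+\<^sub>1 = (M\<^sub>n : M\<^sub>n)\<close>, where \<open>M\<^sub>n\<close> is
  the set of nonunits of \<open>S\<^sub>n\<close>. Stability makes \<open>M\<^sub>n\<close> principal over \<open>S\<^sub>n\<^sub>+\<^sub>1\<close>. If some \<open>S\<^sub>n\<^sub>+\<^sub>1\<close> failed
  to be local with the residue field of \<open>S\<^sub>n\<close>, or if \<open>M\<^sub>n\<close> were principal over \<open>S\<^sub>n\<close>, the integral closure
  would be generated by two elements, so one \<open>t\<close> satisfies \<open>M\<^sub>n = t S\<^sub>n\<^sub>+\<^sub>1\<close> and \<open>S\<^sub>n = R + t S\<^sub>n\<^sub>+\<^sub>1\<close> for all \<open>n\<close>.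
  The ideals \<open>t\<^sup>n S\<^sub>n\<close> of \<open>R\<close> then define \<open>P\<close> as the intersection of all \<open>t\<^sup>n S\<^sub>n + t\<^sup>n C\<close>.\<close>

section \<open>Commutative ring identities by reflection\<close>

text \<open>The obstacle to necessity is that a defect met far up the chain must contradict a
  property of \<open>R\<close>, while finiteness of the normalization is known to fail for
  \<open>R\<close> alone. Failure is therefore expressed by \<open>two_generated_closure\<close>
  with a fixed base ring, and it passes from a ring \<open>S\<close> of the chain to the next ring
  \<open>E\<close>: a suitable ring \<open>E + E x\<close> that contains the closure equals
  \<open>S + S x\<close>. Two generators suffice since each element of \<open>E\<close> is quadratic
  over \<open>S\<close>; otherwise \<open>S + S x\<close> would have no endomorphisms beyond
  \<open>S\<close>, and so be cyclic. One \<open>t\<close> serves at all stages because, when the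
  nonunits of \<open>E\<close> are not principal over \<open>E\<close>, the old generator differs
  from the new one by a unit of the following ring. As \<open>t\<^sup>n S\<^sub>n\<close> lies in
  \<open>R\<close>, its square lies in \<open>t\<^sup>n R\<close>, whence
  \<open>P\<^sup>2 = 0\<close>. Expansion in powers of \<open>t\<close> makes \<open>t\<close> a
  uniformizer modulo \<open>P\<close>, and \<open>P\<close> is nonzero because the nonunits of
  \<open>R\<close> exceed \<open>t R\<close>.\<close>

context cring
begin

lemma ring_identity:
  "\<lbrakk>x = Ipolex l P; y = Ipolex l Q; in_carrier l; norm (Sub P Q) = Pc 0\<rbrakk> \<Longrightarrow> x = y"
  using norm_ci[of l "Sub P Q"] norm_ci[of l P] norm_ci[of l Q] by (simp add: eq_diff0)

text \<open>The equation \<open>u = v\<close> acts as a rewrite rule from the monomial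
  \<open>A\<close> to \<open>B\<close> on the normal form of the difference, so the relations used
  below keep a bare product such as \<open>x x\<close> on the left. The two numerals 9 bound the
  rounds of rewriting.\<close>

lemma ring_identity_mod:
  "\<lbrakk>x = Ipolex l P; y = Ipolex l Q; u = v; u = Ipolex l A; v = Ipolex l B; in_carrier l;
    pnsubstl (norm (Sub P Q)) (mk_monpol_list [(A, B)]) 9 9 = Pc 0\<rbrakk> \<Longrightarrow> x = y"
  using norm_subst_correct[of l "[(A, B)]" "Sub P Q" 9 9] norm_ci[of l P] norm_ci[of l Q]
  by (simp add: eq_diff0)

lemma ring_identity_mod3:
  "\<lbrakk>x = Ipolex l P; y = Ipolex l Q; u = v; u' = v'; u'' = v'';
    u = Ipolex l A; v = Ipolex l B; u' = Ipolex l A'; v' = Ipolex l B';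
    u'' = Ipolex l A''; v'' = Ipolex l B''; in_carrier l;
    pnsubstl (norm (Sub P Q)) (mk_monpol_list [(A, B), (A', B'), (A'', B'')]) 9 9 = Pc 0\<rbrakk> \<Longrightarrow> x = y"
  using norm_subst_correct[of l "[(A, B), (A', B'), (A'', B'')]" "Sub P Q" 9 9]
    norm_ci[of l P] norm_ci[of l Q]
  by (simp add: eq_diff0)

text \<open>Resolution with these rules, in this order, reads off \<open>P\<close>, \<open>Q\<close> and the list \<open>l\<close> of atoms: the
  open tail of \<open>l\<close> is instantiated as new atoms are met. The remaining premise on normal forms
  is closed and settled by evaluation.\<close>

lemma reify_op:
  "\<zero> = Ipolex l (Const 0)"
  "\<one> = Ipolex l (Const 1)"
  "\<lbrakk>x = Ipolex l P; y = Ipolex l Q\<rbrakk> \<Longrightarrow> x \<oplus> y = Ipolex l (Add P Q)"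
  "\<lbrakk>x = Ipolex l P; y = Ipolex l Q\<rbrakk> \<Longrightarrow> x \<ominus> y = Ipolex l (Sub P Q)"
  "\<lbrakk>x = Ipolex l P; y = Ipolex l Q\<rbrakk> \<Longrightarrow> x \<otimes> y = Ipolex l (Mul P Q)"
  "x = Ipolex l P \<Longrightarrow> \<ominus> x = Ipolex l (Neg P)"
  "x = Ipolex l P \<Longrightarrow> x [^] n = Ipolex l (Pow P n)"
  by simp_all

lemma reify_var:
  "x = Ipolex (x # l) (Var 0)"
  "x = Ipolex (a # x # l) (Var 1)"
  "x = Ipolex (a # b # x # l) (Var 2)"
  "x = Ipolex (a # b # c # x # l) (Var 3)"
  "x = Ipolex (a # b # c # d # x # l) (Var 4)"
  "x = Ipolex (a # b # c # d # e # x # l) (Var 5)"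
  "x = Ipolex (a # b # c # d # e # f # x # l) (Var 6)"
  "x = Ipolex (a # b # c # d # e # f # g # x # l) (Var 7)"
  "x = Ipolex (a # b # c # d # e # f # g # h # x # l) (Var 8)"
  "x = Ipolex (a # b # c # d # e # f # g # h # i # x # l) (Var 9)"
  "x = Ipolex (a # b # c # d # e # f # g # h # i # j # x # l) (Var 10)"
  "x = Ipolex (a # b # c # d # e # f # g # h # i # j # k # x # l) (Var 11)"
  "x = Ipolex (a # b # c # d # e # f # g # h # i # j # k # m # x # l) (Var 12)"
  by (simp_all add: numeral_eq_Suc)

lemmas reify = reify_op reify_var in_carrier_Nil in_carrier_Cons

end

lemmas (in cring) carrier_intros =
  m_closed a_closed a_inv_closed minus_closed one_closed zero_closed nat_pow_closed

section \<open>Ideals, discrete valuation rings and Krull dimension\<close>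

lemma (in ideal) minus_mem: "\<lbrakk>x \<in> I; y \<in> I\<rbrakk> \<Longrightarrow> x \<ominus> y \<in> I"
  by (simp add: minus_eq)

lemma (in cring) PIdl_iff: "x \<in> PIdl r \<longleftrightarrow> (\<exists>k\<in>carrier R. x = k \<otimes> r)"
  by (auto simp: cgenideal_def)

lemma (in cring) PIdl_mult_left: "\<lbrakk>k \<in> carrier R; r \<in> carrier R\<rbrakk> \<Longrightarrow> r \<otimes> k \<in> PIdl r"
  by (auto simp: PIdl_iff m_comm)

lemma (in cring) PIdl_subset_iff:
  assumes "r \<in> carrier R" "s \<in> carrier R"
  shows "PIdl s \<subseteq> PIdl r \<longleftrightarrow> s \<in> PIdl r"
  using assms cgenideal_self cgenideal_minimal[OF cgenideal_ideal] by blast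

lemma (in cring) PIdl_closed:
  assumes "r \<in> carrier R"
  shows "x \<in> PIdl r \<Longrightarrow> x \<in> carrier R"
    "\<zero> \<in> PIdl r"
    "\<lbrakk>x \<in> PIdl r; y \<in> PIdl r\<rbrakk> \<Longrightarrow> x \<oplus> y \<in> PIdl r"
    "\<lbrakk>x \<in> PIdl r; y \<in> PIdl r\<rbrakk> \<Longrightarrow> x \<ominus> y \<in> PIdl r"
    "\<lbrakk>x \<in> PIdl r\<rbrakk> \<Longrightarrow> \<ominus> x \<in> PIdl r"
    "\<lbrakk>x \<in> PIdl r; k \<in> carrier R\<rbrakk> \<Longrightarrow> k \<otimes> x \<in> PIdl r"
    "\<lbrakk>x \<in> PIdl r; k \<in> carrier R\<rbrakk> \<Longrightarrow> x \<otimes> k \<in> PIdl r"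
proof -
  interpret ideal "PIdl r" R by (rule cgenideal_ideal[OF assms])
  show "x \<in> PIdl r \<Longrightarrow> x \<in> carrier R"
    "\<zero> \<in> PIdl r"
    "\<lbrakk>x \<in> PIdl r; y \<in> PIdl r\<rbrakk> \<Longrightarrow> x \<oplus> y \<in> PIdl r"
    "\<lbrakk>x \<in> PIdl r; y \<in> PIdl r\<rbrakk> \<Longrightarrow> x \<ominus> y \<in> PIdl r"
    "\<lbrakk>x \<in> PIdl r\<rbrakk> \<Longrightarrow> \<ominus> x \<in> PIdl r"
    "\<lbrakk>x \<in> PIdl r; k \<in> carrier R\<rbrakk> \<Longrightarrow> k \<otimes> x \<in> PIdl r"
    "\<lbrakk>x \<in> PIdl r; k \<in> carrier R\<rbrakk> \<Longrightarrow> x \<otimes> k \<in> PIdl r"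
    by (auto simp: minus_mem I_l_closed I_r_closed)
qed

lemma (in ring) ideal_coset_eq_iff:
  assumes "ideal J R" "a \<in> carrier R" "b \<in> carrier R"
  shows "J +> a = J +> b \<longleftrightarrow> a \<ominus> b \<in> J"
  using quotient_eq_iff_same_a_r_cos[OF assms] by blast

lemma (in ring) ideal_add_coset:
  assumes I: "ideal I R" and J: "ideal J R" and sub: "J \<subseteq> I" and a: "a \<in> carrier R"
  shows "I <+>\<^bsub>R\<^esub> (J +> a) = I +> a"
proof -
  interpret I: ideal I R by fact
  interpret J: ideal J R by fact
  have IJ: "j \<in> I" if "j \<in> J" for j using sub that by blast
  show ?thesis
  proof (intro equalityI subsetI)
    fix x assume "x \<in> I <+>\<^bsub>R\<^esub> (J +> a)"
    then obtain i j where ij: "i \<in> I" "j \<in> J" "x = i \<oplus> (j \<oplus> a)"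
      by (auto simp: set_add_def' a_r_coset_def')
    then have "x = (i \<oplus> j) \<oplus> a" using a I.Icarr J.Icarr by (simp add: a_assoc)
    moreover have "i \<oplus> j \<in> I" using ij IJ by simp
    ultimately show "x \<in> I +> a" by (auto simp: a_r_coset_def')
  next
    fix x assume "x \<in> I +> a"
    then obtain i where i: "i \<in> I" "x = i \<oplus> a" by (auto simp: a_r_coset_def')
    then have "x = i \<oplus> (\<zero> \<oplus> a)" using a by simp
    moreover have "\<zero> \<oplus> a \<in> J +> a" using J.zero_closed by (auto simp: a_r_coset_def' intro!: bexI[of _ \<zero>])
    ultimately show "x \<in> I <+>\<^bsub>R\<^esub> (J +> a)" using i by (auto simp: set_add_def')
  qed
qed

text \<open>The least power of \<open>t\<close> inside a nonzero ideal generates it, and the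
  multiples of \<open>t\<close> are exactly the nonunits. That zero divisors are absent also follows
  from the factorizations, because no power of \<open>t\<close> vanishes.\<close>

lemma (in cring) dvr_criterion:
  assumes t: "t \<in> carrier R" "t \<notin> Units R" "\<And>n::nat. t [^] n \<noteq> \<zero>"
    and fac: "\<And>x. \<lbrakk>x \<in> carrier R; x \<noteq> \<zero>\<rbrakk> \<Longrightarrow> \<exists>(n::nat) u. u \<in> Units R \<and> x = t [^] n \<otimes> u"
  shows "dvr R"
proof -
  have dom: "domain R"
  proof (rule domainI)
    show "cring R" by (rule is_cring)
    show "\<one> \<noteq> \<zero>" using t(3)[of 0] by simp
    fix a b assume ab: "a \<otimes> b = \<zero>" "a \<in> carrier R" "b \<in> carrier R"
    show "a = \<zero> \<or> b = \<zero>"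
    proof (rule ccontr)
      assume "\<not> ?thesis"
      then obtain n m :: nat and u v where
        u: "u \<in> Units R" "a = t [^] n \<otimes> u" and v: "v \<in> Units R" "b = t [^] m \<otimes> v"
        using fac ab by metis
      have uv: "u \<otimes> v \<in> Units R" using u v by simp
      have uvc: "u \<in> carrier R" "v \<in> carrier R" using u v by auto
      have "t [^] (n + m) \<otimes> (u \<otimes> v) = \<zero>"
        using ab(1) t(1) uvc unfolding u(2) v(2) by (simp add: nat_pow_mult[symmetric] m_ac)
      then have "t [^] (n + m) \<otimes> (u \<otimes> v) \<otimes> inv (u \<otimes> v) = \<zero>" using uv by simp
      then have "t [^] (n + m) = \<zero>" using uv t(1) uvc by (simp add: m_assoc)
      then show False using t(3) by blast
    qed
  qed
  interpret domain R by (rule dom)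
  have PIt: "x \<in> PIdl t \<longleftrightarrow> x \<in> carrier R \<and> x \<notin> Units R" for x
  proof
    assume "x \<in> PIdl t"
    then obtain k where k: "k \<in> carrier R" "x = k \<otimes> t" by (auto simp: PIdl_iff)
    then show "x \<in> carrier R \<and> x \<notin> Units R"
      using t(1,2) prod_unit_r unit_factor by (metis m_closed m_comm)
  next
    assume x: "x \<in> carrier R \<and> x \<notin> Units R"
    show "x \<in> PIdl t"
    proof (cases "x = \<zero>")
      case True
      then show ?thesis using PIdl_closed(2)[OF t(1)] by simp
    next
      case False
      then obtain n :: nat and u where u: "u \<in> Units R" "x = t [^] n \<otimes> u" using fac x by blast
      then have "n \<noteq> 0" using x by (auto intro!: ccontr[of "n \<noteq> 0"])
      then obtain k where "n = Suc k" using not0_implies_Suc by blast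
      then have "x = t \<otimes> (t [^] k \<otimes> u)" using u t(1) by (simp add: m_ac Units_closed)
      then show ?thesis using u t(1) by (auto intro!: PIdl_mult_left)
    qed
  qed
  have unit_ideal: "J = carrier R" if "ideal J R" "u \<in> J" "u \<in> Units R" for J u
  proof -
    interpret J: ideal J R by fact
    have "inv u \<otimes> u \<in> J" using that by (intro J.I_l_closed) auto
    then show ?thesis using that J.one_imp_carrier by simp
  qed
  have "principal_domain R"
  proof (intro principal_domain.intro principal_domain_axioms.intro dom)
    fix I assume I: "ideal I R"
    interpret I: ideal I R by fact
    show "\<exists>a\<in>carrier R. I = PIdl a"
    proof (cases "I = {\<zero>}")
      case True
      then show ?thesis by (intro bexI[of _ \<zero>]) (simp_all add: cgenideal_eq_genideal genideal_zero)
    next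
      case False
      have pow: "\<exists>m::nat. t [^] m \<in> I \<and> x \<in> PIdl (t [^] m)" if x: "x \<in> I" "x \<noteq> \<zero>" for x
      proof -
        obtain m :: nat and u where u: "u \<in> Units R" "x = t [^] m \<otimes> u"
          using fac[OF I.Icarr[OF x(1)] x(2)] by blast
        have "x \<otimes> inv u \<in> I" using u x by (intro I.I_r_closed) auto
        then have "t [^] m \<in> I" using u t(1) by (simp add: m_assoc Units_closed)
        moreover have "x \<in> PIdl (t [^] m)" unfolding u(2) using u t(1) by (intro PIdl_mult_left) auto
        ultimately show ?thesis by blast
      qed
      define n :: nat where "n = (LEAST n. t [^] n \<in> I)"
      obtain x where "x \<in> I" "x \<noteq> \<zero>" using False I.zero_closed by blast
      then have ex: "\<exists>n::nat. t [^] n \<in> I" using pow by blast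
      have n: "t [^] n \<in> I" unfolding n_def by (rule LeastI_ex[of "\<lambda>n. t [^] n \<in> I", OF ex])
      have "I \<subseteq> PIdl (t [^] n)"
      proof
        fix x assume x: "x \<in> I"
        show "x \<in> PIdl (t [^] n)"
        proof (cases "x = \<zero>")
          case True
          then show ?thesis using PIdl_closed(2) t(1) by simp
        next
          case False
          then obtain m :: nat where m: "t [^] m \<in> I" "x \<in> PIdl (t [^] m)" using pow x by blast
          have "n \<le> m" unfolding n_def using m(1) by (rule Least_le)
          then have "t [^] m = t [^] n \<otimes> t [^] (m - n)" using t(1) by (simp add: nat_pow_mult)
          then have "t [^] m \<in> PIdl (t [^] n)" using t(1) by (simp add: PIdl_mult_left)
          then show ?thesis using m(2) PIdl_subset_iff[of "t [^] n" "t [^] m"] t(1) by auto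
        qed
      qed
      moreover have "PIdl (t [^] n) \<subseteq> I" using cgenideal_minimal[OF I n] .
      ultimately show ?thesis using t(1) by (intro bexI[of _ "t [^] n"]) auto
    qed
  qed
  moreover have "maximalideal (PIdl t) R"
  proof (rule maximalidealI)
    show "ideal (PIdl t) R" using cgenideal_ideal[OF t(1)] .
    show "carrier R \<noteq> PIdl t" using PIt[of \<one>] by auto
    fix J assume J: "ideal J R" "PIdl t \<subseteq> J" "J \<subseteq> carrier R"
    show "J = PIdl t \<or> J = carrier R"
      using J unit_ideal[OF J(1)] PIt by blast
  qed
  moreover have "M = PIdl t" if M: "maximalideal M R" for M
  proof -
    interpret M: maximalideal M R by fact
    have "M \<subseteq> PIdl t"
      using PIt unit_ideal[OF M.is_ideal] M.I_notcarr M.Icarr by blast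
    then show ?thesis
      using M.I_maximal[OF cgenideal_ideal[OF t(1)]] PIdl_closed(1)[OF t(1)] PIt[of \<one>] by auto
  qed
  moreover have "\<not> field R"
  proof
    assume "field R"
    then have "t \<in> Units R" using field.field_Units t(1) t(3)[of 1] by (metis DiffI nat_pow_eone singletonD)
    then show False using t by blast
  qed
  ultimately show ?thesis unfolding dvr_def quasilocal_def using is_cring by blast
qed

section \<open>Prime ideals avoiding a multiplicative set, and the consequences of dimension
  one\<close>

context cring
begin

lemma ideal_maximal_disjoint:
  assumes I: "ideal I R" and T: "I \<inter> T = {}"
  obtains Q where "ideal Q R" "I \<subseteq> Q" "Q \<inter> T = {}"
    "\<And>J. \<lbrakk>ideal J R; Q \<subseteq> J; J \<inter> T = {}\<rbrakk> \<Longrightarrow> J = Q"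
proof -
  define A where "A = {J. ideal J R \<and> I \<subseteq> J \<and> J \<inter> T = {}}"
  have "\<exists>Q\<in>A. \<forall>J\<in>A. Q \<subseteq> J \<longrightarrow> J = Q"
  proof (rule subset_Zorn_nonempty)
    show "A \<noteq> {}" using I T unfolding A_def by blast
    fix Ch assume Ch: "Ch \<noteq> {}" "subset.chain A Ch"
    have XA: "Ch \<subseteq> A" using Ch unfolding subset_chain_def by blast
    have "subset.chain {I. ideal I R} Ch"
      using Ch unfolding subset_chain_def A_def by blast
    then have "ideal (\<Union>Ch) R" using chain_Union_is_ideal[of Ch] Ch(1) by simp
    moreover obtain J where "J \<in> Ch" using Ch(1) by blast
    ultimately show "\<Union>Ch \<in> A" using XA unfolding A_def by auto
  qed
  then obtain Q where "Q \<in> A" "\<forall>J\<in>A. Q \<subseteq> J \<longrightarrow> J = Q" by blast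
  then show thesis by (intro that[of Q]) (auto simp: A_def)
qed

text \<open>Krull's argument: elements \<open>a\<close>, \<open>b\<close> outside \<open>Q\<close>
  give enlarged ideals that both meet \<open>T\<close>; if \<open>a b\<close> were in
  \<open>Q\<close>, the product of two such elements of \<open>T\<close> would be in
  \<open>Q\<close> as well.\<close>

lemma prime_if_maximal_disjoint:
  assumes Q: "ideal Q R" "Q \<inter> T = {}"
    and max: "\<And>J. \<lbrakk>ideal J R; Q \<subseteq> J; J \<inter> T = {}\<rbrakk> \<Longrightarrow> J = Q"
    and T: "T \<subseteq> carrier R" "\<one> \<in> T" "\<And>x y. \<lbrakk>x \<in> T; y \<in> T\<rbrakk> \<Longrightarrow> x \<otimes> y \<in> T"
  shows "primeideal Q R"
proof (rule primeidealI[OF Q(1) is_cring])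
  interpret Q: ideal Q R by fact
  show "carrier R \<noteq> Q" using Q(2) T(2) by auto
  have ex: "\<exists>q\<in>Q. \<exists>k\<in>carrier R. q \<oplus> k \<otimes> a \<in> T" if a: "a \<in> carrier R" "a \<notin> Q" for a
  proof -
    define J where "J = Q <+>\<^bsub>R\<^esub> PIdl a"
    have J: "ideal J R" unfolding J_def using add_ideals[OF Q(1) cgenideal_ideal[OF a(1)]] .
    have mem: "x \<in> J \<longleftrightarrow> (\<exists>q\<in>Q. \<exists>k\<in>carrier R. x = q \<oplus> k \<otimes> a)" for x
      unfolding J_def by (auto simp: set_add_def' cgenideal_def)
    have "Q \<subseteq> J"
    proof
      fix x assume x: "x \<in> Q"
      have "x = x \<oplus> \<zero> \<otimes> a" using a Q.Icarr[OF x] by simp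
      then show "x \<in> J" using x mem zero_closed by blast
    qed
    moreover have "a \<in> J"
    proof -
      have "a = \<zero> \<oplus> \<one> \<otimes> a" using a by simp
      then show ?thesis using mem Q.zero_closed one_closed by blast
    qed
    ultimately have "J \<inter> T \<noteq> {}" using max[OF J] a by blast
    then obtain x where "x \<in> J" "x \<in> T" by blast
    then show ?thesis using mem[of x] by blast
  qed
  fix a b assume ab: "a \<in> carrier R" "b \<in> carrier R" "a \<otimes> b \<in> Q"
  show "a \<in> Q \<or> b \<in> Q"
  proof (rule ccontr)
    assume "\<not> ?thesis"
    then obtain q k r l where q: "q \<in> Q" "k \<in> carrier R" "q \<oplus> k \<otimes> a \<in> T"
      and r: "r \<in> Q" "l \<in> carrier R" "r \<oplus> l \<otimes> b \<in> T" using ex ab by meson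
    have c: "q \<in> carrier R" "r \<in> carrier R" "k \<in> carrier R" "l \<in> carrier R" "a \<in> carrier R" "b \<in> carrier R"
      using q r ab Q.Icarr by auto
    \<comment> \<open>Every summand but the last has the factor \<open>q\<close> or
      \<open>r\<close>; the last one contains \<open>a b\<close>.\<close>
    have "(q \<oplus> k \<otimes> a) \<otimes> (r \<oplus> l \<otimes> b) = (r \<oplus> l \<otimes> b) \<otimes> q \<oplus> (k \<otimes> a) \<otimes> r \<oplus> (k \<otimes> l) \<otimes> (a \<otimes> b)"
      by (rule ring_identity, (rule reify c)+, code_simp)
    also have "\<dots> \<in> Q"
      using c by (intro Q.a_closed Q.I_l_closed[OF q(1)] Q.I_l_closed[OF r(1)] Q.I_l_closed[OF ab(3)]) simp_all
    finally show False using T(3)[OF q(3) r(3)] Q(2) by blast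
  qed
qed

lemma nonunit_in_maximal:
  assumes x: "x \<in> carrier R" "x \<notin> Units R"
  obtains M where "maximalideal M R" "x \<in> M"
proof -
  \<comment> \<open>With \<open>T = {1}\<close>, avoiding \<open>T\<close> means being proper, so
    maximal avoidance is maximality.\<close>
  have one: "J = carrier R \<longleftrightarrow> J \<inter> {\<one>} \<noteq> {}" if "ideal J R" for J
    using ideal.one_imp_carrier[OF that] by auto
  have "\<one> \<notin> PIdl x"
  proof
    assume "\<one> \<in> PIdl x"
    then obtain k where "k \<in> carrier R" "k \<otimes> x = \<one>" by (auto simp: PIdl_iff)
    then show False using x unit_factor[of x k] by (simp add: m_comm)
  qed
  then have "PIdl x \<inter> {\<one>} = {}" by simp
  then obtain Q where Q: "ideal Q R" "PIdl x \<subseteq> Q" "Q \<inter> {\<one>} = {}"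
    "\<And>J. \<lbrakk>ideal J R; Q \<subseteq> J; J \<inter> {\<one>} = {}\<rbrakk> \<Longrightarrow> J = Q"
    using ideal_maximal_disjoint[OF cgenideal_ideal[OF x(1)], of "{\<one>}"] by metis
  have "maximalideal Q R"
    using Q one by (intro maximalidealI) blast+
  then show thesis using that Q(2) cgenideal_self[OF x(1)] by blast
qed

lemma proper_ideal_nonunit:
  assumes "ideal J R" "J \<noteq> carrier R" "x \<in> J"
  shows "x \<in> carrier R - Units R"
proof -
  interpret J: ideal J R by fact
  have "x \<notin> Units R"
  proof
    assume u: "x \<in> Units R"
    have "inv x \<otimes> x \<in> J" using u assms by (intro J.I_l_closed) auto
    then show False using u J.one_imp_carrier assms(2) by simp
  qed
  then show ?thesis using J.Icarr assms(3) by blast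
qed

text \<open>Each nonunit lies in some maximal ideal, and there is only one.\<close>

lemma quasilocal_maximal:
  assumes "quasilocal R"
  shows "maximalideal (carrier R - Units R) R"
proof -
  obtain M where M: "maximalideal M R" "\<And>M'. maximalideal M' R \<Longrightarrow> M' = M"
    using assms unfolding quasilocal_def by auto
  interpret M: maximalideal M R by fact
  have "M = carrier R - Units R"
    using nonunit_in_maximal M(2) proper_ideal_nonunit[OF M.is_ideal] M.I_notcarr by blast
  then show ?thesis using M(1) by simp
qed

end

lemma krull_dim_chain:
  assumes "\<And>i. i \<le> n \<Longrightarrow> primeideal (P i) R" "\<And>i. i < n \<Longrightarrow> P i \<subset> P (Suc i)"
  shows "enat n \<le> krull_dim R"
  unfolding krull_dim_def using assms by (intro Sup_upper) blast

text \<open>Were all nonzero elements units, zero would be the only prime and the dimension would be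
  zero.\<close>

lemma (in "domain") one_dimensional_nonunit:
  assumes "krull_dim R = 1"
  obtains m where "m \<in> carrier R" "m \<notin> Units R" "m \<noteq> \<zero>"
proof -
  have "\<exists>m\<in>carrier R - Units R. m \<noteq> \<zero>"
  proof (rule ccontr)
    assume no: "\<not> ?thesis"
    have prime0: "Q = {\<zero>}" if Q: "primeideal Q R" for Q
    proof -
      interpret Q: primeideal Q R by fact
      show ?thesis
        using no proper_ideal_nonunit[OF Q.is_ideal] Q.I_notcarr Q.zero_closed by blast
    qed
    have "krull_dim R \<le> 0"
      unfolding krull_dim_def
    proof (rule Sup_least)
      fix x assume "x \<in> {enat n | n. \<exists>P. (\<forall>i\<le>n. primeideal (P i) R) \<and> (\<forall>i<n. P i \<subset> P (Suc i))}"
      then obtain n P where n: "x = enat n" "\<And>i. i \<le> n \<Longrightarrow> primeideal (P i) R" "\<And>i. i < n \<Longrightarrow> P i \<subset> P (Suc i)"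
        by blast
      have "n = 0"
      proof (rule ccontr)
        assume "n \<noteq> 0"
        then have "P 0 \<subset> P (Suc 0)" "primeideal (P 0) R" "primeideal (P (Suc 0)) R" using n by auto
        then show False using prime0 by blast
      qed
      then show "x \<le> 0" using n by (simp add: zero_enat_def)
    qed
    then show False using assms by simp
  qed
  then show thesis using that by blast
qed

text \<open>A prime maximal among the ideals that contain \<open>s\<close> and avoid the powers of
  \<open>m\<close> would lie strictly between zero and the maximal ideal, a chain of length two.
  Hence the powers of a nonzero nonunit are cofinal among the principal ideals and define the
  topology of the completion.\<close>

lemma (in "domain") one_dimensional_power:
  assumes ql: "quasilocal R" and dim: "krull_dim R = 1"
    and s: "s \<in> carrier R" "s \<noteq> \<zero>" and m: "m \<in> carrier R" "m \<notin> Units R"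
  shows "\<exists>n::nat. m [^] n \<in> PIdl s"
proof (rule ccontr)
  assume no: "\<not> ?thesis"
  define T where "T = {m [^] n | n::nat. True}"
  have "PIdl s \<inter> T = {}" using no unfolding T_def by blast
  then obtain Q where Q: "ideal Q R" "PIdl s \<subseteq> Q" "Q \<inter> T = {}"
    "\<And>J. \<lbrakk>ideal J R; Q \<subseteq> J; J \<inter> T = {}\<rbrakk> \<Longrightarrow> J = Q"
    using ideal_maximal_disjoint[OF cgenideal_ideal[OF s(1)], of T] by metis
  have "primeideal Q R"
  proof (rule prime_if_maximal_disjoint[OF Q(1,3)])
    show "J = Q" if "ideal J R" "Q \<subseteq> J" "J \<inter> T = {}" for J using Q(4)[OF that] .
    show "T \<subseteq> carrier R" using m unfolding T_def by auto
    show "\<one> \<in> T" unfolding T_def by (auto intro: exI[of _ "0::nat"])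
    show "x \<otimes> y \<in> T" if "x \<in> T" "y \<in> T" for x y
      using that m unfolding T_def by (auto simp: nat_pow_mult)
  qed
  interpret Q: primeideal Q R by fact
  define M where "M = carrier R - Units R"
  have "maximalideal M R" using quasilocal_maximal[OF ql] unfolding M_def .
  then have M: "primeideal M R" using maximalideal_prime by blast
  have QM: "Q \<subset> M"
  proof -
    have "m [^] (1::nat) \<in> T" unfolding T_def by blast
    then have "m \<notin> Q" using Q(3) m by auto
    then show ?thesis using m proper_ideal_nonunit[OF Q(1)] Q.I_notcarr unfolding M_def by blast
  qed
  have Q0: "{\<zero>} \<subset> Q" using Q(2) cgenideal_self[OF s(1)] s(2) Q.zero_closed by blast
  have "enat 2 \<le> krull_dim R"
  proof (rule krull_dim_chain[where P = "\<lambda>i. if i = 0 then {\<zero>} else if i = 1 then Q else M"])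
    show "primeideal (if i = 0 then {\<zero>} else if i = 1 then Q else M) R" for i :: nat
      using \<open>primeideal Q R\<close> M zeroprimeideal by simp
    show "(if i = 0 then {\<zero>} else if i = 1 then Q else M) \<subset>
      (if Suc i = 0 then {\<zero>} else if Suc i = 1 then Q else M)" if "i < 2" for i :: nat
      using that QM Q0 by (auto simp: less_2_cases_iff)
  qed
  then show False using dim by (simp add: one_enat_def)
qed

section \<open>The field of fractions\<close>

context "domain"
begin

abbreviation Frac where "Frac \<equiv> total_quot_ring R"

lemma regular_elems_domain: "regular_elems R = carrier R - {\<zero>}"
proof (intro equalityI subsetI)
  fix s assume "s \<in> regular_elems R"
  then have s: "s \<in> carrier R" "s \<otimes> \<one> = \<zero> \<Longrightarrow> \<one> = \<zero>" unfolding regular_elems_def by blast+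
  then have "s \<noteq> \<zero>" using one_not_zero by auto
  then show "s \<in> carrier R - {\<zero>}" using s by blast
next
  fix s assume "s \<in> carrier R - {\<zero>}"
  then show "s \<in> regular_elems R" unfolding regular_elems_def using integral by auto
qed

abbreviation (input) fr where "fr \<equiv> fraction R"

lemma fraction_eq_iff:
  assumes "a \<in> carrier R" "b \<in> carrier R" "s \<in> carrier R" "s \<noteq> \<zero>" "t \<in> carrier R" "t \<noteq> \<zero>"
  shows "fr a s = fr b t \<longleftrightarrow> a \<otimes> t = b \<otimes> s"
proof
  assume eq: "fr a s = fr b t"
  have "(a, s) \<in> fr a s" using assms by (simp add: fraction_def regular_elems_domain)
  then have "(a, s) \<in> fr b t" unfolding eq .
  then show "a \<otimes> t = b \<otimes> s" by (simp add: fraction_def)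
next
  have sub: "fr a s \<subseteq> fr b t" if c: "a \<in> carrier R" "b \<in> carrier R" "s \<in> carrier R" "s \<noteq> \<zero>" "t \<in> carrier R" "t \<noteq> \<zero>"
    and eq: "a \<otimes> t = b \<otimes> s" for a b s t
  proof
    fix x assume x: "x \<in> fr a s"
    then obtain d u where x: "x = (d, u)" "d \<in> carrier R" "u \<in> carrier R" "u \<noteq> \<zero>" "a \<otimes> u = d \<otimes> s"
      by (auto simp: fraction_def regular_elems_domain)
    have "s \<otimes> (b \<otimes> u) = (b \<otimes> s) \<otimes> u" using x(2,3) c by (simp add: m_ac)
    also have "\<dots> = (a \<otimes> u) \<otimes> t" unfolding eq[symmetric] using x(2,3) c by (simp add: m_ac)
    also have "\<dots> = s \<otimes> (d \<otimes> t)" unfolding x(5) using x(2) c by (simp add: m_ac)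
    finally have "b \<otimes> u = d \<otimes> t" using m_lcancel[OF c(4,3)] c x by simp
    then show "x \<in> fr b t" using x(1-4) by (simp add: fraction_def regular_elems_domain)
  qed
  assume "a \<otimes> t = b \<otimes> s"
  then show "fr a s = fr b t" using sub[of a b s t] sub[of b a t s] assms by simp
qed

lemma Frac_carrierE:
  assumes "z \<in> carrier Frac"
  obtains a s where "a \<in> carrier R" "s \<in> carrier R" "s \<noteq> \<zero>" "z = fr a s"
  using assms by (auto simp: total_quot_ring_def regular_elems_domain)

lemma fraction_closed: "\<lbrakk>a \<in> carrier R; s \<in> carrier R; s \<noteq> \<zero>\<rbrakk> \<Longrightarrow> fr a s \<in> carrier Frac"
  by (auto simp: total_quot_ring_def regular_elems_domain)

text \<open>The operations on fractions are unions over all pairs of representatives. Since all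
  members of such a union coincide, it collapses to a single fraction, and only well-definedness
  remains to be checked.\<close>

lemma fraction_UN:
  assumes c: "a \<in> carrier R" "b \<in> carrier R" "s \<in> carrier R" "s \<noteq> \<zero>" "t \<in> carrier R" "t \<noteq> \<zero>"
    and const: "\<And>a' s' b' t'. \<lbrakk>a' \<in> carrier R; s' \<in> carrier R; s' \<noteq> \<zero>; a \<otimes> s' = a' \<otimes> s;
      b' \<in> carrier R; t' \<in> carrier R; t' \<noteq> \<zero>; b \<otimes> t' = b' \<otimes> t\<rbrakk> \<Longrightarrow> f a' s' b' t' = w"
  shows "(\<Union>(a, s)\<in>fr a s. \<Union>(b, t)\<in>fr b t. f a s b t) = w"
proof -
  have "(a, s) \<in> fr a s" "(b, t) \<in> fr b t" using c by (simp_all add: fraction_def regular_elems_domain)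
  moreover have "f a' s' b' t' = w" if "(a', s') \<in> fr a s" "(b', t') \<in> fr b t" for a' s' b' t'
    using that by (intro const) (auto simp: fraction_def regular_elems_domain)
  ultimately show ?thesis by fast
qed

lemma fraction_mult:
  assumes c: "a \<in> carrier R" "b \<in> carrier R" "s \<in> carrier R" "s \<noteq> \<zero>" "t \<in> carrier R" "t \<noteq> \<zero>"
  shows "fr a s \<otimes>\<^bsub>Frac\<^esub> fr b t = fr (a \<otimes> b) (s \<otimes> t)"
proof -
  have "(\<Union>(a, s)\<in>fr a s. \<Union>(b, t)\<in>fr b t. fr (a \<otimes> b) (s \<otimes> t)) = fr (a \<otimes> b) (s \<otimes> t)"
  proof (rule fraction_UN[OF c])
    fix a' s' b' t' assume 1: "a' \<in> carrier R" "s' \<in> carrier R" "s' \<noteq> \<zero>" "a \<otimes> s' = a' \<otimes> s"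
      "b' \<in> carrier R" "t' \<in> carrier R" "t' \<noteq> \<zero>" "b \<otimes> t' = b' \<otimes> t"
    have "(a' \<otimes> b') \<otimes> (s \<otimes> t) = (a' \<otimes> s) \<otimes> (b' \<otimes> t)" using 1 c by (simp add: m_ac)
    also have "\<dots> = (a \<otimes> b) \<otimes> (s' \<otimes> t')" unfolding 1(4)[symmetric] 1(8)[symmetric] using 1(1-3,5-7) c by (simp add: m_ac)
    finally show "fr (a' \<otimes> b') (s' \<otimes> t') = fr (a \<otimes> b) (s \<otimes> t)"
      using 1 c by (subst fraction_eq_iff) (simp_all add: integral_iff)
  qed
  then show ?thesis by (simp add: total_quot_ring_def)
qed

lemma fraction_add:
  assumes c: "a \<in> carrier R" "b \<in> carrier R" "s \<in> carrier R" "s \<noteq> \<zero>" "t \<in> carrier R" "t \<noteq> \<zero>"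
  shows "fr a s \<oplus>\<^bsub>Frac\<^esub> fr b t = fr (a \<otimes> t \<oplus> b \<otimes> s) (s \<otimes> t)"
proof -
  have "(\<Union>(a, s)\<in>fr a s. \<Union>(b, t)\<in>fr b t. fr (a \<otimes> t \<oplus> b \<otimes> s) (s \<otimes> t)) = fr (a \<otimes> t \<oplus> b \<otimes> s) (s \<otimes> t)"
  proof (rule fraction_UN[OF c])
    fix a' s' b' t' assume 1: "a' \<in> carrier R" "s' \<in> carrier R" "s' \<noteq> \<zero>" "a \<otimes> s' = a' \<otimes> s"
      "b' \<in> carrier R" "t' \<in> carrier R" "t' \<noteq> \<zero>" "b \<otimes> t' = b' \<otimes> t"
    have "(a' \<otimes> t' \<oplus> b' \<otimes> s') \<otimes> (s \<otimes> t) = (a' \<otimes> s) \<otimes> (t \<otimes> t') \<oplus> (b' \<otimes> t) \<otimes> (s \<otimes> s')"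
      by (rule ring_identity, (rule reify 1 c)+, code_simp)
    also have "\<dots> = (a \<otimes> t \<oplus> b \<otimes> s) \<otimes> (s' \<otimes> t')"
      unfolding 1(4)[symmetric] 1(8)[symmetric]
      by (rule ring_identity, (rule reify 1 c)+, code_simp)
    finally show "fr (a' \<otimes> t' \<oplus> b' \<otimes> s') (s' \<otimes> t') = fr (a \<otimes> t \<oplus> b \<otimes> s) (s \<otimes> t)"
      using 1 c by (subst fraction_eq_iff) (simp_all add: integral_iff)
  qed
  then show ?thesis by (simp add: total_quot_ring_def)
qed

lemma Frac_one: "\<one>\<^bsub>Frac\<^esub> = fr \<one> \<one>" and Frac_zero: "\<zero>\<^bsub>Frac\<^esub> = fr \<zero> \<one>"
  by (simp_all add: total_quot_ring_def)

lemmas Frac_ops = fraction_mult fraction_add Frac_one Frac_zero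

lemma fraction_eqI:
  assumes "a \<otimes> t = b \<otimes> s" "a \<in> carrier R" "b \<in> carrier R" "s \<in> carrier R" "s \<noteq> \<zero>" "t \<in> carrier R" "t \<noteq> \<zero>"
  shows "fr a s = fr b t"
  using fraction_eq_iff assms by blast

lemma Frac_cring: "cring Frac"
proof (rule cringI)
  show "abelian_group Frac"
  proof (rule abelian_groupI)
    fix x assume "x \<in> carrier Frac"
    then obtain a s where x: "a \<in> carrier R" "s \<in> carrier R" "s \<noteq> \<zero>" "x = fr a s" by (rule Frac_carrierE)
    show "\<zero>\<^bsub>Frac\<^esub> \<oplus>\<^bsub>Frac\<^esub> x = x"
      using x by (simp add: Frac_ops)
    have "fr (\<ominus> a) s \<oplus>\<^bsub>Frac\<^esub> x = \<zero>\<^bsub>Frac\<^esub>"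
      using x by (simp add: Frac_ops fraction_eq_iff integral_iff l_minus l_neg)
    then show "\<exists>y\<in>carrier Frac. y \<oplus>\<^bsub>Frac\<^esub> x = \<zero>\<^bsub>Frac\<^esub>"
      using x fraction_closed by (metis a_inv_closed)
  next
    fix x y assume "x \<in> carrier Frac" "y \<in> carrier Frac"
    then obtain a s b t where x: "a \<in> carrier R" "s \<in> carrier R" "s \<noteq> \<zero>" "x = fr a s"
      and y: "b \<in> carrier R" "t \<in> carrier R" "t \<noteq> \<zero>" "y = fr b t" by (metis Frac_carrierE)
    show "x \<oplus>\<^bsub>Frac\<^esub> y \<in> carrier Frac" using x y by (simp add: Frac_ops fraction_closed integral_iff)
    show "x \<oplus>\<^bsub>Frac\<^esub> y = y \<oplus>\<^bsub>Frac\<^esub> x" using x y by (simp add: Frac_ops a_comm m_comm)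
    fix z assume "z \<in> carrier Frac"
    then obtain d u where z: "d \<in> carrier R" "u \<in> carrier R" "u \<noteq> \<zero>" "z = fr d u" by (rule Frac_carrierE)
    have "((a \<otimes> t \<oplus> b \<otimes> s) \<otimes> u \<oplus> d \<otimes> (s \<otimes> t)) \<otimes> (s \<otimes> (t \<otimes> u)) =
      (a \<otimes> (t \<otimes> u) \<oplus> (b \<otimes> u \<oplus> d \<otimes> t) \<otimes> s) \<otimes> (s \<otimes> t \<otimes> u)"
      by (rule ring_identity, (rule reify x y z)+, code_simp)
    then show "x \<oplus>\<^bsub>Frac\<^esub> y \<oplus>\<^bsub>Frac\<^esub> z = x \<oplus>\<^bsub>Frac\<^esub> (y \<oplus>\<^bsub>Frac\<^esub> z)"
      unfolding x(4) y(4) z(4) using x(1-3) y(1-3) z(1-3)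
      by (simp add: Frac_ops integral_iff fraction_eq_iff)
  qed (simp add: Frac_ops fraction_closed)
  show "Group.comm_monoid Frac"
  proof (rule comm_monoidI)
    fix x assume "x \<in> carrier Frac"
    then obtain a s where x: "a \<in> carrier R" "s \<in> carrier R" "s \<noteq> \<zero>" "x = fr a s" by (rule Frac_carrierE)
    show "\<one>\<^bsub>Frac\<^esub> \<otimes>\<^bsub>Frac\<^esub> x = x" using x by (simp add: Frac_ops)
  next
    fix x y assume "x \<in> carrier Frac" "y \<in> carrier Frac"
    then obtain a s b t where x: "a \<in> carrier R" "s \<in> carrier R" "s \<noteq> \<zero>" "x = fr a s"
      and y: "b \<in> carrier R" "t \<in> carrier R" "t \<noteq> \<zero>" "y = fr b t" by (metis Frac_carrierE)
    show "x \<otimes>\<^bsub>Frac\<^esub> y \<in> carrier Frac" using x y by (simp add: Frac_ops fraction_closed integral_iff)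
    show "x \<otimes>\<^bsub>Frac\<^esub> y = y \<otimes>\<^bsub>Frac\<^esub> x" using x y by (simp add: Frac_ops m_comm)
    fix z assume "z \<in> carrier Frac"
    then obtain d u where z: "d \<in> carrier R" "u \<in> carrier R" "u \<noteq> \<zero>" "z = fr d u" by (rule Frac_carrierE)
    show "x \<otimes>\<^bsub>Frac\<^esub> y \<otimes>\<^bsub>Frac\<^esub> z = x \<otimes>\<^bsub>Frac\<^esub> (y \<otimes>\<^bsub>Frac\<^esub> z)"
      using x y z by (simp add: Frac_ops integral_iff m_assoc)
  qed (simp add: Frac_ops fraction_closed)
  fix x y z assume "x \<in> carrier Frac" "y \<in> carrier Frac" "z \<in> carrier Frac"
  then obtain a s b t d u where x: "a \<in> carrier R" "s \<in> carrier R" "s \<noteq> \<zero>" "x = fr a s"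
    and y: "b \<in> carrier R" "t \<in> carrier R" "t \<noteq> \<zero>" "y = fr b t"
    and z: "d \<in> carrier R" "u \<in> carrier R" "u \<noteq> \<zero>" "z = fr d u"
    by (elim Frac_carrierE) blast
  have "((a \<otimes> t \<oplus> b \<otimes> s) \<otimes> d) \<otimes> (s \<otimes> u \<otimes> (t \<otimes> u)) =
    (a \<otimes> d \<otimes> (t \<otimes> u) \<oplus> b \<otimes> d \<otimes> (s \<otimes> u)) \<otimes> (s \<otimes> t \<otimes> u)"
    by (rule ring_identity, (rule reify x y z)+, code_simp)
  then show "(x \<oplus>\<^bsub>Frac\<^esub> y) \<otimes>\<^bsub>Frac\<^esub> z = x \<otimes>\<^bsub>Frac\<^esub> z \<oplus>\<^bsub>Frac\<^esub> y \<otimes>\<^bsub>Frac\<^esub> z"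
    unfolding x(4) y(4) z(4) using x(1-3) y(1-3) z(1-3)
    by (simp add: Frac_ops integral_iff fraction_eq_iff)
qed

lemma Frac_field: "field Frac"
proof -
  interpret Fr: cring Frac by (rule Frac_cring)
  show ?thesis
  proof (rule Fr.cring_fieldI2)
    show "\<zero>\<^bsub>Frac\<^esub> \<noteq> \<one>\<^bsub>Frac\<^esub>" by (simp add: Frac_ops fraction_eq_iff)
    fix x assume x0: "x \<in> carrier Frac" "x \<noteq> \<zero>\<^bsub>Frac\<^esub>"
    then obtain a s where x: "a \<in> carrier R" "s \<in> carrier R" "s \<noteq> \<zero>" "x = fr a s" by (metis Frac_carrierE)
    have a: "a \<noteq> \<zero>" using x0 x by (auto simp: Frac_ops fraction_eq_iff)
    have "x \<otimes>\<^bsub>Frac\<^esub> fr s a = \<one>\<^bsub>Frac\<^esub>"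
      using x a by (simp add: Frac_ops fraction_eq_iff integral_iff m_comm)
    then show "\<exists>y\<in>carrier Frac. x \<otimes>\<^bsub>Frac\<^esub> y = \<one>\<^bsub>Frac\<^esub>" using x a fraction_closed by blast
  qed
qed

definition embed :: "'a \<Rightarrow> ('a \<times> 'a) set" where "embed a = fr a \<one>"

lemma frac_image_eq: "frac_image R = embed ` carrier R"
  by (simp add: frac_image_def embed_def)

lemma embed_hom: "embed \<in> ring_hom R Frac"
  by (rule ring_hom_memI) (auto simp: embed_def Frac_ops fraction_closed)

lemma embed_inj: "\<lbrakk>a \<in> carrier R; b \<in> carrier R\<rbrakk> \<Longrightarrow> embed a = embed b \<longleftrightarrow> a = b"
  by (simp add: embed_def fraction_eq_iff)

lemma Frac_denominator:
  assumes "z \<in> carrier Frac"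
  obtains a s where "a \<in> carrier R" "s \<in> carrier R" "s \<noteq> \<zero>" "embed s \<otimes>\<^bsub>Frac\<^esub> z = embed a"
proof -
  obtain a s where x: "a \<in> carrier R" "s \<in> carrier R" "s \<noteq> \<zero>" "z = fr a s" using assms by (rule Frac_carrierE)
  have "embed s \<otimes>\<^bsub>Frac\<^esub> z = embed a"
    using x by (simp add: embed_def Frac_ops fraction_eq_iff integral_iff m_comm)
  then show thesis using that x by blast
qed

end

text \<open>A name of its own, since the field of fractions is again a domain and would otherwise
  call for its own field of fractions in turn.\<close>

locale domain_fractions = "domain"

sublocale domain_fractions \<subseteq> Fr: field "total_quot_ring R" by (rule Frac_field)

sublocale domain_fractions \<subseteq> emb: ring_hom_cring R "total_quot_ring R" embed
  by (intro ring_hom_cringI ring_hom_ringI2 ring_axioms Fr.ring_axioms is_cring Fr.is_cring embed_hom)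

section \<open>The completion\<close>

lemma (in ring) add_minus_cancel:
  assumes "a \<in> carrier R" "x \<in> carrier R"
  shows "a \<oplus> (x \<oplus> \<ominus> a) = x"
  using assms a_lcomm[of a x "\<ominus> a"] by (simp add: r_neg)

context "domain"
begin

definition nz :: "'a set" where "nz = carrier R - {\<zero>}"

lemma nz_iff: "r \<in> nz \<longleftrightarrow> r \<in> carrier R \<and> r \<noteq> \<zero>"
  by (auto simp: nz_def)

lemma nz_mult: "\<lbrakk>r \<in> nz; s \<in> nz\<rbrakk> \<Longrightarrow> r \<otimes> s \<in> nz"
  by (auto simp: nz_iff integral_iff)

lemma nz_pow: "r \<in> nz \<Longrightarrow> r [^] (n::nat) \<in> nz"
  by (induction n) (auto simp: nz_iff integral_iff)

lemma nzD [simp]: "r \<in> nz \<Longrightarrow> r \<in> carrier R" "r \<in> nz \<Longrightarrow> r \<noteq> \<zero>"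
  by (simp_all add: nz_iff)

text \<open>Representatives in place of cosets turn the arithmetic of the completion into pointwise
  arithmetic in the ring.\<close>

definition coherent :: "('a \<Rightarrow> 'a) \<Rightarrow> bool"
  where "coherent f \<longleftrightarrow> (\<forall>r\<in>nz. f r \<in> carrier R) \<and>
    (\<forall>r\<in>nz. \<forall>s\<in>nz. s \<in> PIdl r \<longrightarrow> f s \<ominus> f r \<in> PIdl r)"

definition family_limit :: "('a \<Rightarrow> 'a) \<Rightarrow> 'a \<Rightarrow> 'a set"
  where "family_limit f = (\<lambda>r\<in>nz. PIdl r +> f r)"

abbreviation \<iota> :: "'a \<Rightarrow> 'a \<Rightarrow> 'a set"
  where "\<iota> a \<equiv> family_limit (\<lambda>_. a)"

lemma coherentI:
  assumes "\<And>r. r \<in> nz \<Longrightarrow> f r \<in> carrier R"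
    and "\<And>r s. \<lbrakk>r \<in> nz; s \<in> nz; s \<in> PIdl r\<rbrakk> \<Longrightarrow> f s \<ominus> f r \<in> PIdl r"
  shows "coherent f"
  using assms unfolding coherent_def by blast

lemma coherentD:
  assumes "coherent f" "r \<in> nz"
  shows "f r \<in> carrier R" "\<lbrakk>s \<in> nz; s \<in> PIdl r\<rbrakk> \<Longrightarrow> f s \<ominus> f r \<in> PIdl r"
  using assms by (simp_all add: coherent_def)

text \<open>The indices \<open>r\<close> and \<open>s\<close> need not be comparable; their product
  is a common multiple through which both members of the family are related.\<close>

lemma coherent_mult_right:
  assumes "coherent f" "r \<in> nz" "s \<in> nz"
  shows "f (r \<otimes> s) \<ominus> f r \<in> PIdl r" "f (r \<otimes> s) \<ominus> f s \<in> PIdl s" "f (r \<otimes> s) \<in> carrier R"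
    "r \<otimes> s \<in> nz"
proof -
  show rs: "r \<otimes> s \<in> nz" using assms by (intro nz_mult)
  show "f (r \<otimes> s) \<in> carrier R" using coherentD(1)[OF assms(1) rs] .
  show "f (r \<otimes> s) \<ominus> f r \<in> PIdl r"
    using coherentD(2)[OF assms(1,2) rs] assms by (simp add: PIdl_mult_left)
  show "f (r \<otimes> s) \<ominus> f s \<in> PIdl s"
    using coherentD(2)[OF assms(1,3) rs] assms PIdl_mult_left[of r s] by (simp add: m_comm)
qed

lemma completion_carrier_iff:
  "x \<in> carrier (completion R) \<longleftrightarrow> (\<exists>f. coherent f \<and> x = family_limit f)"
proof
  assume x: "x \<in> carrier (completion R)"
  then have x1: "x \<in> (\<Pi>\<^sub>E r\<in>nz. carrier (R Quot PIdl r))"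
    and x2: "\<And>r s. \<lbrakk>r \<in> nz; s \<in> nz; PIdl s \<subseteq> PIdl r\<rbrakk> \<Longrightarrow> PIdl r <+>\<^bsub>R\<^esub> x s = x r"
    unfolding nz_def by (auto simp: completion_def Let_def)
  have "\<exists>a\<in>carrier R. x r = PIdl r +> a" if "r \<in> nz" for r
    using x1 that by (auto simp: PiE_iff FactRing_def A_RCOSETS_def')
  then obtain f where f: "\<And>r. r \<in> nz \<Longrightarrow> f r \<in> carrier R" "\<And>r. r \<in> nz \<Longrightarrow> x r = PIdl r +> f r"
    by metis
  have "x = family_limit f"
    using x1 f unfolding family_limit_def by (intro ext) (auto simp: PiE_iff extensional_def)
  moreover have "coherent f"
  proof (rule coherentI)
    show "f r \<in> carrier R" if "r \<in> nz" for r using f that by blast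
    fix r s assume rs: "r \<in> nz" "s \<in> nz" "s \<in> PIdl r"
    then have sub: "PIdl s \<subseteq> PIdl r" using PIdl_subset_iff by auto
    have ids: "ideal (PIdl r) R" "ideal (PIdl s) R" using rs by (auto intro: cgenideal_ideal)
    have "PIdl r +> f s = PIdl r <+>\<^bsub>R\<^esub> x s"
      using ideal_add_coset[OF ids sub] f rs by simp
    also have "\<dots> = PIdl r +> f r" using x2[OF rs(1,2) sub] f(2)[OF rs(1)] by simp
    finally show "f s \<ominus> f r \<in> PIdl r"
      using ideal_coset_eq_iff[OF ids(1)] f(1) rs by blast
  qed
  ultimately show "\<exists>f. coherent f \<and> x = family_limit f" by blast
next
  assume "\<exists>f. coherent f \<and> x = family_limit f"
  then obtain f where f: "coherent f" and x: "x = family_limit f" by blast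
  have "PIdl r <+>\<^bsub>R\<^esub> (PIdl s +> f s) = PIdl r +> f r"
    if rs: "r \<in> nz" "s \<in> nz" "PIdl s \<subseteq> PIdl r" for r s
  proof -
    have ids: "ideal (PIdl r) R" "ideal (PIdl s) R" using rs by (auto intro: cgenideal_ideal)
    have "s \<in> PIdl r" using rs PIdl_subset_iff by auto
    then have "PIdl r +> f s = PIdl r +> f r"
      using ideal_coset_eq_iff[OF ids(1)] coherentD[OF f] rs by blast
    then show ?thesis using ideal_add_coset[OF ids rs(3)] coherentD(1)[OF f] rs by simp
  qed
  moreover have "\<exists>a\<in>carrier R. PIdl r +> f r = PIdl r +> a" if "r \<in> nz" for r
    using coherentD(1)[OF f that] by blast
  ultimately show "x \<in> carrier (completion R)"
    unfolding x completion_def Let_def family_limit_def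
    by (auto simp: FactRing_def A_RCOSETS_def' nz_def[symmetric])
qed

lemma completionE:
  assumes "x \<in> carrier (completion R)"
  obtains f where "coherent f" "\<And>r. r \<in> nz \<Longrightarrow> f r \<in> carrier R" "x = family_limit f"
  using assms coherentD(1) unfolding completion_carrier_iff by metis

lemma limit_closed: "coherent f \<Longrightarrow> family_limit f \<in> carrier (completion R)"
  using completion_carrier_iff by blast

lemma limit_eq_iff:
  assumes "coherent f" "coherent g"
  shows "family_limit f = family_limit g \<longleftrightarrow> (\<forall>r\<in>nz. f r \<ominus> g r \<in> PIdl r)"
proof -
  have "(PIdl r +> f r = PIdl r +> g r) = (f r \<ominus> g r \<in> PIdl r)" if "r \<in> nz" for r
    using that assms by (intro ideal_coset_eq_iff cgenideal_ideal) (use coherentD(1)[OF assms(1)] coherentD(1)[OF assms(2)] in auto)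
  then show ?thesis
    unfolding family_limit_def by (auto simp: fun_eq_iff restrict_def)
qed

lemma coherent_add:
  assumes fg: "coherent f" "coherent g"
  shows "coherent (\<lambda>r. f r \<oplus> g r)"
proof (rule coherentI)
  note c = coherentD(1)[OF fg(1)] coherentD(1)[OF fg(2)]
  show "f r \<oplus> g r \<in> carrier R" if "r \<in> nz" for r using c that by simp
  fix r s assume rs: "r \<in> nz" "s \<in> nz" "s \<in> PIdl r"
  have "(f s \<oplus> g s) \<ominus> (f r \<oplus> g r) = (f s \<ominus> f r) \<oplus> (g s \<ominus> g r)"
    using c rs by (simp add: minus_eq minus_add a_ac)
  then show "(f s \<oplus> g s) \<ominus> (f r \<oplus> g r) \<in> PIdl r"
    using rs PIdl_closed(3)[of r] coherentD(2)[OF fg(1)] coherentD(2)[OF fg(2)] by simp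
qed

lemma coherent_mult:
  assumes fg: "coherent f" "coherent g"
  shows "coherent (\<lambda>r. f r \<otimes> g r)"
proof (rule coherentI)
  show "f r \<otimes> g r \<in> carrier R" if "r \<in> nz" for r
    using coherentD(1)[OF fg(1)] coherentD(1)[OF fg(2)] that by simp
  fix r s assume rs: "r \<in> nz" "s \<in> nz" "s \<in> PIdl r"
  obtain a b c d where abcd: "a = f s" "b = f r" "c = g s" "d = g r" by blast
  have carr: "a \<in> carrier R" "b \<in> carrier R" "c \<in> carrier R" "d \<in> carrier R"
    using abcd rs by (simp_all add: coherentD(1)[OF fg(1)] coherentD(1)[OF fg(2)])
  have "a \<otimes> c \<ominus> b \<otimes> d = (a \<ominus> b) \<otimes> c \<oplus> b \<otimes> (c \<ominus> d)"
    by (rule ring_identity, (rule reify carr)+, code_simp)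
  moreover have "a \<ominus> b \<in> PIdl r" "c \<ominus> d \<in> PIdl r"
    using coherentD(2)[OF fg(1)] coherentD(2)[OF fg(2)] rs abcd by auto
  ultimately show "f s \<otimes> g s \<ominus> f r \<otimes> g r \<in> PIdl r"
    using rs carr abcd PIdl_closed(3,6,7)[of r] by simp
qed

lemma coherent_const: "a \<in> carrier R \<Longrightarrow> coherent (\<lambda>_. a)"
  by (rule coherentI) (auto simp: r_neg minus_eq intro: PIdl_closed(2))

lemma coherent_uminus: "coherent f \<Longrightarrow> coherent (\<lambda>r. \<ominus> f r)"
  using coherent_mult[OF coherent_const[of "\<ominus> \<one>"], of f] coherentD(1)[of f]
  unfolding coherent_def by (simp add: l_minus)

lemma limit_add:
  assumes "coherent f" "coherent g"
  shows "family_limit f \<oplus>\<^bsub>completion R\<^esub> family_limit g = family_limit (\<lambda>r. f r \<oplus> g r)"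
proof -
  have "(PIdl r +> f r) <+>\<^bsub>R\<^esub> (PIdl r +> g r) = PIdl r +> (f r \<oplus> g r)" if "r \<in> nz" for r
    using that assms by (intro ideal.a_rcos_sum cgenideal_ideal) (use coherentD(1)[OF assms(1)] coherentD(1)[OF assms(2)] in auto)
  then show ?thesis
    unfolding completion_def Let_def family_limit_def by (auto simp: FactRing_def fun_eq_iff restrict_def nz_def[symmetric])
qed

lemma limit_mult:
  assumes "coherent f" "coherent g"
  shows "family_limit f \<otimes>\<^bsub>completion R\<^esub> family_limit g = family_limit (\<lambda>r. f r \<otimes> g r)"
proof -
  have "rcoset_mult R (PIdl r) (PIdl r +> f r) (PIdl r +> g r) = PIdl r +> (f r \<otimes> g r)" if "r \<in> nz" for r
    using that assms by (intro ideal.rcoset_mult_add cgenideal_ideal) (use coherentD(1)[OF assms(1)] coherentD(1)[OF assms(2)] in auto)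
  then show ?thesis
    unfolding completion_def Let_def family_limit_def by (auto simp: FactRing_def fun_eq_iff restrict_def nz_def[symmetric])
qed

lemma limit_one: "\<one>\<^bsub>completion R\<^esub> = \<iota> \<one>"
  unfolding completion_def Let_def family_limit_def nz_def by (simp add: FactRing_def)

lemma limit_zero: "\<zero>\<^bsub>completion R\<^esub> = \<iota> \<zero>"
proof -
  have "PIdl r +> \<zero> = PIdl r" if "r \<in> nz" for r
    using that by (intro a_rcos_zero cgenideal_ideal) (auto intro: PIdl_closed(2))
  then show ?thesis
    unfolding completion_def Let_def family_limit_def by (auto simp: FactRing_def fun_eq_iff restrict_def nz_def[symmetric])
qed

lemmas coherent_intros = coherent_add coherent_mult coherent_const coherent_uminus
lemmas limit_ops = limit_add limit_mult limit_one limit_zero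

lemma limit_cong:
  assumes "\<And>r. r \<in> nz \<Longrightarrow> f r = g r"
  shows "family_limit f = family_limit g"
  using assms unfolding family_limit_def by (auto simp: fun_eq_iff restrict_def)

lemma completion_cring: "cring (completion R)"
proof (rule cringI)
  show "abelian_group (completion R)"
  proof (rule abelian_groupI)
    show "\<exists>y\<in>carrier (completion R). y \<oplus>\<^bsub>completion R\<^esub> x = \<zero>\<^bsub>completion R\<^esub>"
      if "x \<in> carrier (completion R)" for x
      using that
      by (auto elim!: completionE simp: limit_ops coherent_intros l_neg
          intro!: bexI[OF _ limit_closed[OF coherent_uminus]] limit_cong)
  qed (auto elim!: completionE simp: limit_ops coherent_intros limit_closed a_ac intro!: limit_cong)
  show "Group.comm_monoid (completion R)"
    by (rule comm_monoidI)
      (auto elim!: completionE simp: limit_ops coherent_intros limit_closed m_ac intro!: limit_cong)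
qed (auto elim!: completionE simp: limit_ops coherent_intros limit_closed l_distr intro!: limit_cong)

lemma \<iota>_closed: "a \<in> carrier R \<Longrightarrow> \<iota> a \<in> carrier (completion R)"
  by (rule limit_closed[OF coherent_const])

lemma \<iota>_hom: "\<iota> \<in> ring_hom R (completion R)"
  by (rule ring_hom_memI) (auto simp: \<iota>_closed limit_ops coherent_const)

text \<open>Division by \<open>r\<close> costs precision: the quotient modulo \<open>s\<close> is
  visible only in the member of the family at \<open>r s\<close>, so \<open>g s\<close> is defined
  by \<open>f (r s) = r (g s)\<close>.\<close>

lemma limit_divisible:
  assumes r: "r \<in> nz" and f: "coherent f" and fr: "f r \<in> PIdl r"
  shows "\<exists>y\<in>carrier (completion R). family_limit f = \<iota> r \<otimes>\<^bsub>completion R\<^esub> y"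
proof -
  have rc: "r \<in> carrier R" "r \<noteq> \<zero>" using r by simp_all
  have "\<exists>b\<in>carrier R. f (r \<otimes> s) = r \<otimes> b" if s: "s \<in> nz" for s
  proof -
    note c = coherent_mult_right[OF f r s]
    have "f (r \<otimes> s) = (f (r \<otimes> s) \<ominus> f r) \<oplus> f r"
      using c(3) coherentD(1)[OF f r] by (simp add: minus_eq a_assoc l_neg)
    also have "\<dots> \<in> PIdl r" using c(1) fr rc(1) by (intro PIdl_closed(3))
    finally show ?thesis using rc by (auto simp: PIdl_iff m_comm)
  qed
  then obtain g where g: "\<And>s. s \<in> nz \<Longrightarrow> g s \<in> carrier R" "\<And>s. s \<in> nz \<Longrightarrow> f (r \<otimes> s) = r \<otimes> g s"
    by metis
  have cg: "coherent g"
  proof (rule coherentI)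
    show "g s \<in> carrier R" if "s \<in> nz" for s using g that by blast
    fix s u assume su: "s \<in> nz" "u \<in> nz" "u \<in> PIdl s"
    obtain k where k: "k \<in> carrier R" "u = k \<otimes> s" using su(3) by (auto simp: PIdl_iff)
    have "r \<otimes> u = k \<otimes> (r \<otimes> s)" using k su rc by (simp add: m_lcomm)
    then have "r \<otimes> u \<in> PIdl (r \<otimes> s)" using k by (auto simp: PIdl_iff)
    then have "f (r \<otimes> u) \<ominus> f (r \<otimes> s) \<in> PIdl (r \<otimes> s)"
      using coherentD(2)[OF f coherent_mult_right(4)[OF f r su(1)] coherent_mult_right(4)[OF f r su(2)]] by blast
    then obtain l where l: "l \<in> carrier R" "r \<otimes> g u \<ominus> r \<otimes> g s = l \<otimes> (r \<otimes> s)"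
      using g(2) su by (auto simp: PIdl_iff)
    have gc: "g u \<in> carrier R" "g s \<in> carrier R" using g(1) su by auto
    have "r \<otimes> (g u \<ominus> g s) = r \<otimes> (l \<otimes> s)"
      using l gc rc su by (simp add: r_distr minus_eq r_minus m_lcomm)
    then have "g u \<ominus> g s = l \<otimes> s" using m_lcancel[OF rc(2,1)] gc l su by simp
    then show "g u \<ominus> g s \<in> PIdl s" using l by (auto simp: PIdl_iff)
  qed
  have rg: "coherent (\<lambda>s. r \<otimes> g s)" using coherent_mult[OF coherent_const[OF rc(1)] cg] .
  have "\<forall>s\<in>nz. f s \<ominus> r \<otimes> g s \<in> PIdl s"
  proof
    fix s assume s: "s \<in> nz"
    have "f s \<ominus> r \<otimes> g s = \<ominus> (f (r \<otimes> s) \<ominus> f s)"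
      using g[OF s] rc coherentD(1)[OF f s] by (simp add: minus_eq minus_add a_comm)
    then show "f s \<ominus> r \<otimes> g s \<in> PIdl s"
      using coherent_mult_right(2)[OF f r s] PIdl_closed(5)[OF nzD(1)[OF s]] by simp
  qed
  then have "family_limit f = family_limit (\<lambda>s. r \<otimes> g s)" using limit_eq_iff[OF f rg] by blast
  then show ?thesis
    using limit_closed[OF cg] rc by (auto simp: limit_mult coherent_const cg intro!: bexI[of _ "family_limit g"])
qed

text \<open>Identifies the kernel of the projection from the completion \<open>C\<close> to
  \<open>R/rR\<close> as \<open>r C\<close>.\<close>

lemma \<iota>_dvd_iff:
  assumes r: "r \<in> nz" and f: "coherent f"
  shows "(\<exists>y\<in>carrier (completion R). family_limit f = \<iota> r \<otimes>\<^bsub>completion R\<^esub> y) \<longleftrightarrow> f r \<in> PIdl r"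
proof
  have rc: "r \<in> carrier R" using r by auto
  assume "\<exists>y\<in>carrier (completion R). family_limit f = \<iota> r \<otimes>\<^bsub>completion R\<^esub> y"
  then obtain g where g: "coherent g" "family_limit f = family_limit (\<lambda>s. r \<otimes> g s)"
    using rc by (auto elim!: completionE simp: limit_mult coherent_const)
  then have "f r \<ominus> r \<otimes> g r \<in> PIdl r"
    using r limit_eq_iff[OF f coherent_mult[OF coherent_const[OF rc] g(1)]] by blast
  moreover have "r \<otimes> g r \<in> PIdl r" using coherentD(1)[OF g(1) r] rc by (rule PIdl_mult_left)
  ultimately have "(f r \<ominus> r \<otimes> g r) \<oplus> r \<otimes> g r \<in> PIdl r" using rc by (intro PIdl_closed(3))
  then show "f r \<in> PIdl r"
    using coherentD(1)[OF f r] coherentD(1)[OF g(1) r] rc by (simp add: minus_eq a_assoc l_neg)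
qed (rule limit_divisible[OF r f])

text \<open>So \<open>r C\<close> meets \<open>R\<close> in \<open>r R\<close>; the descents of
  divisibility from the completion to the ring rest on this.\<close>

lemma \<iota>_dvd_\<iota>_iff:
  assumes "r \<in> nz" "a \<in> carrier R"
  shows "(\<exists>y\<in>carrier (completion R). \<iota> a = \<iota> r \<otimes>\<^bsub>completion R\<^esub> y) \<longleftrightarrow> a \<in> PIdl r"
  using \<iota>_dvd_iff[OF assms(1) coherent_const[OF assms(2)]] .

text \<open>The relation at index \<open>r s\<close>, divided by \<open>r\<close>, says that the
  member there is a multiple of \<open>s\<close>, and this member agrees with \<open>f s\<close>
  modulo \<open>s\<close>.\<close>

lemma \<iota>_regular:
  assumes r: "r \<in> nz" and y: "y \<in> carrier (completion R)"
    and 0: "\<iota> r \<otimes>\<^bsub>completion R\<^esub> y = \<zero>\<^bsub>completion R\<^esub>"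
  shows "y = \<zero>\<^bsub>completion R\<^esub>"
proof -
  have rc: "r \<in> carrier R" "r \<noteq> \<zero>" using r by simp_all
  obtain f where f: "coherent f" "y = family_limit f" by (rule completionE[OF y])
  have eq: "family_limit (\<lambda>s. r \<otimes> f s) = family_limit (\<lambda>_. \<zero>)"
    using 0 rc f by (simp add: limit_ops coherent_const)
  have "f s \<ominus> \<zero> \<in> PIdl s" if s: "s \<in> nz" for s
  proof -
    note c = coherent_mult_right[OF f(1) r s]
    have "r \<otimes> f (r \<otimes> s) \<ominus> \<zero> \<in> PIdl (r \<otimes> s)"
      using eq limit_eq_iff[OF coherent_mult[OF coherent_const[OF rc(1)] f(1)] coherent_const[OF zero_closed]] c(4)
      by blast
    then obtain k where k: "k \<in> carrier R" "r \<otimes> f (r \<otimes> s) = k \<otimes> (r \<otimes> s)"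
      using c(3) rc by (auto simp: PIdl_iff)
    have "r \<otimes> f (r \<otimes> s) = r \<otimes> (k \<otimes> s)" using k s rc by (simp add: m_lcomm)
    then have "f (r \<otimes> s) = k \<otimes> s" using m_lcancel[OF rc(2,1)] k s c(3) by simp
    then have "f (r \<otimes> s) \<in> PIdl s" using k by (auto simp: PIdl_iff)
    then have "f (r \<otimes> s) \<ominus> (f (r \<otimes> s) \<ominus> f s) \<in> PIdl s"
      using c(2) by (rule PIdl_closed(4)[OF nzD(1)[OF s]])
    moreover have "f (r \<otimes> s) \<ominus> (f (r \<otimes> s) \<ominus> f s) = f s \<ominus> \<zero>"
      using c(3) coherentD(1)[OF f(1) s] by (simp add: minus_eq minus_add r_neg2)
    ultimately show ?thesis by simp
  qed
  then show ?thesis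
    unfolding f(2) limit_zero using limit_eq_iff[OF f(1) coherent_const[OF zero_closed]] by blast
qed

lemma completion_separated:
  assumes y: "y \<in> carrier (completion R)"
    and dvd: "\<And>r. r \<in> nz \<Longrightarrow> \<exists>z\<in>carrier (completion R). y = \<iota> r \<otimes>\<^bsub>completion R\<^esub> z"
  shows "y = \<zero>\<^bsub>completion R\<^esub>"
proof -
  obtain f where f: "coherent f" "y = family_limit f" by (rule completionE[OF y])
  have "f r \<ominus> \<zero> \<in> PIdl r" if "r \<in> nz" for r
    using dvd[OF that] \<iota>_dvd_iff[OF that f(1)] coherentD(1)[OF f(1) that] f(2) by simp
  then show ?thesis
    unfolding f(2) limit_zero using limit_eq_iff[OF f(1) coherent_const[OF zero_closed]] by blast
qed

text \<open>Here \<open>a\<close> is the representative of \<open>y\<close> at index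
  \<open>r\<close>; the rest is divisible by \<open>r\<close> because its member at \<open>r\<close>
  vanishes.\<close>

lemma completion_dense:
  assumes y: "y \<in> carrier (completion R)" and r: "r \<in> nz"
  obtains a z where "a \<in> carrier R" "z \<in> carrier (completion R)"
    "y = \<iota> a \<oplus>\<^bsub>completion R\<^esub> \<iota> r \<otimes>\<^bsub>completion R\<^esub> z"
proof -
  obtain f where f: "coherent f" "y = family_limit f" by (rule completionE[OF y])
  define a where "a = f r"
  have a: "a \<in> carrier R" using coherentD(1)[OF f(1) r] by (simp add: a_def)
  have cg: "coherent (\<lambda>s. f s \<oplus> \<ominus> a)" using a f by (intro coherent_intros) auto
  have "f r \<oplus> \<ominus> a \<in> PIdl r" using a r by (simp add: a_def r_neg PIdl_closed(2))
  then obtain z where z: "z \<in> carrier (completion R)"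
    "family_limit (\<lambda>s. f s \<oplus> \<ominus> a) = \<iota> r \<otimes>\<^bsub>completion R\<^esub> z"
    using limit_divisible[OF r cg] by blast
  have "y = family_limit (\<lambda>s. a \<oplus> (f s \<oplus> \<ominus> a))"
    unfolding f(2) using a coherentD(1)[OF f(1)] by (intro limit_cong) (simp add: add_minus_cancel)
  also have "\<dots> = \<iota> a \<oplus>\<^bsub>completion R\<^esub> \<iota> r \<otimes>\<^bsub>completion R\<^esub> z"
    using a cg by (simp add: limit_add coherent_const flip: z(2))
  finally show thesis using that a z by blast
qed

text \<open>As the powers of \<open>t\<close> are cofinal, a Cauchy sequence \<open>p\<close>
  determines a family: at index \<open>s\<close> take \<open>p N\<close> with \<open>t^N\<close> in
  \<open>s R\<close>.\<close>

lemma completion_complete: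
  assumes t: "t \<in> nz" and cofinal: "\<And>s. s \<in> nz \<Longrightarrow> \<exists>n::nat. t [^] n \<in> PIdl s"
    and p: "\<And>n. p n \<in> carrier R" "\<And>n::nat. p (Suc n) \<ominus> p n \<in> PIdl (t [^] n)"
  shows "\<exists>y\<in>carrier (completion R). \<forall>n. \<exists>z\<in>carrier (completion R).
    y = \<iota> (p n) \<oplus>\<^bsub>completion R\<^esub> \<iota> (t [^] n) \<otimes>\<^bsub>completion R\<^esub> z"
proof -
  have tc: "t \<in> carrier R" "t \<noteq> \<zero>" using t by auto
  have tn: "t [^] n \<in> carrier R" for n :: nat using tc by simp
  have tn0: "t [^] n \<in> nz" for n :: nat using nz_pow[OF t] .
  have pow_le: "t [^] n \<in> PIdl (t [^] m)" if "m \<le> n" for m n :: nat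
  proof -
    have "t [^] n = t [^] m \<otimes> t [^] (n - m)" using that tc by (simp add: nat_pow_mult)
    then show ?thesis using tn by (simp add: PIdl_mult_left)
  qed
  have p_le: "p n \<ominus> p m \<in> PIdl (t [^] m)" if "m \<le> n" for m n
    using that
  proof (induction n rule: dec_induct)
    case base
    then show ?case using p(1) tn PIdl_closed(2) by (simp add: minus_eq r_neg)
  next
    case (step n)
    have "p (Suc n) \<ominus> p n \<in> PIdl (t [^] m)"
      using p(2)[of n] pow_le[OF step(1)] PIdl_subset_iff[OF tn tn] by blast
    then have "(p (Suc n) \<ominus> p n) \<oplus> (p n \<ominus> p m) \<in> PIdl (t [^] m)"
      using step tn by (intro PIdl_closed(3))
    moreover have "(p (Suc n) \<ominus> p n) \<oplus> (p n \<ominus> p m) = p (Suc n) \<ominus> p m"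
      using p(1) by (simp add: minus_eq a_assoc r_neg2 l_neg r_neg1)
    ultimately show ?case by simp
  qed
  \<comment> \<open>Taking the least exponent makes \<open>N\<close> monotone for divisibility: a
    power of \<open>t\<close> in \<open>s R\<close> also lies in \<open>r R\<close> when
    \<open>r\<close> divides \<open>s\<close>.\<close>
  define N where "N s = (LEAST n::nat. t [^] n \<in> PIdl s)" for s
  have N: "t [^] N s \<in> PIdl s" if "s \<in> nz" for s
    unfolding N_def by (rule LeastI_ex[of "\<lambda>n. t [^] n \<in> PIdl s", OF cofinal[OF that]])
  have N_le: "N s \<le> n" if "t [^] n \<in> PIdl s" for s n
    unfolding N_def using that by (rule Least_le)
  have f: "coherent (\<lambda>s. p (N s))"
  proof (rule coherentI)
    fix r s assume rs: "r \<in> nz" "s \<in> nz" "s \<in> PIdl r"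
    then have "t [^] N s \<in> PIdl r" using N[OF rs(2)] PIdl_subset_iff[of r s] by auto
    then have "p (N s) \<ominus> p (N r) \<in> PIdl (t [^] N r)" by (intro p_le N_le)
    moreover have "PIdl (t [^] N r) \<subseteq> PIdl r"
      using N[OF rs(1)] PIdl_subset_iff[OF _ tn] rs(1) by simp
    ultimately show "p (N s) \<ominus> p (N r) \<in> PIdl r" by blast
  qed (rule p(1))
  have "\<exists>z\<in>carrier (completion R). family_limit (\<lambda>s. p (N s))
      = \<iota> (p n) \<oplus>\<^bsub>completion R\<^esub> \<iota> (t [^] n) \<otimes>\<^bsub>completion R\<^esub> z" for n
  proof -
    have cg: "coherent (\<lambda>s. p (N s) \<oplus> \<ominus> p n)" using f p(1) by (intro coherent_intros) auto
    \<comment> \<open>The inequality is enough: \<open>p n\<close> and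
      \<open>p (N (t [^] n))\<close> agree modulo \<open>t\<close> to the smaller exponent, and that
      power is itself a multiple of \<open>t^n\<close>.\<close>
    have "N (t [^] n) \<le> n" using tn by (intro N_le cgenideal_self)
    then have "p n \<ominus> p (N (t [^] n)) \<in> PIdl (t [^] n)"
      using p_le[of "N (t [^] n)" n] N[OF tn0] PIdl_subset_iff[OF tn tn] by blast
    then have "\<ominus> (p n \<ominus> p (N (t [^] n))) \<in> PIdl (t [^] n)" using tn by (intro PIdl_closed(5))
    then have "p (N (t [^] n)) \<oplus> \<ominus> p n \<in> PIdl (t [^] n)"
      using p(1) by (simp add: minus_eq minus_add a_comm)
    then obtain z where z: "z \<in> carrier (completion R)"
      "family_limit (\<lambda>s. p (N s) \<oplus> \<ominus> p n) = \<iota> (t [^] n) \<otimes>\<^bsub>completion R\<^esub> z"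
      using limit_divisible[OF tn0 cg] by blast
    have "family_limit (\<lambda>s. p (N s)) = family_limit (\<lambda>s. p n \<oplus> (p (N s) \<oplus> \<ominus> p n))"
      using p(1) by (intro limit_cong) (simp add: add_minus_cancel)
    also have "\<dots> = \<iota> (p n) \<oplus>\<^bsub>completion R\<^esub> \<iota> (t [^] n) \<otimes>\<^bsub>completion R\<^esub> z"
      using cg p(1) by (simp add: limit_add coherent_const flip: z(2))
    finally show ?thesis using z by blast
  qed
  then show ?thesis using limit_closed[OF f] by blast
qed

text \<open>All members \<open>a + t (g r)\<close> are units, since nonunits are closed under sums
  and \<open>a\<close> is a unit; their inverses again form a coherent family.\<close>

lemma completion_unit:
  assumes local: "\<And>x y. \<lbrakk>x \<in> carrier R - Units R; y \<in> carrier R - Units R\<rbrakk> \<Longrightarrow> x \<oplus> y \<in> carrier R - Units R"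
    and t: "t \<in> nz" "t \<notin> Units R" and a: "a \<in> Units R" and z: "z \<in> carrier (completion R)"
  shows "\<iota> a \<oplus>\<^bsub>completion R\<^esub> \<iota> t \<otimes>\<^bsub>completion R\<^esub> z \<in> Units (completion R)"
proof -
  interpret C: cring "completion R" by (rule completion_cring)
  have ac: "a \<in> carrier R" and tc: "t \<in> carrier R" using a t by auto
  obtain g where g: "coherent g" "z = family_limit g" by (rule completionE[OF z])
  define f where "f r = a \<oplus> t \<otimes> g r" for r
  have f: "coherent f" unfolding f_def using ac tc g by (intro coherent_intros) auto
  have nonunit_mult: "k \<otimes> x \<notin> Units R" if "k \<in> carrier R" "x \<in> carrier R" "x \<notin> Units R" for k x
    using that by (metis prod_unit_r unit_factor m_comm)
  have f_unit: "f r \<in> Units R" if r: "r \<in> nz" for r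
  proof (rule ccontr)
    have gr: "g r \<in> carrier R" using coherentD(1)[OF g(1) r] .
    assume "f r \<notin> Units R"
    moreover have "g r \<otimes> (\<ominus> t) \<notin> Units R"
    proof
      assume "g r \<otimes> (\<ominus> t) \<in> Units R"
      moreover have "g r \<otimes> (\<ominus> t) = (\<ominus> g r) \<otimes> t" using gr tc by (simp add: l_minus r_minus)
      ultimately show False using nonunit_mult[of "\<ominus> g r" t] gr tc t by simp
    qed
    ultimately have "f r \<oplus> g r \<otimes> (\<ominus> t) \<notin> Units R"
      using local coherentD(1)[OF f r] gr tc by simp
    moreover have "f r \<oplus> g r \<otimes> (\<ominus> t) = a"
      using ac tc gr unfolding f_def by (simp add: r_minus m_comm a_assoc r_neg)
    ultimately show False using a by simp
  qed
  have ic: "inv (f r) \<in> carrier R" "f r \<in> carrier R" "f r \<otimes> inv (f r) = \<one>" if "r \<in> nz" for r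
    using f_unit[OF that] by auto
  have h: "coherent (\<lambda>r. inv (f r))"
  proof (rule coherentI)
    fix r s assume rs: "r \<in> nz" "s \<in> nz" "s \<in> PIdl r"
    obtain x y u v where xyuv: "x = f r" "y = f s" "u = inv (f r)" "v = inv (f s)" by blast
    have c: "x \<in> carrier R" "y \<in> carrier R" "u \<in> carrier R" "v \<in> carrier R"
      using ic rs by (auto simp: xyuv)
    have "\<ominus> (u \<otimes> v) \<otimes> (y \<ominus> x) = (x \<otimes> u) \<otimes> v \<ominus> (y \<otimes> v) \<otimes> u"
      by (rule ring_identity, (rule reify c)+, code_simp)
    then have "inv (f s) \<ominus> inv (f r) = \<ominus> (u \<otimes> v) \<otimes> (y \<ominus> x)"
      using ic rs c by (simp add: xyuv)
    moreover have "y \<ominus> x \<in> PIdl r" using coherentD(2)[OF f rs] by (simp add: xyuv)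
    ultimately show "inv (f s) \<ominus> inv (f r) \<in> PIdl r"
      using rs c PIdl_closed(6)[of r "y \<ominus> x" "\<ominus> (u \<otimes> v)"] by auto
  qed (use ic in blast)
  have eq: "\<iota> a \<oplus>\<^bsub>completion R\<^esub> \<iota> t \<otimes>\<^bsub>completion R\<^esub> z = family_limit f"
    unfolding f_def g(2) using g(1) ac tc by (simp add: limit_ops coherent_intros)
  have "family_limit f \<otimes>\<^bsub>completion R\<^esub> family_limit (\<lambda>r. inv (f r)) = \<one>\<^bsub>completion R\<^esub>"
    using ic by (auto simp: limit_ops f h intro!: limit_cong)
  then show ?thesis
    unfolding eq using limit_closed[OF f] limit_closed[OF h] C.unit_factor C.Units_one_closed by metis
qed

end

section \<open>The prime ideal defined by a filtration\<close>

lemma (in ring) FactRing_carrierE: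
  assumes "x \<in> carrier (R Quot I)"
  shows "\<exists>y\<in>carrier R. x = I +> y"
  using assms by (auto simp: FactRing_def A_RCOSETS_def')

text \<open>\<open>I n\<close> stands for the ideal \<open>t\<^sup>n S\<^sub>n\<close>. The axioms
  record what is needed of the rings \<open>S\<^sub>n\<close>: \<open>I_step\<close> encodes
  \<open>S\<^sub>n = R + t S\<^sub>n\<^sub>+\<^sub>1\<close>, \<open>I_mult\<close> will give square
  zero, \<open>t_pow_not_I\<close> keeps \<open>t\<close> from being nilpotent modulo
  \<open>P\<close>, and \<open>I_proper\<close> keeps \<open>P\<close> from vanishing.\<close>

locale ideal_filtration = "domain" R for R (structure) +
  fixes t and I :: "nat \<Rightarrow> 'a set"
  assumes t_nz: "t \<in> nz"
    and cofinal: "s \<in> nz \<Longrightarrow> \<exists>n::nat. t [^] n \<in> PIdl s"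
    and I_add: "\<lbrakk>a \<in> I n; b \<in> I n\<rbrakk> \<Longrightarrow> a \<oplus> b \<in> I n"
    and I_smult: "\<lbrakk>r \<in> carrier R; a \<in> I n\<rbrakk> \<Longrightarrow> r \<otimes> a \<in> I n"
    and I_0: "I 0 = carrier R"
    and I_1: "I (Suc 0) = carrier R - Units R"
    and I_Suc: "I (Suc n) \<subseteq> I n"
    and t_pow_I: "t [^] n \<in> I n"
    and t_pow_not_I: "t [^] n \<notin> I (Suc n)"
    and I_t: "a \<in> I n \<Longrightarrow> t \<otimes> a \<in> I (Suc n)"
    and I_mult: "\<lbrakk>a \<in> I n; b \<in> I n\<rbrakk> \<Longrightarrow> a \<otimes> b \<in> PIdl (t [^] n)"
    and I_step: "a \<in> I n \<Longrightarrow> \<exists>c\<in>carrier R. a \<ominus> t [^] n \<otimes> c \<in> I (Suc n)"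
    and I_proper: "\<exists>a\<in>I (Suc 0). a \<notin> PIdl t"
begin

sublocale C: cring "completion R" by (rule completion_cring)

sublocale \<iota>: ring_hom_cring R "completion R" \<iota>
  by (intro ring_hom_cringI ring_hom_ringI2 ring_axioms C.ring_axioms is_cring completion_cring \<iota>_hom)

abbreviation C where "C \<equiv> completion R"

lemma I_carr: "a \<in> I n \<Longrightarrow> a \<in> carrier R"
proof (induction n)
  case 0
  then show ?case by (simp add: I_0)
next
  case (Suc n)
  then show ?case using I_Suc by blast
qed

lemma tn_nz: "t [^] (n::nat) \<in> nz" using nz_pow[OF t_nz] .

lemma t_carr [simp]: "t \<in> carrier R" using t_nz by simp

lemma tn_carr [simp]: "t [^] (n::nat) \<in> carrier R" by simp

lemma PIdl_I: "x \<in> PIdl (t [^] n) \<Longrightarrow> x \<in> I n"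
  using I_smult[OF _ t_pow_I] by (auto simp: PIdl_iff)

text \<open>The ideal of the completion \<open>C\<close> generated by \<open>I n\<close>: as
  \<open>C = R + t^n C\<close> and \<open>t^n\<close> lies in \<open>I n\<close>, the products
  collapse to this form.\<close>

definition J :: "nat \<Rightarrow> ('a \<Rightarrow> 'a set) set"
  where "J n = {\<iota> a \<oplus>\<^bsub>C\<^esub> \<iota> (t [^] n) \<otimes>\<^bsub>C\<^esub> y | a y. a \<in> I n \<and> y \<in> carrier C}"

lemma J_I: "\<lbrakk>a \<in> I n; y \<in> carrier C; x = \<iota> a \<oplus>\<^bsub>C\<^esub> \<iota> (t [^] n) \<otimes>\<^bsub>C\<^esub> y\<rbrakk> \<Longrightarrow> x \<in> J n"
  by (auto simp: J_def)

lemma J_E: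
  assumes "x \<in> J n"
  obtains a y where "a \<in> I n" "a \<in> carrier R" "y \<in> carrier C"
    "x = \<iota> a \<oplus>\<^bsub>C\<^esub> \<iota> (t [^] n) \<otimes>\<^bsub>C\<^esub> y"
  using assms I_carr by (auto simp: J_def)

lemma J_carr: "x \<in> J n \<Longrightarrow> x \<in> carrier C"
  by (auto elim!: J_E)

lemma J_add:
  assumes "x \<in> J n" "y \<in> J n"
  shows "x \<oplus>\<^bsub>C\<^esub> y \<in> J n"
proof -
  obtain a u where 1: "a \<in> I n" "a \<in> carrier R" "u \<in> carrier C"
    "x = \<iota> a \<oplus>\<^bsub>C\<^esub> \<iota> (t [^] n) \<otimes>\<^bsub>C\<^esub> u" by (rule J_E[OF assms(1)])
  obtain b v where 2: "b \<in> I n" "b \<in> carrier R" "v \<in> carrier C"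
    "y = \<iota> b \<oplus>\<^bsub>C\<^esub> \<iota> (t [^] n) \<otimes>\<^bsub>C\<^esub> v" by (rule J_E[OF assms(2)])
  have "x \<oplus>\<^bsub>C\<^esub> y = \<iota> (a \<oplus> b) \<oplus>\<^bsub>C\<^esub> \<iota> (t [^] n) \<otimes>\<^bsub>C\<^esub> (u \<oplus>\<^bsub>C\<^esub> v)"
    using 1 2 by (simp add: C.r_distr C.a_ac)
  then show ?thesis using 1 2 by (intro J_I[OF I_add[of a n b]]) auto
qed

text \<open>The part \<open>t^n C\<close> contributes only \<open>t^n R\<close> to the ring, and
  \<open>t^n R\<close> lies in \<open>I n\<close>.\<close>

lemma \<iota>_J_iff:
  assumes a: "a \<in> carrier R"
  shows "\<iota> a \<in> J n \<longleftrightarrow> a \<in> I n"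
proof
  assume "\<iota> a \<in> J n"
  then obtain b u where 1: "b \<in> I n" "b \<in> carrier R" "u \<in> carrier C"
    "\<iota> a = \<iota> b \<oplus>\<^bsub>C\<^esub> \<iota> (t [^] n) \<otimes>\<^bsub>C\<^esub> u" by (rule J_E)
  have "\<iota> (a \<oplus> \<ominus> b) = \<iota> (t [^] n) \<otimes>\<^bsub>C\<^esub> u"
    using 1 a C.add_minus_cancel[of "\<ominus>\<^bsub>C\<^esub> \<iota> b"] by (simp add: C.a_ac C.r_neg1 C.r_neg2)
  then have "a \<oplus> \<ominus> b \<in> PIdl (t [^] n)"
    using \<iota>_dvd_\<iota>_iff[OF tn_nz, of "a \<oplus> \<ominus> b"] a 1 by auto
  then have "(a \<oplus> \<ominus> b) \<oplus> b \<in> I n" using PIdl_I 1 I_add by blast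
  then show "a \<in> I n" using a 1 by (simp add: a_assoc l_neg)
next
  assume "a \<in> I n"
  then show "\<iota> a \<in> J n" using a by (intro J_I[of a n "\<zero>\<^bsub>C\<^esub>"]) auto
qed

lemma t_mult_J: "y \<in> carrier C \<Longrightarrow> \<iota> (t [^] n) \<otimes>\<^bsub>C\<^esub> y \<in> J n"
  using I_smult[OF zero_closed t_pow_I[of n]] by (intro J_I[of \<zero> n y]) auto

lemma J_mult:
  assumes "x \<in> J n" "z \<in> carrier C"
  shows "z \<otimes>\<^bsub>C\<^esub> x \<in> J n"
proof -
  obtain a u where 1: "a \<in> I n" "a \<in> carrier R" "u \<in> carrier C"
    "x = \<iota> a \<oplus>\<^bsub>C\<^esub> \<iota> (t [^] n) \<otimes>\<^bsub>C\<^esub> u" by (rule J_E[OF assms(1)])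
  obtain b v where 2: "b \<in> carrier R" "v \<in> carrier C"
    "z = \<iota> b \<oplus>\<^bsub>C\<^esub> \<iota> (t [^] n) \<otimes>\<^bsub>C\<^esub> v" by (rule completion_dense[OF assms(2) tn_nz])
  define A B T where "A = \<iota> a" and "B = \<iota> b" and "T = \<iota> (t [^] n)"
  have c: "A \<in> carrier C" "B \<in> carrier C" "T \<in> carrier C" "u \<in> carrier C" "v \<in> carrier C"
    using 1 2 by (auto simp: A_def B_def T_def)
  have "z \<otimes>\<^bsub>C\<^esub> x = B \<otimes>\<^bsub>C\<^esub> A \<oplus>\<^bsub>C\<^esub> T \<otimes>\<^bsub>C\<^esub> (z \<otimes>\<^bsub>C\<^esub> u \<oplus>\<^bsub>C\<^esub> v \<otimes>\<^bsub>C\<^esub> A)"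
    unfolding 1(4) 2(3) A_def[symmetric] B_def[symmetric] T_def[symmetric]
    by (rule C.ring_identity, (rule C.reify c)+, code_simp)
  then have zx: "z \<otimes>\<^bsub>C\<^esub> x = \<iota> (b \<otimes> a) \<oplus>\<^bsub>C\<^esub> \<iota> (t [^] n) \<otimes>\<^bsub>C\<^esub> (z \<otimes>\<^bsub>C\<^esub> u \<oplus>\<^bsub>C\<^esub> v \<otimes>\<^bsub>C\<^esub> A)"
    using 1 2 by (simp add: A_def B_def T_def)
  show ?thesis
    by (rule J_I[OF I_smult[OF 2(1) 1(1)] _ zx]) (use c assms(2) in simp)
qed

lemma J_Suc: "x \<in> J n \<Longrightarrow> \<iota> t \<otimes>\<^bsub>C\<^esub> x \<in> J (Suc n)"
proof -
  assume "x \<in> J n"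
  then obtain a u where 1: "a \<in> I n" "a \<in> carrier R" "u \<in> carrier C"
    "x = \<iota> a \<oplus>\<^bsub>C\<^esub> \<iota> (t [^] n) \<otimes>\<^bsub>C\<^esub> u" by (rule J_E)
  have "\<iota> t \<otimes>\<^bsub>C\<^esub> x = \<iota> (t \<otimes> a) \<oplus>\<^bsub>C\<^esub> \<iota> (t [^] Suc n) \<otimes>\<^bsub>C\<^esub> u"
    unfolding 1(4) using 1 by (simp add: C.r_distr C.m_ac)
  then show ?thesis using 1 I_t by (intro J_I) auto
qed

text \<open>Each of the four products has the factor \<open>t^n\<close>: three visibly, the product
  of the two elements of \<open>I n\<close> by \<open>I_mult\<close>.\<close>

lemma J_product:
  assumes "x \<in> J n" "z \<in> J n"
  shows "\<exists>y\<in>carrier C. x \<otimes>\<^bsub>C\<^esub> z = \<iota> (t [^] n) \<otimes>\<^bsub>C\<^esub> y"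
proof -
  obtain a u where 1: "a \<in> I n" "a \<in> carrier R" "u \<in> carrier C"
    "x = \<iota> a \<oplus>\<^bsub>C\<^esub> \<iota> (t [^] n) \<otimes>\<^bsub>C\<^esub> u" by (rule J_E[OF assms(1)])
  obtain b v where 2: "b \<in> I n" "b \<in> carrier R" "v \<in> carrier C"
    "z = \<iota> b \<oplus>\<^bsub>C\<^esub> \<iota> (t [^] n) \<otimes>\<^bsub>C\<^esub> v" by (rule J_E[OF assms(2)])
  obtain c where c: "c \<in> carrier R" "a \<otimes> b = c \<otimes> t [^] n"
    using I_mult[OF 1(1) 2(1)] by (auto simp: PIdl_iff)
  define A B T D where "A = \<iota> a" and "B = \<iota> b" and "T = \<iota> (t [^] n)" and "D = \<iota> c"
  have cc: "A \<in> carrier C" "B \<in> carrier C" "T \<in> carrier C" "u \<in> carrier C" "v \<in> carrier C" "D \<in> carrier C"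
    using 1 2 c by (auto simp: A_def B_def T_def D_def)
  have AB: "A \<otimes>\<^bsub>C\<^esub> B = D \<otimes>\<^bsub>C\<^esub> T"
    unfolding A_def B_def D_def T_def using 1(2) 2(2) c(1)
    by (simp only: \<iota>.hom_mult[symmetric] tn_carr c(2))
  define y where "y = D \<oplus>\<^bsub>C\<^esub> u \<otimes>\<^bsub>C\<^esub> B \<oplus>\<^bsub>C\<^esub> v \<otimes>\<^bsub>C\<^esub> A \<oplus>\<^bsub>C\<^esub> T \<otimes>\<^bsub>C\<^esub> u \<otimes>\<^bsub>C\<^esub> v"
  have y: "y \<in> carrier C" unfolding y_def using cc by (simp only: C.carrier_intros)
  have xz: "x \<otimes>\<^bsub>C\<^esub> z = T \<otimes>\<^bsub>C\<^esub> (D \<oplus>\<^bsub>C\<^esub> u \<otimes>\<^bsub>C\<^esub> B \<oplus>\<^bsub>C\<^esub> v \<otimes>\<^bsub>C\<^esub> A \<oplus>\<^bsub>C\<^esub> T \<otimes>\<^bsub>C\<^esub> u \<otimes>\<^bsub>C\<^esub> v)"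
    unfolding 1(4) 2(4) A_def[symmetric] B_def[symmetric] T_def[symmetric]
    by (rule C.ring_identity_mod[OF _ _ AB], (rule C.reify cc)+, code_simp)
  show ?thesis
    by (rule bexI[OF _ y]) (unfold y_def xz, simp only: T_def)
qed

text \<open>Modulo \<open>t\<close> an element of the completion is an element \<open>a\<close> of
  the local ring; a unit \<open>a\<close> lifts by \<open>completion_unit\<close>, a nonunit lies in
  \<open>I 1\<close>.\<close>

lemma unit_or_J: "x \<in> carrier C \<Longrightarrow> x \<in> Units C \<or> x \<in> J (Suc 0)"
proof -
  assume x: "x \<in> carrier C"
  obtain a z where a: "a \<in> carrier R" "z \<in> carrier C" "x = \<iota> a \<oplus>\<^bsub>C\<^esub> \<iota> t \<otimes>\<^bsub>C\<^esub> z"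
    by (rule completion_dense[OF x t_nz])
  have "t \<in> I (Suc 0)" using t_pow_I[of "Suc 0"] by simp
  then have t: "t \<notin> Units R" using I_1 by auto
  show ?thesis
  proof (cases "a \<in> Units R")
    case True
    have "x \<oplus> y \<in> carrier R - Units R"
      if "x \<in> carrier R - Units R" "y \<in> carrier R - Units R" for x y
      using that I_add[of x "Suc 0" y] unfolding I_1 by blast
    then show ?thesis
      using completion_unit[OF _ t_nz t True a(2)] a(3) by simp
  next
    case False
    then have "a \<in> I (Suc 0)" using a I_1 by simp
    then show ?thesis using a by (auto intro!: J_I[of a])
  qed
qed

definition P :: "('a \<Rightarrow> 'a set) set"
  where "P = {x \<in> carrier C. \<forall>n. x \<in> J n}"

lemma P_ideal: "ideal P C"
proof (rule idealI[OF C.ring_axioms])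
  have neg: "\<ominus>\<^bsub>C\<^esub> x \<in> P" if "x \<in> P" for x
  proof -
    have "\<ominus>\<^bsub>C\<^esub> x \<in> J n" for n
      using J_mult[of x n "\<ominus>\<^bsub>C\<^esub> \<one>\<^bsub>C\<^esub>"] that by (simp add: P_def C.l_minus)
    then show ?thesis using that by (simp add: P_def)
  qed
  have 0: "\<zero>\<^bsub>C\<^esub> \<in> P"
    using t_mult_J[of "\<zero>\<^bsub>C\<^esub>"] by (simp add: P_def)
  show "subgroup P (add_monoid C)"
    by (rule C.add.subgroupI) (use 0 neg in \<open>auto simp: P_def J_add a_inv_def[symmetric]\<close>)
  show "y \<otimes>\<^bsub>C\<^esub> x \<in> P" if "x \<in> P" "y \<in> carrier C" for x y
    using that by (simp add: P_def J_mult)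
  then show "x \<otimes>\<^bsub>C\<^esub> y \<in> P" if "x \<in> P" "y \<in> carrier C" for x y
    using that C.m_comm[of x y] by (simp add: P_def)
qed

text \<open>A product of two elements of \<open>P\<close> is divisible by every power of
  \<open>t\<close>, hence by every nonzero \<open>s\<close>, and the completion is
  separated.\<close>

lemma P_square: "P \<cdot>\<^bsub>C\<^esub> P = {\<zero>\<^bsub>C\<^esub>}"
proof -
  have prod0: "x \<otimes>\<^bsub>C\<^esub> y = \<zero>\<^bsub>C\<^esub>" if xy: "x \<in> P" "y \<in> P" for x y
  proof (rule completion_separated)
    show "x \<otimes>\<^bsub>C\<^esub> y \<in> carrier C" using xy by (simp add: P_def)
    fix s assume s: "s \<in> nz"
    obtain n :: nat where "t [^] n \<in> PIdl s" using cofinal[OF s] by blast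
    then obtain k where k: "k \<in> carrier R" "t [^] n = k \<otimes> s" by (auto simp: PIdl_iff)
    obtain z where z: "z \<in> carrier C" "x \<otimes>\<^bsub>C\<^esub> y = \<iota> (t [^] n) \<otimes>\<^bsub>C\<^esub> z"
      using J_product xy unfolding P_def by blast
    have "x \<otimes>\<^bsub>C\<^esub> y = \<iota> s \<otimes>\<^bsub>C\<^esub> (\<iota> k \<otimes>\<^bsub>C\<^esub> z)"
      unfolding z(2) k(2) using k s z by (simp add: C.m_ac)
    then show "\<exists>z\<in>carrier C. x \<otimes>\<^bsub>C\<^esub> y = \<iota> s \<otimes>\<^bsub>C\<^esub> z"
      using k z by (intro bexI[of _ "\<iota> k \<otimes>\<^bsub>C\<^esub> z"]) simp_all
  qed
  have zero: "x = \<zero>\<^bsub>C\<^esub>" if "x \<in> P \<cdot>\<^bsub>C\<^esub> P" for x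
    using that by (induction rule: ideal_prod.induct) (simp_all only: prod0 C.l_zero C.zero_closed)
  have "\<zero>\<^bsub>C\<^esub> \<in> P"
    using additive_subgroup.zero_closed[OF ideal.axioms(1)[OF P_ideal]] .
  then have "\<zero>\<^bsub>C\<^esub> \<otimes>\<^bsub>C\<^esub> \<zero>\<^bsub>C\<^esub> \<in> P \<cdot>\<^bsub>C\<^esub> P" by (intro ideal_prod.prod)
  then have "\<zero>\<^bsub>C\<^esub> \<in> P \<cdot>\<^bsub>C\<^esub> P" by (simp only: C.l_null[OF C.zero_closed])
  with zero show ?thesis by blast
qed

text \<open>Iterating \<open>I_step\<close> writes \<open>a\<close> as a series
  \<open>t c1 + t^2 c2 + ...\<close> up to remainders in the ideals \<open>I n\<close>. The series
  converges in the completion to a multiple of \<open>t\<close>, and the remainders place its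
  difference from \<open>a\<close> in every \<open>J n\<close>.\<close>

lemma I_expansion:
  assumes a: "a \<in> I (Suc 0)"
  obtains y where "y \<in> carrier C" "\<iota> a \<ominus>\<^bsub>C\<^esub> \<iota> t \<otimes>\<^bsub>C\<^esub> y \<in> P"
proof -
  \<comment> \<open>The remainders: \<open>e n\<close> is what is left after \<open>n\<close> terms,
    one index ahead in the filtration because \<open>a\<close> starts in \<open>I 1\<close>.\<close>
  have "\<exists>e. (e 0 = a \<and> e 0 \<in> I (Suc 0)) \<and> (\<forall>n. (e (Suc n) \<in> I (Suc (Suc n))
      \<and> (\<exists>c\<in>carrier R. e (Suc n) = e n \<ominus> t [^] Suc n \<otimes> c)))"
  proof -
    have "\<exists>e. \<forall>n. (e n \<in> I (Suc n) \<and> (n = 0 \<longrightarrow> e n = a)) \<and>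
       (\<exists>c\<in>carrier R. e (Suc n) = e n \<ominus> t [^] Suc n \<otimes> c)"
    proof (rule dependent_nat_choice)
      show "\<exists>x. x \<in> I (Suc 0) \<and> (0 = (0::nat) \<longrightarrow> x = a)" using a by blast
      show "\<exists>y. (y \<in> I (Suc (Suc n)) \<and> (Suc n = 0 \<longrightarrow> y = a)) \<and>
          (\<exists>c\<in>carrier R. y = x \<ominus> t [^] Suc n \<otimes> c)"
        if "x \<in> I (Suc n) \<and> (n = 0 \<longrightarrow> x = a)" for x n
        using I_step[of x "Suc n"] that by blast
    qed
    then show ?thesis by blast
  qed
  then obtain e where e0: "e 0 = a" and e: "\<And>n. e n \<in> I (Suc n)"
    and step: "\<And>n. \<exists>c\<in>carrier R. e (Suc n) = e n \<ominus> t [^] Suc n \<otimes> c"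
    by (metis not0_implies_Suc)
  have ec: "e n \<in> carrier R" for n using e I_carr by blast
  have ac: "a \<in> carrier R" using a I_carr by blast
  define p where "p n = a \<ominus> e n" for n
  have p: "p n \<in> carrier R" for n using ac ec by (simp add: p_def)
  \<comment> \<open>The increment is divisible by \<open>t^(n+1)\<close>. Splitting off
    \<open>t^n\<close> serves convergence; at \<open>n = 0\<close> the other factor \<open>t\<close>
    is what makes the limit a multiple of \<open>t\<close>.\<close>
  have diff: "\<exists>c\<in>carrier R. p (Suc n) \<ominus> p n = t [^] n \<otimes> (t \<otimes> c)" for n
  proof -
    obtain c where c: "c \<in> carrier R" "e (Suc n) = e n \<ominus> t [^] Suc n \<otimes> c" using step by blast
    define u v where "u = e n" and "v = t [^] n"
    have cc: "u \<in> carrier R" "v \<in> carrier R" "a \<in> carrier R" "c \<in> carrier R" "t \<in> carrier R"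
      using ec ac c by (auto simp: u_def v_def)
    have "p (Suc n) \<ominus> p n = (a \<ominus> (u \<ominus> v \<otimes> t \<otimes> c)) \<ominus> (a \<ominus> u)"
      unfolding p_def c(2) u_def v_def by simp
    also have "\<dots> = v \<otimes> (t \<otimes> c)"
      by (rule ring_identity, (rule reify cc)+, code_simp)
    finally show ?thesis using c by (auto simp: v_def)
  qed
  have pd: "p (Suc n) \<ominus> p n \<in> PIdl (t [^] n)" for n
    using diff[of n] by (metis PIdl_mult_left m_closed t_carr tn_carr)
  obtain g where g: "g \<in> carrier C"
    "\<And>n. \<exists>z\<in>carrier C. g = \<iota> (p n) \<oplus>\<^bsub>C\<^esub> \<iota> (t [^] n) \<otimes>\<^bsub>C\<^esub> z"
    using completion_complete[OF t_nz cofinal p pd] by blast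
  have "\<iota> a \<ominus>\<^bsub>C\<^esub> g \<in> J n" for n
  proof -
    obtain z where z: "z \<in> carrier C" "g = \<iota> (p n) \<oplus>\<^bsub>C\<^esub> \<iota> (t [^] n) \<otimes>\<^bsub>C\<^esub> z" using g(2) by blast
    define A B T where "A = \<iota> a" and "B = \<iota> (e n)" and "T = \<iota> (t [^] n)"
    have cc: "A \<in> carrier C" "B \<in> carrier C" "T \<in> carrier C" "z \<in> carrier C"
      using ac ec z by (auto simp: A_def B_def T_def)
    have pn: "\<iota> (p n) = A \<oplus>\<^bsub>C\<^esub> \<ominus>\<^bsub>C\<^esub> B" using ac ec by (simp add: p_def A_def B_def minus_eq)
    have "A \<ominus>\<^bsub>C\<^esub> (A \<oplus>\<^bsub>C\<^esub> \<ominus>\<^bsub>C\<^esub> B \<oplus>\<^bsub>C\<^esub> T \<otimes>\<^bsub>C\<^esub> z) = B \<oplus>\<^bsub>C\<^esub> T \<otimes>\<^bsub>C\<^esub> (\<ominus>\<^bsub>C\<^esub> z)"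
      by (rule C.ring_identity, (rule C.reify cc)+, code_simp)
    then have "\<iota> a \<ominus>\<^bsub>C\<^esub> g = \<iota> (e n) \<oplus>\<^bsub>C\<^esub> \<iota> (t [^] n) \<otimes>\<^bsub>C\<^esub> (\<ominus>\<^bsub>C\<^esub> z)"
      unfolding z(2) pn by (simp add: A_def B_def T_def)
    then show ?thesis using e I_Suc z by (intro J_I[of "e n" n "\<ominus>\<^bsub>C\<^esub> z"]) auto
  qed
  then have P: "\<iota> a \<ominus>\<^bsub>C\<^esub> g \<in> P" using ac g by (simp add: P_def)
  \<comment> \<open>Reading the limit at index 1, where the partial sum is \<open>t c\<close>,
    exhibits the factor \<open>t\<close>.\<close>
  obtain c where c: "c \<in> carrier R" "p (Suc 0) \<ominus> p 0 = t [^] (0::nat) \<otimes> (t \<otimes> c)" using diff by blast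
  have "p 0 = \<zero>" using ac by (simp add: p_def e0 minus_eq r_neg)
  then have p1: "p (Suc 0) = t \<otimes> c" using c p[of "Suc 0"] by simp
  obtain z where z: "z \<in> carrier C" "g = \<iota> (p (Suc 0)) \<oplus>\<^bsub>C\<^esub> \<iota> (t [^] Suc 0) \<otimes>\<^bsub>C\<^esub> z" using g(2) by blast
  have "g = \<iota> t \<otimes>\<^bsub>C\<^esub> (\<iota> c \<oplus>\<^bsub>C\<^esub> z)"
    unfolding z(2) p1 using c z by (simp add: C.r_distr)
  then show thesis using that[of "\<iota> c \<oplus>\<^bsub>C\<^esub> z"] c z P by simp
qed

lemma J_1_mod_P:
  assumes x: "x \<in> J (Suc 0)"
  obtains y where "y \<in> carrier C" "x \<ominus>\<^bsub>C\<^esub> \<iota> t \<otimes>\<^bsub>C\<^esub> y \<in> P"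
proof -
  obtain a u where 1: "a \<in> I (Suc 0)" "a \<in> carrier R" "u \<in> carrier C"
    "x = \<iota> a \<oplus>\<^bsub>C\<^esub> \<iota> (t [^] Suc 0) \<otimes>\<^bsub>C\<^esub> u" by (rule J_E[OF assms(1)])
  obtain y where y: "y \<in> carrier C" "\<iota> a \<ominus>\<^bsub>C\<^esub> \<iota> t \<otimes>\<^bsub>C\<^esub> y \<in> P" by (rule I_expansion[OF 1(1)])
  define A T where "A = \<iota> a" and "T = \<iota> t"
  have cc: "A \<in> carrier C" "T \<in> carrier C" "u \<in> carrier C" "y \<in> carrier C"
    using 1 y by (auto simp: A_def T_def)
  have "A \<oplus>\<^bsub>C\<^esub> T \<otimes>\<^bsub>C\<^esub> u \<ominus>\<^bsub>C\<^esub> T \<otimes>\<^bsub>C\<^esub> (u \<oplus>\<^bsub>C\<^esub> y) = A \<ominus>\<^bsub>C\<^esub> T \<otimes>\<^bsub>C\<^esub> y"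
    by (rule C.ring_identity, (rule C.reify cc)+, code_simp)
  then have "x \<ominus>\<^bsub>C\<^esub> \<iota> t \<otimes>\<^bsub>C\<^esub> (u \<oplus>\<^bsub>C\<^esub> y) \<in> P"
    unfolding 1(4) using y by (simp add: A_def T_def)
  then show thesis by (rule that[OF C.a_closed[OF 1(3) y(1)]])
qed

text \<open>Otherwise an element of \<open>I 1\<close> outside \<open>t R\<close> would be a
  multiple of \<open>t\<close> in the completion, hence in the ring.\<close>

lemma P_nonzero: "P \<noteq> {\<zero>\<^bsub>C\<^esub>}"
proof
  assume P0: "P = {\<zero>\<^bsub>C\<^esub>}"
  obtain a where a: "a \<in> I (Suc 0)" "a \<notin> PIdl t" using I_proper by blast
  have ac: "a \<in> carrier R" using a I_carr by blast
  obtain y where y: "y \<in> carrier C" "\<iota> a \<ominus>\<^bsub>C\<^esub> \<iota> t \<otimes>\<^bsub>C\<^esub> y \<in> P" by (rule I_expansion[OF a(1)])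
  then have "\<iota> a = \<iota> t \<otimes>\<^bsub>C\<^esub> y" using P0 ac C.eq_diff0 by simp
  then show False using \<iota>_dvd_\<iota>_iff[OF t_nz ac] a y by blast
qed

text \<open>A nonunit \<open>x\<close> is \<open>t y\<close> modulo \<open>P\<close>, and
  \<open>y\<close> avoids a \<open>J\<close> of smaller index, since \<open>t\<close> moves
  \<open>J n\<close> into \<open>J (Suc n)\<close>. The descent ends because \<open>J 0\<close> is
  the whole completion.\<close>

lemma factor_mod_P:
  "\<lbrakk>x \<in> carrier C; x \<notin> J n\<rbrakk> \<Longrightarrow>
    \<exists>(k::nat) u. u \<in> Units C \<and> x \<ominus>\<^bsub>C\<^esub> \<iota> t [^]\<^bsub>C\<^esub> k \<otimes>\<^bsub>C\<^esub> u \<in> P"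
proof (induction n arbitrary: x)
  case 0
  then show ?case using t_mult_J[of x 0] by (simp add: C.ring_axioms)
next
  case (Suc n)
  interpret P: ideal P C by (rule P_ideal)
  show ?case
  proof (cases "x \<in> Units C")
    case True
    have "x \<ominus>\<^bsub>C\<^esub> \<iota> t [^]\<^bsub>C\<^esub> (0::nat) \<otimes>\<^bsub>C\<^esub> x = \<zero>\<^bsub>C\<^esub>"
      using Suc.prems(1) by (simp add: C.minus_eq C.r_neg)
    then show ?thesis using True P.zero_closed by metis
  next
    case False
    then have "x \<in> J (Suc 0)" using unit_or_J Suc.prems by blast
    then obtain y where y: "y \<in> carrier C" "x \<ominus>\<^bsub>C\<^esub> \<iota> t \<otimes>\<^bsub>C\<^esub> y \<in> P" by (rule J_1_mod_P)
    define T where "T = \<iota> t"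
    have T: "T \<in> carrier C" by (simp add: T_def)
    have "y \<notin> J n"
    proof
      assume "y \<in> J n"
      then have "T \<otimes>\<^bsub>C\<^esub> y \<in> J (Suc n)" unfolding T_def by (rule J_Suc)
      moreover have "x \<ominus>\<^bsub>C\<^esub> T \<otimes>\<^bsub>C\<^esub> y \<in> J (Suc n)" using y(2) unfolding P_def T_def by blast
      ultimately have "(x \<ominus>\<^bsub>C\<^esub> T \<otimes>\<^bsub>C\<^esub> y) \<oplus>\<^bsub>C\<^esub> T \<otimes>\<^bsub>C\<^esub> y \<in> J (Suc n)" by (intro J_add)
      moreover have "(x \<ominus>\<^bsub>C\<^esub> T \<otimes>\<^bsub>C\<^esub> y) \<oplus>\<^bsub>C\<^esub> T \<otimes>\<^bsub>C\<^esub> y = x"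
        by (rule C.ring_identity, (rule C.reify y(1) T Suc.prems(1))+, code_simp)
      ultimately show False using Suc.prems(2) by simp
    qed
    then obtain k :: nat and u where u: "u \<in> Units C" "y \<ominus>\<^bsub>C\<^esub> T [^]\<^bsub>C\<^esub> k \<otimes>\<^bsub>C\<^esub> u \<in> P"
      using Suc.IH[OF y(1)] unfolding T_def by blast
    define w where "w = T [^]\<^bsub>C\<^esub> k"
    have c: "x \<in> carrier C" "y \<in> carrier C" "u \<in> carrier C" "w \<in> carrier C" "T \<in> carrier C"
      using Suc.prems y u T by (auto simp: w_def)
    have "x \<ominus>\<^bsub>C\<^esub> (w \<otimes>\<^bsub>C\<^esub> T) \<otimes>\<^bsub>C\<^esub> u = (x \<ominus>\<^bsub>C\<^esub> T \<otimes>\<^bsub>C\<^esub> y) \<oplus>\<^bsub>C\<^esub> T \<otimes>\<^bsub>C\<^esub> (y \<ominus>\<^bsub>C\<^esub> w \<otimes>\<^bsub>C\<^esub> u)"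
      by (rule C.ring_identity, (rule C.reify c)+, code_simp)
    also have "\<dots> \<in> P" using y(2) u(2) T by (auto simp: w_def T_def intro!: P.a_closed P.I_l_closed)
    finally have "x \<ominus>\<^bsub>C\<^esub> \<iota> t [^]\<^bsub>C\<^esub> Suc k \<otimes>\<^bsub>C\<^esub> u \<in> P" by (simp add: w_def T_def)
    then show ?thesis using u(1) by blast
  qed
qed

lemma quotient_dvr: "dvr (C Quot P)"
proof -
  interpret P: ideal P C by (rule P_ideal)
  interpret Q: cring "C Quot P" by (rule P.quotient_is_cring[OF C.is_cring])
  interpret h: ring_hom_cring C "C Quot P" "(+>\<^bsub>C\<^esub>) P" by (rule P.rcos_ring_hom_cring[OF C.is_cring])
  define T where "T = \<iota> t"
  have T: "T \<in> carrier C" by (simp add: T_def)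
  have pow: "(P +>\<^bsub>C\<^esub> x) [^]\<^bsub>C Quot P\<^esub> (n::nat) = P +>\<^bsub>C\<^esub> (x [^]\<^bsub>C\<^esub> n)" if "x \<in> carrier C" for x n
    using that by (induction n) auto
  have Tn: "T [^]\<^bsub>C\<^esub> n = \<iota> (t [^] n)" for n :: nat
    unfolding T_def by (induction n) auto
  have zero_iff: "P +>\<^bsub>C\<^esub> x = \<zero>\<^bsub>C Quot P\<^esub> \<longleftrightarrow> x \<in> P" if "x \<in> carrier C" for x
    using that C.ideal_coset_eq_iff[OF P_ideal that C.zero_closed]
    by (simp only: h.hom_zero C.minus_0_r)
  have coset_eq: "P +>\<^bsub>C\<^esub> x = P +>\<^bsub>C\<^esub> y \<longleftrightarrow> x \<ominus>\<^bsub>C\<^esub> y \<in> P" if "x \<in> carrier C" "y \<in> carrier C" for x y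
    using C.ideal_coset_eq_iff[OF P_ideal that] .
  have surj: "\<exists>y\<in>carrier C. x = P +>\<^bsub>C\<^esub> y" if "x \<in> carrier (C Quot P)" for x
    using C.FactRing_carrierE[OF that] .
  show ?thesis
  proof (rule Q.dvr_criterion[of "P +>\<^bsub>C\<^esub> T"])
    show "P +>\<^bsub>C\<^esub> T \<in> carrier (C Quot P)" using T by simp
    show "(P +>\<^bsub>C\<^esub> T) [^]\<^bsub>C Quot P\<^esub> n \<noteq> \<zero>\<^bsub>C Quot P\<^esub>" for n :: nat
    proof
      assume "(P +>\<^bsub>C\<^esub> T) [^]\<^bsub>C Quot P\<^esub> n = \<zero>\<^bsub>C Quot P\<^esub>"
      then have "P +>\<^bsub>C\<^esub> (T [^]\<^bsub>C\<^esub> n) = \<zero>\<^bsub>C Quot P\<^esub>" unfolding pow[OF T] .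
      then have "T [^]\<^bsub>C\<^esub> n \<in> P" using zero_iff[OF C.nat_pow_closed[OF T, of n]] by blast
      then have "\<iota> (t [^] n) \<in> P" by (simp only: Tn)
      then have "\<iota> (t [^] n) \<in> J (Suc n)" unfolding P_def by blast
      then show False using \<iota>_J_iff[OF tn_carr] t_pow_not_I by blast
    qed
    \<comment> \<open>If \<open>t\<close> were a unit modulo \<open>P\<close>, then \<open>1\<close>
      would lie in \<open>J 1\<close>, which meets the ring in its nonunits.\<close>
    show "P +>\<^bsub>C\<^esub> T \<notin> Units (C Quot P)"
    proof
      assume "P +>\<^bsub>C\<^esub> T \<in> Units (C Quot P)"
      then obtain v where v: "v \<in> carrier (C Quot P)" "(P +>\<^bsub>C\<^esub> T) \<otimes>\<^bsub>C Quot P\<^esub> v = \<one>\<^bsub>C Quot P\<^esub>"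
        using Q.Units_r_inv_ex by blast
      then obtain u where u: "u \<in> carrier C" "v = P +>\<^bsub>C\<^esub> u" using surj by blast
      have "P +>\<^bsub>C\<^esub> (T \<otimes>\<^bsub>C\<^esub> u) = P +>\<^bsub>C\<^esub> \<one>\<^bsub>C\<^esub>"
        using v(2) unfolding u(2) h.hom_mult[OF T u(1)] h.hom_one .
      then have "T \<otimes>\<^bsub>C\<^esub> u \<ominus>\<^bsub>C\<^esub> \<one>\<^bsub>C\<^esub> \<in> P"
        using coset_eq[OF C.m_closed[OF T u(1)] C.one_closed] by blast
      then have j1: "T \<otimes>\<^bsub>C\<^esub> u \<ominus>\<^bsub>C\<^esub> \<one>\<^bsub>C\<^esub> \<in> J (Suc 0)" unfolding P_def by blast
      have j2: "T \<otimes>\<^bsub>C\<^esub> u \<in> J (Suc 0)" using t_mult_J[OF u(1), of "Suc 0"] by (simp add: T_def)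
      have "(\<ominus>\<^bsub>C\<^esub> \<one>\<^bsub>C\<^esub>) \<otimes>\<^bsub>C\<^esub> (T \<otimes>\<^bsub>C\<^esub> u \<ominus>\<^bsub>C\<^esub> \<one>\<^bsub>C\<^esub>) \<oplus>\<^bsub>C\<^esub> T \<otimes>\<^bsub>C\<^esub> u \<in> J (Suc 0)"
        by (rule J_add[OF J_mult[OF j1 C.a_inv_closed[OF C.one_closed]] j2])
      moreover have "(\<ominus>\<^bsub>C\<^esub> \<one>\<^bsub>C\<^esub>) \<otimes>\<^bsub>C\<^esub> (T \<otimes>\<^bsub>C\<^esub> u \<ominus>\<^bsub>C\<^esub> \<one>\<^bsub>C\<^esub>) \<oplus>\<^bsub>C\<^esub> T \<otimes>\<^bsub>C\<^esub> u = \<one>\<^bsub>C\<^esub>"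
        by (rule C.ring_identity, (rule C.reify u(1) T)+, code_simp)
      ultimately have "\<iota> \<one> \<in> J (Suc 0)" by (simp only: \<iota>.hom_one)
      then have "\<one> \<in> I (Suc 0)" by (simp only: \<iota>_J_iff[OF one_closed])
      then show False unfolding I_1 by blast
    qed
    fix x assume x: "x \<in> carrier (C Quot P)" "x \<noteq> \<zero>\<^bsub>C Quot P\<^esub>"
    obtain y where y: "y \<in> carrier C" "x = P +>\<^bsub>C\<^esub> y" using surj[OF x(1)] by blast
    then have "y \<notin> P" using x(2) zero_iff by blast
    then obtain n where "y \<notin> J n" using y(1) unfolding P_def by blast
    then obtain k :: nat and u where u: "u \<in> Units C" "y \<ominus>\<^bsub>C\<^esub> T [^]\<^bsub>C\<^esub> k \<otimes>\<^bsub>C\<^esub> u \<in> P"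
      using factor_mod_P[OF y(1)] unfolding T_def by blast
    have uc: "u \<in> carrier C" by (rule C.Units_closed[OF u(1)])
    have Tk: "T [^]\<^bsub>C\<^esub> k \<in> carrier C" using T by (rule C.nat_pow_closed)
    have "x = P +>\<^bsub>C\<^esub> (T [^]\<^bsub>C\<^esub> k \<otimes>\<^bsub>C\<^esub> u)"
      using u(2) coset_eq[OF y(1) C.m_closed[OF Tk uc]] y(2) by blast
    then have "x = (P +>\<^bsub>C\<^esub> T) [^]\<^bsub>C Quot P\<^esub> k \<otimes>\<^bsub>C Quot P\<^esub> (P +>\<^bsub>C\<^esub> u)"
      unfolding h.hom_mult[OF Tk uc] pow[OF T] .
    moreover have "P +>\<^bsub>C\<^esub> u \<in> Units (C Quot P)"
    proof -
      have "(P +>\<^bsub>C\<^esub> u) \<otimes>\<^bsub>C Quot P\<^esub> (P +>\<^bsub>C\<^esub> inv\<^bsub>C\<^esub> u) = \<one>\<^bsub>C Quot P\<^esub>"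
        unfolding h.hom_mult[OF uc C.Units_inv_closed[OF u(1)], symmetric] C.Units_r_inv[OF u(1)]
        by (rule h.hom_one)
      then show ?thesis
        using Q.unit_factor[OF _ h.hom_closed[OF uc] h.hom_closed[OF C.Units_inv_closed[OF u(1)]]]
          Q.Units_one_closed by metis
    qed
    ultimately show "\<exists>(n::nat) u. u \<in> Units (C Quot P) \<and> x = (P +>\<^bsub>C\<^esub> T) [^]\<^bsub>C Quot P\<^esub> n \<otimes>\<^bsub>C Quot P\<^esub> u"
      by blast
  qed
qed

theorem square_zero_prime:
  "\<exists>P. primeideal P C \<and> P \<noteq> {\<zero>\<^bsub>C\<^esub>} \<and> P \<cdot>\<^bsub>C\<^esub> P = {\<zero>\<^bsub>C\<^esub>} \<and> dvr (C Quot P)"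
proof (intro exI conjI)
  have "domain (C Quot P)"
    using quotient_dvr unfolding dvr_def principal_domain_def by blast
  then show "primeideal P C" using C.quot_domain_imp_primeideal[OF P_ideal] by blast
qed (rule P_nonzero P_square quotient_dvr)+

end

section \<open>Stable local subrings of a field\<close>

definition nonunits :: "('a, 'm) ring_scheme \<Rightarrow> 'a set \<Rightarrow> 'a set"
  where "nonunits K S = {x \<in> S. \<forall>y\<in>S. x \<otimes>\<^bsub>K\<^esub> y \<noteq> \<one>\<^bsub>K\<^esub>}"

definition submodule_over :: "('a, 'm) ring_scheme \<Rightarrow> 'a set \<Rightarrow> 'a set \<Rightarrow> bool"
  where "submodule_over K S I \<longleftrightarrow> I \<subseteq> carrier K \<and> \<zero>\<^bsub>K\<^esub> \<in> I \<and>
    (\<forall>x\<in>I. \<forall>y\<in>I. x \<oplus>\<^bsub>K\<^esub> y \<in> I) \<and> (\<forall>s\<in>S. \<forall>x\<in>I. s \<otimes>\<^bsub>K\<^esub> x \<in> I)"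

text \<open>Quantifying over such \<open>H\<close> replaces finite sums: an element is a finite sum
  of given products exactly when every such \<open>H\<close> that contains them contains it. With
  \<open>H\<close> the nonunits of a local ring this yields a single product outside
  \<open>H\<close>.\<close>

definition sum_closed :: "('a, 'm) ring_scheme \<Rightarrow> 'a set \<Rightarrow> bool"
  where "sum_closed K H \<longleftrightarrow> \<zero>\<^bsub>K\<^esub> \<in> H \<and> (\<forall>x\<in>H. \<forall>y\<in>H. x \<oplus>\<^bsub>K\<^esub> y \<in> H)"

definition dual :: "('a, 'm) ring_scheme \<Rightarrow> 'a set \<Rightarrow> 'a set"
  where "dual K I = {q \<in> carrier K. \<forall>x\<in>I. \<forall>y\<in>I. q \<otimes>\<^bsub>K\<^esub> (x \<otimes>\<^bsub>K\<^esub> y) \<in> I}"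

text \<open>As \<open>dual K I\<close> is \<open>(I : I\<^sup>2)\<close>, the inverse of \<open>I\<close> as a module over \<open>(I : I)\<close>, this says that \<open>1\<close> is a
  sum of products \<open>q x\<close> with \<open>q\<close> in the inverse and \<open>x\<close> in \<open>I\<close>.\<close>

definition invertible_over_endo :: "('a, 'm) ring_scheme \<Rightarrow> 'a set \<Rightarrow> bool"
  where "invertible_over_endo K I \<longleftrightarrow>
    (\<forall>H. sum_closed K H \<and> (\<forall>q\<in>dual K I. \<forall>x\<in>I. q \<otimes>\<^bsub>K\<^esub> x \<in> H) \<longrightarrow> \<one>\<^bsub>K\<^esub> \<in> H)"

definition endo_nonunits :: "('a, 'm) ring_scheme \<Rightarrow> 'a set \<Rightarrow> 'a set"
  where "endo_nonunits K S =
    {x \<in> carrier K. \<forall>m\<in>nonunits K S. x \<otimes>\<^bsub>K\<^esub> m \<in> nonunits K S}"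

definition affine_span :: "('a, 'm) ring_scheme \<Rightarrow> 'a set \<Rightarrow> 'a \<Rightarrow> 'a set"
  where "affine_span K S x = {a \<oplus>\<^bsub>K\<^esub> b \<otimes>\<^bsub>K\<^esub> x | a b. a \<in> S \<and> b \<in> S}"

lemma invertible_over_endoE:
  assumes "invertible_over_endo K I" "sum_closed K H" "\<one>\<^bsub>K\<^esub> \<notin> H"
  obtains q x where "q \<in> dual K I" "x \<in> I" "q \<otimes>\<^bsub>K\<^esub> x \<notin> H"
  using assms unfolding invertible_over_endo_def by blast

text \<open>These are properties that survive the passage to the endomorphism ring of the nonunits
  when that ring is local: locality, invertibility of every nonzero fractional ideal over its own
  endomorphisms, and, from dimension one, that inverting any nonzero nonunit yields all of
  \<open>K\<close>. The last axiom excludes fields.\<close>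

locale stable_subring = field K for K (structure) +
  fixes S
  assumes subring_S: "subring S K"
    and nonunits_add: "\<lbrakk>x \<in> nonunits K S; y \<in> nonunits K S\<rbrakk> \<Longrightarrow> x \<oplus> y \<in> nonunits K S"
    and invertible_fractional: "\<lbrakk>submodule_over K S I; I \<noteq> {\<zero>}; c \<in> carrier K; c \<noteq> \<zero>;
      \<And>x. x \<in> I \<Longrightarrow> c \<otimes> x \<in> S\<rbrakk> \<Longrightarrow> invertible_over_endo K I"
    and absorbing: "\<lbrakk>m \<in> nonunits K S; m \<noteq> \<zero>; z \<in> carrier K\<rbrakk> \<Longrightarrow> \<exists>n::nat. m [^] n \<otimes> z \<in> S"
    and nonunits_nontrivial: "nonunits K S \<noteq> {\<zero>}"
begin

abbreviation M where "M \<equiv> nonunits K S"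
abbreviation E where "E \<equiv> endo_nonunits K S"

lemma S_carr [simp]: "x \<in> S \<Longrightarrow> x \<in> carrier K"
  using subringE(1)[OF subring_S] by blast

lemma S_closed [simp]:
  "\<one> \<in> S" "\<zero> \<in> S"
  "x \<in> S \<Longrightarrow> \<ominus> x \<in> S"
  "\<lbrakk>x \<in> S; y \<in> S\<rbrakk> \<Longrightarrow> x \<oplus> y \<in> S"
  "\<lbrakk>x \<in> S; y \<in> S\<rbrakk> \<Longrightarrow> x \<ominus> y \<in> S"
  "\<lbrakk>x \<in> S; y \<in> S\<rbrakk> \<Longrightarrow> x \<otimes> y \<in> S"
  using subringE[OF subring_S] by (auto simp: minus_eq)

lemma M_I: "\<lbrakk>x \<in> S; \<And>y. y \<in> S \<Longrightarrow> x \<otimes> y \<noteq> \<one>\<rbrakk> \<Longrightarrow> x \<in> M"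
  unfolding nonunits_def by blast

lemma M_D: "\<lbrakk>x \<in> M; y \<in> S\<rbrakk> \<Longrightarrow> x \<otimes> y \<noteq> \<one>"
  unfolding nonunits_def by blast

lemma M_S: "m \<in> M \<Longrightarrow> m \<in> S"
  unfolding nonunits_def by blast

lemma M_carr [simp]: "m \<in> M \<Longrightarrow> m \<in> carrier K"
  by (simp add: M_S)

lemma M_smult [simp]:
  assumes "s \<in> S" "m \<in> M"
  shows "s \<otimes> m \<in> M" "m \<otimes> s \<in> M"
proof -
  have [simp]: "m \<in> S" using assms by (simp add: M_S)
  have "m \<otimes> s \<otimes> y \<noteq> \<one>" if "y \<in> S" for y
    using M_D[OF assms(2), of "s \<otimes> y"] assms that by (simp add: m_assoc)
  then show "m \<otimes> s \<in> M" using assms by (intro M_I) simp_all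
  then show "s \<otimes> m \<in> M" using assms by (simp add: m_comm)
qed

lemma one_notin_M: "\<one> \<notin> M"
  using M_D[of \<one> \<one>] by auto

lemma notin_M_unit:
  assumes "x \<in> S" "x \<notin> M"
  obtains y where "y \<in> S" "y \<in> carrier K" "x \<otimes> y = \<one>"
  using assms M_I S_carr by blast

lemma zero_M [simp]: "\<zero> \<in> M"
  by (rule M_I) auto

lemma M_closed [simp]:
  "x \<in> M \<Longrightarrow> \<ominus> x \<in> M"
  "\<lbrakk>x \<in> M; y \<in> M\<rbrakk> \<Longrightarrow> x \<oplus> y \<in> M"
  "\<lbrakk>x \<in> M; y \<in> M\<rbrakk> \<Longrightarrow> x \<ominus> y \<in> M"
proof -
  show neg: "\<ominus> x \<in> M" if "x \<in> M" for x
    using M_smult(1)[of "\<ominus> \<one>" x] that by (simp add: l_minus)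
  show "\<lbrakk>x \<in> M; y \<in> M\<rbrakk> \<Longrightarrow> x \<oplus> y \<in> M" by (rule nonunits_add)
  show "\<lbrakk>x \<in> M; y \<in> M\<rbrakk> \<Longrightarrow> x \<ominus> y \<in> M" by (simp add: minus_eq nonunits_add neg)
qed

lemma add_M_notin:
  assumes "a \<in> S" "a \<notin> M" "m \<in> M"
  shows "a \<oplus> m \<notin> M"
proof
  assume "a \<oplus> m \<in> M"
  then have "(a \<oplus> m) \<ominus> m \<in> M" using assms by (meson M_closed)
  moreover have "(a \<oplus> m) \<ominus> m = a"
  proof -
    have c: "a \<in> carrier K" "m \<in> carrier K" using assms by simp_all
    show ?thesis by (rule ring_identity, (rule reify c)+, code_simp)
  qed
  ultimately show False using assms by simp
qed

lemma mult_notin_M: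
  assumes "a \<in> S" "a \<notin> M" "b \<in> S" "b \<notin> M"
  shows "a \<otimes> b \<notin> M"
proof
  assume ab: "a \<otimes> b \<in> M"
  obtain c where c: "c \<in> S" "a \<otimes> c = \<one>" using assms notin_M_unit by metis
  have "c \<otimes> (a \<otimes> b) \<in> M" using ab c by simp
  moreover have "c \<otimes> (a \<otimes> b) = b"
    using assms c by (metis S_carr l_one m_assoc m_comm)
  ultimately show False using assms by simp
qed

lemma E_I: "\<lbrakk>x \<in> carrier K; \<And>m. m \<in> M \<Longrightarrow> x \<otimes> m \<in> M\<rbrakk> \<Longrightarrow> x \<in> E"
  unfolding endo_nonunits_def by blast

lemma E_carr [simp]: "x \<in> E \<Longrightarrow> x \<in> carrier K"
  unfolding endo_nonunits_def by blast

lemma E_M [simp]: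
  assumes "x \<in> E" "m \<in> M"
  shows "x \<otimes> m \<in> M" "m \<otimes> x \<in> M"
proof -
  show "x \<otimes> m \<in> M" using assms unfolding endo_nonunits_def by blast
  then show "m \<otimes> x \<in> M" using assms by (simp add: m_comm)
qed

lemma S_E: "x \<in> S \<Longrightarrow> x \<in> E"
  by (rule E_I) auto

lemma E_closed [simp]:
  "x \<in> E \<Longrightarrow> \<ominus> x \<in> E"
  "\<lbrakk>x \<in> E; y \<in> E\<rbrakk> \<Longrightarrow> x \<oplus> y \<in> E"
  "\<lbrakk>x \<in> E; y \<in> E\<rbrakk> \<Longrightarrow> x \<ominus> y \<in> E"
  "\<lbrakk>x \<in> E; y \<in> E\<rbrakk> \<Longrightarrow> x \<otimes> y \<in> E"
  "\<one> \<in> E" "\<zero> \<in> E"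
  by (rule E_I; simp add: l_minus l_distr minus_eq m_assoc del: add_uminus_conv_diff)+

lemma subring_E: "subring E K"
  by (rule subringI) auto

lemma nonzero_nonunit:
  obtains m where "m \<in> M" "m \<noteq> \<zero>" "m \<in> carrier K"
  using nonunits_nontrivial zero_M S_carr M_S by blast

text \<open>Any nonzero nonunit serves as a common denominator, since it carries \<open>E\<close>
  into the nonunits.\<close>

lemma invertible_in_E:
  assumes "submodule_over K S I" "I \<subseteq> E" "I \<noteq> {\<zero>}"
  shows "invertible_over_endo K I"
proof -
  obtain m where "m \<in> M" "m \<noteq> \<zero>" "m \<in> carrier K" by (rule nonzero_nonunit)
  with assms show ?thesis by (intro invertible_fractional[of I m] M_S E_M) auto
qed

lemma sum_closed_M: "sum_closed K M"
  by (auto simp: sum_closed_def)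

text \<open>An invertible module over a local ring is cyclic: some product \<open>q x\<close> avoids
  \<open>M\<close>, hence is a unit of \<open>S\<close>, and then \<open>x\<close> generates
  \<open>J\<close>.\<close>

lemma principal_if_endo_trivial:
  assumes J: "submodule_over K S J" "J \<subseteq> E" "J \<noteq> {\<zero>}"
    and triv: "\<And>u. \<lbrakk>u \<in> carrier K; \<And>y. y \<in> J \<Longrightarrow> u \<otimes> y \<in> J\<rbrakk> \<Longrightarrow> u \<in> S"
  obtains z where "z \<in> J" "\<And>y. y \<in> J \<Longrightarrow> \<exists>a\<in>S. y = z \<otimes> a"
proof -
  obtain q x where q: "q \<in> dual K J" and x: "x \<in> J" and qx: "q \<otimes> x \<notin> M"
    using invertible_over_endoE[OF invertible_in_E[OF J] sum_closed_M one_notin_M] .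
  have J_carr: "y \<in> carrier K" if "y \<in> J" for y using J that by auto
  have qc: "q \<in> carrier K" using q by (simp add: dual_def)
  have qS: "q \<otimes> y \<in> S" if "y \<in> J" for y
    using q that qc J_carr by (intro triv) (auto simp: dual_def m_assoc)
  obtain v where v: "v \<in> S" "v \<in> carrier K" "q \<otimes> x \<otimes> v = \<one>"
    using notin_M_unit[OF qS[OF x] qx] .
  show thesis
  proof (rule that[OF x])
    fix y assume y: "y \<in> J"
    have xc: "x \<in> carrier K" and yc: "y \<in> carrier K" using x y J_carr by auto
    have "x \<otimes> (v \<otimes> (q \<otimes> y)) = (q \<otimes> x \<otimes> v) \<otimes> y"
      by (rule ring_identity, (rule reify xc yc qc v(2))+, code_simp)
    then have "y = x \<otimes> (v \<otimes> (q \<otimes> y))" using v yc by simp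
    then show "\<exists>a\<in>S. y = x \<otimes> a" using v(1) qS[OF y] S_closed(6) by blast
  qed
qed

text \<open>Used by contraposition: a module between \<open>S\<close> and \<open>E\<close> that is
  larger than \<open>S\<close> has an endomorphism outside \<open>S\<close>. Indeed a generator
  \<open>z\<close> with \<open>z a = 1\<close> forces \<open>a\<close> to be a unit, as
  \<open>z\<close> carries \<open>M\<close> into \<open>M\<close>.\<close>

lemma unital_endo_trivial:
  assumes J: "submodule_over K S J" "J \<subseteq> E" "\<one> \<in> J"
    and triv: "\<And>u. \<lbrakk>u \<in> carrier K; \<And>y. y \<in> J \<Longrightarrow> u \<otimes> y \<in> J\<rbrakk> \<Longrightarrow> u \<in> S"
  shows "J \<subseteq> S"
proof -
  have "J \<noteq> {\<zero>}" using J by auto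
  then obtain z where z: "z \<in> J" "\<And>y. y \<in> J \<Longrightarrow> \<exists>a\<in>S. y = z \<otimes> a"
    using principal_if_endo_trivial[OF J(1,2) _ triv] by blast
  obtain a where a: "a \<in> S" "\<one> = z \<otimes> a" using z(2)[OF J(3)] by blast
  have "z \<in> E" using z J by blast
  then have "a \<notin> M" using a one_notin_M E_M by metis
  then obtain v where v: "v \<in> S" "v \<in> carrier K" "a \<otimes> v = \<one>" using a notin_M_unit by metis
  have "z = z \<otimes> (a \<otimes> v)" using v \<open>z \<in> E\<close> by simp
  also have "\<dots> = (z \<otimes> a) \<otimes> v" using a v \<open>z \<in> E\<close> by (simp add: m_assoc)
  also have "\<dots> = v" using a(2)[symmetric] v by simp
  finally have "z \<in> S" using v by simp
  then show "J \<subseteq> S" using z(2) by fastforce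
qed

section \<open>Quadratic relations in the endomorphism ring of the nonunits\<close>

abbreviation lin :: "'a \<Rightarrow> 'a set"
  where "lin \<equiv> affine_span K S"

lemmas lin_def = affine_span_def[of K S]

lemma linI: "\<lbrakk>a \<in> S; b \<in> S; y = a \<oplus> b \<otimes> x\<rbrakk> \<Longrightarrow> y \<in> lin x"
  by (auto simp: lin_def)

lemma linE:
  assumes "y \<in> lin x"
  obtains a b where "a \<in> S" "b \<in> S" "a \<in> carrier K" "b \<in> carrier K" "y = a \<oplus> b \<otimes> x"
  using assms by (auto simp: lin_def)

lemma submodule_lin:
  assumes x: "x \<in> E"
  shows "submodule_over K S (lin x)" "lin x \<subseteq> E" "\<one> \<in> lin x"
proof -
  have xc: "x \<in> carrier K" using x by simp
  show "lin x \<subseteq> E" using x by (auto elim!: linE simp: S_E)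
  have "y \<oplus> z \<in> lin x" if "y \<in> lin x" "z \<in> lin x" for y z
  proof -
    obtain a b where ab: "a \<in> S" "b \<in> S" "a \<in> carrier K" "b \<in> carrier K" "y = a \<oplus> b \<otimes> x"
      by (rule linE[OF \<open>y \<in> lin x\<close>])
    obtain c d where cd: "c \<in> S" "d \<in> S" "c \<in> carrier K" "d \<in> carrier K" "z = c \<oplus> d \<otimes> x"
      by (rule linE[OF \<open>z \<in> lin x\<close>])
    have "y \<oplus> z = (a \<oplus> c) \<oplus> (b \<oplus> d) \<otimes> x"
      unfolding ab(5) cd(5) by (rule ring_identity, (rule reify ab cd xc)+, code_simp)
    then show ?thesis using ab cd by (intro linI) auto
  qed
  moreover have "s \<otimes> y \<in> lin x" if "s \<in> S" "y \<in> lin x" for y s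
  proof -
    obtain a b where ab: "a \<in> S" "b \<in> S" "a \<in> carrier K" "b \<in> carrier K" "y = a \<oplus> b \<otimes> x"
      by (rule linE[OF \<open>y \<in> lin x\<close>])
    have sc: "s \<in> carrier K" using that by simp
    have "s \<otimes> y = s \<otimes> a \<oplus> (s \<otimes> b) \<otimes> x"
      unfolding ab(5) by (rule ring_identity, (rule reify ab sc xc)+, code_simp)
    then show ?thesis using ab that by (intro linI) auto
  qed
  moreover have "\<zero> \<in> lin x" using xc by (intro linI[of \<zero> \<zero>]) auto
  ultimately show "submodule_over K S (lin x)"
    using \<open>lin x \<subseteq> E\<close> by (auto simp: submodule_over_def)
  show "\<one> \<in> lin x" using xc by (intro linI[of \<one> \<zero>]) auto
qed

text \<open>Were \<open>x x\<close> outside \<open>S + S x\<close>, an endomorphism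
  \<open>a + b x\<close> of that module would need \<open>b\<close> in \<open>M\<close>, since a
  unit \<open>b\<close> lets one solve for \<open>x x\<close>. As \<open>x\<close> carries
  \<open>M\<close> into \<open>M\<close>, only multiplications by \<open>S\<close> remain, and
  \<open>unital_endo_trivial\<close> puts \<open>x\<close> into \<open>S\<close>.\<close>

lemma square_in_lin:
  assumes x: "x \<in> E"
  shows "x \<otimes> x \<in> lin x"
proof (rule ccontr)
  assume not: "x \<otimes> x \<notin> lin x"
  have xc: "x \<in> carrier K" using x by simp
  have xl: "x \<in> lin x" using xc by (intro linI[of \<zero> \<one>]) auto
  have "lin x \<subseteq> S"
  proof (rule unital_endo_trivial[OF submodule_lin[OF x]])
    fix u assume u: "u \<in> carrier K" and uJ: "\<And>y. y \<in> lin x \<Longrightarrow> u \<otimes> y \<in> lin x"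
    obtain a b where ab: "a \<in> S" "b \<in> S" "a \<in> carrier K" "b \<in> carrier K" "u = a \<oplus> b \<otimes> x"
      using uJ[OF submodule_lin(3)[OF x]] u by (auto elim!: linE)
    obtain c d where cd: "c \<in> S" "d \<in> S" "c \<in> carrier K" "d \<in> carrier K" "u \<otimes> x = c \<oplus> d \<otimes> x"
      using uJ[OF xl] by (rule linE)
    have "b \<in> M"
    proof (rule ccontr)
      assume "b \<notin> M"
      then obtain v where v: "v \<in> S" "v \<in> carrier K" "b \<otimes> v = \<one>" using ab notin_M_unit by metis
      have "x \<otimes> x = v \<otimes> c \<oplus> (v \<otimes> (d \<ominus> a)) \<otimes> x"
      proof -
        have "(b \<otimes> v) \<otimes> (x \<otimes> x) = v \<otimes> (u \<otimes> x) \<ominus> v \<otimes> a \<otimes> x"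
          unfolding ab(5) by (rule ring_identity, (rule reify ab v xc)+, code_simp)
        also have "\<dots> = v \<otimes> c \<oplus> (v \<otimes> (d \<ominus> a)) \<otimes> x"
          unfolding cd(5) by (rule ring_identity, (rule reify ab cd v xc)+, code_simp)
        finally show ?thesis using v xc by simp
      qed
      then have "x \<otimes> x \<in> lin x" using v cd ab by (intro linI) auto
      then show False using not by simp
    qed
    then show "u \<in> S" using ab x M_S E_M by auto
  qed
  then have "x \<in> S" using xl by blast
  then have "x \<otimes> x \<in> lin x" by (intro linI[of "x \<otimes> x" \<zero>]) auto
  then show False using not by simp
qed

lemma square_eq:
  assumes "x \<in> E"
  obtains a b where "a \<in> S" "b \<in> S" "a \<in> carrier K" "b \<in> carrier K" "x \<otimes> x = a \<oplus> b \<otimes> x"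
  using square_in_lin[OF assms] by (rule linE)

definition lin2 :: "'a \<Rightarrow> 'a \<Rightarrow> 'a set"
  where "lin2 x y = {a \<oplus> b \<otimes> x \<oplus> c \<otimes> y | a b c. a \<in> S \<and> b \<in> S \<and> c \<in> S}"

lemma lin2I: "\<lbrakk>a \<in> S; b \<in> S; c \<in> S; z = a \<oplus> b \<otimes> x \<oplus> c \<otimes> y\<rbrakk> \<Longrightarrow> z \<in> lin2 x y"
  by (auto simp: lin2_def)

lemma lin2E:
  assumes "z \<in> lin2 x y"
  obtains a b c where "a \<in> S" "b \<in> S" "c \<in> S" "a \<in> carrier K" "b \<in> carrier K" "c \<in> carrier K"
    "z = a \<oplus> b \<otimes> x \<oplus> c \<otimes> y"
  using assms by (auto simp: lin2_def)

lemma lin2_swap: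
  assumes "x \<in> carrier K" "y \<in> carrier K"
  shows "lin2 y x = lin2 x y"
proof -
  have "lin2 y x \<subseteq> lin2 x y" if c: "x \<in> carrier K" "y \<in> carrier K" for x y
  proof
    fix z assume "z \<in> lin2 y x"
    then obtain a b c where abc: "a \<in> S" "b \<in> S" "c \<in> S" "a \<in> carrier K" "b \<in> carrier K" "c \<in> carrier K"
      "z = a \<oplus> b \<otimes> y \<oplus> c \<otimes> x" by (rule lin2E)
    have "z = a \<oplus> c \<otimes> x \<oplus> b \<otimes> y"
      unfolding abc(7) by (rule ring_identity, (rule reify abc c)+, code_simp)
    then show "z \<in> lin2 x y" using abc by (intro lin2I)
  qed
  then show ?thesis using assms by blast
qed

lemma submodule_lin2:
  assumes x: "x \<in> E" and y: "y \<in> E"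
  shows "submodule_over K S (lin2 x y)" "lin2 x y \<subseteq> E" "\<one> \<in> lin2 x y"
proof -
  have xc: "x \<in> carrier K" "y \<in> carrier K" using x y by simp_all
  show "lin2 x y \<subseteq> E" using x y by (auto elim!: lin2E simp: S_E)
  have "w \<oplus> z \<in> lin2 x y" if "w \<in> lin2 x y" "z \<in> lin2 x y" for w z
  proof -
    obtain a b c where ab: "a \<in> S" "b \<in> S" "c \<in> S" "a \<in> carrier K" "b \<in> carrier K" "c \<in> carrier K"
      "w = a \<oplus> b \<otimes> x \<oplus> c \<otimes> y"
      by (rule lin2E[OF \<open>w \<in> lin2 x y\<close>])
    obtain d e f where cd: "d \<in> S" "e \<in> S" "f \<in> S" "d \<in> carrier K" "e \<in> carrier K" "f \<in> carrier K"
      "z = d \<oplus> e \<otimes> x \<oplus> f \<otimes> y"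
      by (rule lin2E[OF \<open>z \<in> lin2 x y\<close>])
    have "w \<oplus> z = (a \<oplus> d) \<oplus> (b \<oplus> e) \<otimes> x \<oplus> (c \<oplus> f) \<otimes> y"
      unfolding ab(7) cd(7) by (rule ring_identity, (rule reify ab cd xc)+, code_simp)
    then show ?thesis using ab cd by (intro lin2I) auto
  qed
  moreover have "s \<otimes> w \<in> lin2 x y" if "s \<in> S" "w \<in> lin2 x y" for w s
  proof -
    obtain a b c where ab: "a \<in> S" "b \<in> S" "c \<in> S" "a \<in> carrier K" "b \<in> carrier K" "c \<in> carrier K"
      "w = a \<oplus> b \<otimes> x \<oplus> c \<otimes> y"
      by (rule lin2E[OF \<open>w \<in> lin2 x y\<close>])
    have sc: "s \<in> carrier K" using that by simp
    have "s \<otimes> w = s \<otimes> a \<oplus> (s \<otimes> b) \<otimes> x \<oplus> (s \<otimes> c) \<otimes> y"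
      unfolding ab(7) by (rule ring_identity, (rule reify ab sc xc)+, code_simp)
    then show ?thesis using ab that by (intro lin2I) auto
  qed
  moreover have "\<zero> \<in> lin2 x y" using xc by (intro lin2I[of \<zero> \<zero> \<zero>]) auto
  ultimately show "submodule_over K S (lin2 x y)"
    using \<open>lin2 x y \<subseteq> E\<close> by (auto simp: submodule_over_def)
  show "\<one> \<in> lin2 x y" using xc by (intro lin2I[of \<one> \<zero> \<zero>]) auto
qed

text \<open>A unit \<open>c\<close> would allow solving for \<open>x y\<close>, because the square
  of \<open>x\<close> is already known to be linear in \<open>x\<close>.\<close>

lemma endo_lin2_coeff:
  assumes x: "x \<in> E" and y: "y \<in> E" and not: "x \<otimes> y \<notin> lin2 x y"
    and abc: "a \<in> S" "b \<in> S" "c \<in> S"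
    and ux: "(a \<oplus> b \<otimes> x \<oplus> c \<otimes> y) \<otimes> x \<in> lin2 x y"
  shows "c \<in> M"
proof (rule ccontr)
  assume "c \<notin> M"
  then obtain v where v: "v \<in> S" "v \<in> carrier K" "c \<otimes> v = \<one>" using abc notin_M_unit by metis
  have xc: "x \<in> carrier K" "y \<in> carrier K" "a \<in> carrier K" "b \<in> carrier K" "c \<in> carrier K"
    using x y abc by simp_all
  obtain p q where pq: "p \<in> S" "q \<in> S" "p \<in> carrier K" "q \<in> carrier K" "x \<otimes> x = p \<oplus> q \<otimes> x"
    using x by (rule square_eq)
  obtain d e f where cd: "d \<in> S" "e \<in> S" "f \<in> S" "d \<in> carrier K" "e \<in> carrier K" "f \<in> carrier K"
      "(a \<oplus> b \<otimes> x \<oplus> c \<otimes> y) \<otimes> x = d \<oplus> e \<otimes> x \<oplus> f \<otimes> y" using ux by (rule lin2E)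
  have "(c \<otimes> v) \<otimes> (x \<otimes> y) = v \<otimes> ((a \<oplus> b \<otimes> x \<oplus> c \<otimes> y) \<otimes> x) \<ominus> v \<otimes> a \<otimes> x \<ominus> v \<otimes> b \<otimes> (x \<otimes> x)"
    by (rule ring_identity, (rule reify xc v)+, code_simp)
  also have "\<dots> = v \<otimes> (d \<ominus> b \<otimes> p) \<oplus> (v \<otimes> (e \<ominus> a \<ominus> b \<otimes> q)) \<otimes> x \<oplus> (v \<otimes> f) \<otimes> y"
    unfolding cd(7) pq(5) by (rule ring_identity, (rule reify xc v pq cd)+, code_simp)
  finally have "x \<otimes> y \<in> lin2 x y" using v xc abc cd pq by (intro lin2I) auto
  then show False using not by simp
qed

text \<open>The argument for squares repeated with \<open>S + S x + S y\<close>: the coefficients of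
  \<open>x\<close> and \<open>y\<close> in an endomorphism are nonunits, each by one of the two
  symmetric applications of \<open>endo_lin2_coeff\<close>.\<close>

lemma mult_in_lin2:
  assumes x: "x \<in> E" and y: "y \<in> E"
  shows "x \<otimes> y \<in> lin2 x y"
proof (rule ccontr)
  assume not: "x \<otimes> y \<notin> lin2 x y"
  have xc: "x \<in> carrier K" "y \<in> carrier K" using x y by simp_all
  have not': "y \<otimes> x \<notin> lin2 y x" using not xc by (simp add: lin2_swap m_comm)
  have xl: "x \<in> lin2 x y" using xc by (intro lin2I[of \<zero> \<one> \<zero>]) auto
  have yl: "y \<in> lin2 x y" using xc by (intro lin2I[of \<zero> \<zero> \<one>]) auto
  have "lin2 x y \<subseteq> S"
  proof (rule unital_endo_trivial[OF submodule_lin2[OF x y]])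
    fix u assume u: "u \<in> carrier K" and uJ: "\<And>w. w \<in> lin2 x y \<Longrightarrow> u \<otimes> w \<in> lin2 x y"
    obtain a b c where ab: "a \<in> S" "b \<in> S" "c \<in> S" "a \<in> carrier K" "b \<in> carrier K" "c \<in> carrier K"
      "u = a \<oplus> b \<otimes> x \<oplus> c \<otimes> y"
      using uJ[OF submodule_lin2(3)[OF x y]] u by (auto elim!: lin2E)
    have "c \<in> M" using endo_lin2_coeff[OF x y not ab(1-3)] uJ[OF xl] ab(7) by simp
    moreover have "a \<oplus> b \<otimes> x \<oplus> c \<otimes> y = a \<oplus> c \<otimes> y \<oplus> b \<otimes> x"
      by (rule ring_identity, (rule reify xc ab)+, code_simp)
    then have "b \<in> M" using endo_lin2_coeff[OF y x not' ab(1) ab(3) ab(2)] uJ[OF yl] ab(7) xc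
      by (simp add: lin2_swap)
    ultimately show "u \<in> S" using ab x y M_S E_M by auto
  qed
  then have "x \<in> S" "y \<in> S" using xl yl by blast+
  then have "x \<otimes> y \<in> lin2 x y" by (intro lin2I[of "x \<otimes> y" \<zero> \<zero>]) auto
  then show False using not by simp
qed

lemma mult_eq:
  assumes "x \<in> E" "y \<in> E"
  obtains a b c where "a \<in> S" "b \<in> S" "c \<in> S" "a \<in> carrier K" "b \<in> carrier K" "c \<in> carrier K"
    "x \<otimes> y = a \<oplus> b \<otimes> x \<oplus> c \<otimes> y"
  using mult_in_lin2[OF assms] by (rule lin2E)

text \<open>Without a root modulo \<open>M\<close>, the polynomial \<open>X^2 - b X - a\<close>
  makes \<open>E/M\<close> a quadratic field extension of \<open>S/M\<close>. Inverses come from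
  conjugation, which sends \<open>x\<close> to \<open>b - x\<close>.\<close>

lemma E_no_root:
  assumes x: "x \<in> E" and ab: "a \<in> S" "b \<in> S" and xx: "x \<otimes> x = a \<oplus> b \<otimes> x"
    and no_root: "\<And>c. c \<in> S \<Longrightarrow> c \<otimes> c \<ominus> b \<otimes> c \<ominus> a \<notin> M"
  shows "E \<subseteq> lin x" and "\<And>w. \<lbrakk>w \<in> E; w \<notin> M\<rbrakk> \<Longrightarrow> \<exists>v\<in>E. w \<otimes> v = \<one>"
proof -
  have xc: "x \<in> carrier K" "a \<in> carrier K" "b \<in> carrier K" using x ab by simp_all
  have nS: "c \<otimes> c \<ominus> b \<otimes> c \<ominus> a \<in> S" if "c \<in> S" for c using ab that by simp
  show lin: "E \<subseteq> lin x"
  proof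
    fix y assume y: "y \<in> E"
    then have yc: "y \<in> carrier K" by simp
    obtain p q r where pqr: "p \<in> S" "q \<in> S" "r \<in> S" "p \<in> carrier K" "q \<in> carrier K" "r \<in> carrier K"
      and xy: "x \<otimes> y = p \<oplus> q \<otimes> x \<oplus> r \<otimes> y" using mult_eq[OF x y] .
    obtain v where v: "v \<in> S" "v \<in> carrier K" "(r \<otimes> r \<ominus> b \<otimes> r \<ominus> a) \<otimes> v = \<one>"
      using notin_M_unit[OF nS no_root] pqr(3) by metis
    \<comment> \<open>The relation for \<open>x y\<close> reads \<open>(x - r) y = p + q x\<close>,
      and \<open>x - r\<close> times \<open>x - b + r\<close> is minus the unit
      \<open>r r - b r - a\<close>.\<close>
    have "(r \<otimes> r \<ominus> b \<otimes> r \<ominus> a) \<otimes> y = \<ominus> (x \<ominus> b \<oplus> r) \<otimes> (p \<oplus> q \<otimes> x)"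
    proof -
      have "(r \<otimes> r \<ominus> b \<otimes> r \<ominus> a) \<otimes> y = \<ominus> (x \<ominus> b \<oplus> r) \<otimes> (x \<otimes> y \<ominus> r \<otimes> y)"
        by (rule ring_identity_mod[OF _ _ xx], (rule reify pqr xc yc)+, code_simp)
      also have "x \<otimes> y \<ominus> r \<otimes> y = p \<oplus> q \<otimes> x"
        unfolding xy by (rule ring_identity, (rule reify pqr xc yc)+, code_simp)
      finally show ?thesis .
    qed
    moreover have "((r \<otimes> r \<ominus> b \<otimes> r \<ominus> a) \<otimes> v) \<otimes> y = v \<otimes> ((r \<otimes> r \<ominus> b \<otimes> r \<ominus> a) \<otimes> y)"
      by (rule ring_identity, (rule reify pqr xc yc v)+, code_simp)
    ultimately have "y = v \<otimes> (\<ominus> (x \<ominus> b \<oplus> r) \<otimes> (p \<oplus> q \<otimes> x))" using v yc by simp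
    also have "\<dots> = \<ominus> (v \<otimes> (q \<otimes> a \<oplus> (r \<ominus> b) \<otimes> p)) \<oplus> (\<ominus> (v \<otimes> (p \<oplus> r \<otimes> q))) \<otimes> x"
      by (rule ring_identity_mod[OF _ _ xx], (rule reify pqr xc v)+, code_simp)
    finally show "y \<in> lin x" using v pqr ab yc by (intro linI) auto
  qed
  fix w assume w: "w \<in> E" "w \<notin> M"
  then obtain p q where pq: "p \<in> S" "q \<in> S" "p \<in> carrier K" "q \<in> carrier K" "w = p \<oplus> q \<otimes> x"
    using lin by (blast elim: linE)
  show "\<exists>v\<in>E. w \<otimes> v = \<one>"
  proof (cases "q \<in> M")
    case True
    then have "w \<in> S" using pq(1,5) E_M(2)[OF x] M_S by auto
    then show ?thesis using notin_M_unit[OF _ w(2)] S_E by metis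
  next
    case False
    then obtain v where v: "v \<in> S" "v \<in> carrier K" "q \<otimes> v = \<one>" using pq notin_M_unit by metis
    \<comment> \<open>Now \<open>w = q (x - c)\<close>, so \<open>c\<close> takes the place of
      \<open>r\<close> above.\<close>
    define c where "c = \<ominus> (p \<otimes> v)"
    have c: "c \<in> S" "c \<in> carrier K" using pq v by (simp_all add: c_def)
    obtain n where n: "n \<in> S" "n \<in> carrier K" "(c \<otimes> c \<ominus> b \<otimes> c \<ominus> a) \<otimes> n = \<one>"
      using notin_M_unit[OF nS[OF c(1)] no_root[OF c(1)]] .
    have "q \<otimes> (x \<ominus> c) = q \<otimes> x \<oplus> p \<otimes> (q \<otimes> v)"
      unfolding c_def by (rule ring_identity, (rule reify pq xc v)+, code_simp)
    then have w': "w = q \<otimes> (x \<ominus> c)" using pq xc v by (simp add: a_comm)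
    have "w \<otimes> (\<ominus> (v \<otimes> n) \<otimes> (x \<ominus> b \<oplus> c)) = (q \<otimes> v) \<otimes> ((c \<otimes> c \<ominus> b \<otimes> c \<ominus> a) \<otimes> n)"
      unfolding w' by (rule ring_identity_mod[OF _ _ xx], (rule reify pq xc v n c)+, code_simp)
    also have "\<dots> = \<one>" using v n by simp
    finally show ?thesis
      using v n c ab x by (intro bexI[of _ "\<ominus> (v \<otimes> n) \<otimes> (x \<ominus> b \<oplus> c)"]) (auto simp: S_E)
  qed
qed

section \<open>The nonunits as a principal module over their endomorphism ring\<close>

lemma submodule_M: "submodule_over K S M" "M \<subseteq> E" "M \<noteq> {\<zero>}"
  using nonunits_nontrivial by (auto simp: submodule_over_def intro: S_E M_S)

lemma invertible_M: "invertible_over_endo K M"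
  using invertible_in_E[OF submodule_M] .

lemma dual_M_mult:
  assumes "q \<in> dual K M" "t \<in> M"
  shows "q \<otimes> t \<in> E" "q \<in> carrier K"
proof -
  show q: "q \<in> carrier K" using assms by (simp add: dual_def)
  show "q \<otimes> t \<in> E"
    using assms q by (intro E_I) (auto simp: dual_def m_assoc)
qed

lemma M_principal_if_unit:
  assumes q: "q \<in> dual K M" and t: "t \<in> M" and r: "r \<in> E" and qtr: "q \<otimes> t \<otimes> r = \<one>" and m: "m \<in> M"
  shows "\<exists>e\<in>E. m = t \<otimes> e"
proof -
  have c: "q \<in> carrier K" "t \<in> carrier K" "r \<in> carrier K" "m \<in> carrier K"
    using dual_M_mult(2)[OF q t] t r m by simp_all
  have "t \<otimes> (r \<otimes> (q \<otimes> m)) = (q \<otimes> t \<otimes> r) \<otimes> m"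
    by (rule ring_identity, (rule reify c)+, code_simp)
  also have "\<dots> = m" using qtr c by simp
  finally show ?thesis using r dual_M_mult[OF q m] E_closed(4) by metis
qed

definition M_principal :: bool
  where "M_principal \<longleftrightarrow> (\<exists>t\<in>M. \<forall>m\<in>M. \<exists>e\<in>E. m = t \<otimes> e)"

text \<open>\<open>H\<close> has to contain the nonunits of \<open>E\<close>: it will be
  \<open>M\<close> when \<open>E/M\<close> is a field, and the set of nonunits of \<open>E\<close>
  when \<open>E\<close> is local.\<close>

lemma M_principal_local:
  assumes H: "sum_closed K H" "\<one> \<notin> H" and unit: "\<And>w. \<lbrakk>w \<in> E; w \<notin> H\<rbrakk> \<Longrightarrow> \<exists>v\<in>E. w \<otimes> v = \<one>"
  shows M_principal
proof -
  obtain q t where qt: "q \<in> dual K M" "t \<in> M" "q \<otimes> t \<notin> H"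
    using invertible_over_endoE[OF invertible_M H] .
  then obtain r where "r \<in> E" "q \<otimes> t \<otimes> r = \<one>" using unit dual_M_mult by metis
  then show ?thesis using qt M_principal_if_unit unfolding M_principal_def by blast
qed

text \<open>The ring \<open>E/M\<close> is reduced; testing squares is enough for this.\<close>

definition E_reduced :: bool
  where "E_reduced \<longleftrightarrow> (\<forall>w\<in>E. w \<otimes> w \<in> M \<longrightarrow> w \<in> M)"

lemma reduced_no_root:
  assumes "\<And>w. \<lbrakk>w \<in> E; w \<notin> M\<rbrakk> \<Longrightarrow> \<exists>v\<in>E. w \<otimes> v = \<one>"
  shows E_reduced
  unfolding E_reduced_def
proof (intro ballI impI, rule ccontr)
  fix w assume w: "w \<in> E" "w \<otimes> w \<in> M" "w \<notin> M"
  then obtain v where v: "v \<in> E" "w \<otimes> v = \<one>" using assms by blast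
  have "w = v \<otimes> (w \<otimes> w)" using v w by (metis E_carr l_one m_assoc m_comm)
  then show False using w v E_M by metis
qed

section \<open>An idempotent modulo the nonunits\<close>

context
  fixes x
  assumes x: "x \<in> E" and idem: "x \<otimes> x \<ominus> x \<in> M" and x_M: "x \<notin> M" and x1_M: "\<one> \<ominus> x \<notin> M"
begin

lemma x_carr: "x \<in> carrier K" using x by simp

lemma smult_x_M: "\<lbrakk>c \<in> S; c \<otimes> x \<in> M\<rbrakk> \<Longrightarrow> c \<in> M"
proof (rule ccontr)
  assume c: "c \<in> S" "c \<otimes> x \<in> M" "c \<notin> M"
  then obtain v where v: "v \<in> S" "v \<in> carrier K" "c \<otimes> v = \<one>" using notin_M_unit by metis
  have "v \<otimes> (c \<otimes> x) = x" using v c x_carr by (metis S_carr l_one m_assoc m_comm)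
  then show False using v c x_M M_smult by metis
qed

lemma smult_one_minus_x_M: "\<lbrakk>c \<in> S; c \<otimes> (\<one> \<ominus> x) \<in> M\<rbrakk> \<Longrightarrow> c \<in> M"
proof (rule ccontr)
  assume c: "c \<in> S" "c \<otimes> (\<one> \<ominus> x) \<in> M" "c \<notin> M"
  then obtain v where v: "v \<in> S" "v \<in> carrier K" "c \<otimes> v = \<one>" using notin_M_unit by metis
  have "v \<otimes> (c \<otimes> (\<one> \<ominus> x)) = \<one> \<ominus> x"
    using v c x_carr by (metis S_carr l_one m_assoc m_comm minus_closed one_closed)
  then show False using v c x1_M M_smult by metis
qed

text \<open>Modulo \<open>M\<close> the ring \<open>E\<close> splits into an \<open>x\<close> part
  and a \<open>1 - x\<close> part, and the first must be the residue field of \<open>S\<close>. If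
  \<open>y\<close> gives a nonscalar element there, take \<open>w\<close> with parts
  \<open>y\<close> and \<open>1\<close>: an endomorphism of \<open>M + S x + S w\<close> must act by
  one scalar on both parts, hence lies in \<open>S\<close>. The module would then be cyclic,
  although \<open>x\<close> and \<open>w\<close> are independent modulo \<open>M\<close>.\<close>

lemma idempotent_component:
  assumes y: "y \<in> E"
  shows "\<exists>c\<in>S. x \<otimes> y \<ominus> c \<otimes> x \<in> M"
proof (rule ccontr)
  assume not: "\<not> ?thesis"
  have xc: "x \<in> carrier K" "y \<in> carrier K" using x y by simp_all
  define e where "e = x \<otimes> x \<ominus> x"
  have e: "e \<in> M" "e \<in> E" "e \<in> carrier K" using idem x by (auto simp: e_def)
  have xx: "x \<otimes> x = x \<oplus> e" unfolding e_def
    by (rule ring_identity, (rule reify xc)+, code_simp)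
  define w where "w = x \<otimes> y \<oplus> \<one> \<ominus> x"
  have w: "w \<in> E" "w \<in> carrier K" using x y by (auto simp: w_def)
  define U where "U = {m \<oplus> a \<otimes> x \<oplus> b \<otimes> w | m a b. m \<in> M \<and> a \<in> S \<and> b \<in> S}"
  have U_I: "z \<in> U" if "m \<in> M" "a \<in> S" "b \<in> S" "z = m \<oplus> a \<otimes> x \<oplus> b \<otimes> w" for z m a b
    using that by (auto simp: U_def)
  have U_E: "thesis" if "z \<in> U" "\<And>m a b. \<lbrakk>m \<in> M; a \<in> S; b \<in> S; m \<in> carrier K; a \<in> carrier K; b \<in> carrier K;
    z = m \<oplus> a \<otimes> x \<oplus> b \<otimes> w\<rbrakk> \<Longrightarrow> thesis" for z thesis
    using that by (auto simp: U_def)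
  have UE: "U \<subseteq> E" using x w by (auto elim!: U_E simp: S_E M_S)
  have MU: "m \<in> U" if "m \<in> M" for m using that xc w by (intro U_I[of m \<zero> \<zero>]) auto
  have xU: "x \<in> U" using xc w by (intro U_I[of \<zero> \<one> \<zero>]) auto
  have wU: "w \<in> U" using xc w by (intro U_I[of \<zero> \<zero> \<one>]) auto
  have "z1 \<oplus> z2 \<in> U" if z1: "z1 \<in> U" and z2: "z2 \<in> U" for z1 z2
  proof -
    obtain m a b where 1: "m \<in> M" "a \<in> S" "b \<in> S" "m \<in> carrier K" "a \<in> carrier K" "b \<in> carrier K"
      "z1 = m \<oplus> a \<otimes> x \<oplus> b \<otimes> w" using U_E[OF z1] by metis
    obtain m' a' b' where 2: "m' \<in> M" "a' \<in> S" "b' \<in> S" "m' \<in> carrier K" "a' \<in> carrier K" "b' \<in> carrier K"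
      "z2 = m' \<oplus> a' \<otimes> x \<oplus> b' \<otimes> w" using U_E[OF z2] by metis
    have "z1 \<oplus> z2 = (m \<oplus> m') \<oplus> (a \<oplus> a') \<otimes> x \<oplus> (b \<oplus> b') \<otimes> w"
      unfolding 1(7) 2(7) by (rule ring_identity, (rule reify 1 2 xc w)+, code_simp)
    then show ?thesis using 1 2 by (intro U_I) auto
  qed
  moreover have "s \<otimes> z1 \<in> U" if s: "s \<in> S" and z1: "z1 \<in> U" for z1 s
  proof -
    obtain m a b where 1: "m \<in> M" "a \<in> S" "b \<in> S" "m \<in> carrier K" "a \<in> carrier K" "b \<in> carrier K"
      "z1 = m \<oplus> a \<otimes> x \<oplus> b \<otimes> w" using U_E[OF z1] by metis
    have sc: "s \<in> carrier K" using s by simp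
    have "s \<otimes> z1 = s \<otimes> m \<oplus> (s \<otimes> a) \<otimes> x \<oplus> (s \<otimes> b) \<otimes> w"
      unfolding 1(7) by (rule ring_identity, (rule reify 1 sc xc w)+, code_simp)
    then show ?thesis using 1 s by (intro U_I) auto
  qed
  ultimately have sub: "submodule_over K S U"
    using UE MU[OF zero_M] by (auto simp: submodule_over_def)
  have U0: "U \<noteq> {\<zero>}" using xU x_M by auto
  \<comment> \<open>Up to terms in \<open>M\<close>, the two parts of \<open>w\<close> are
    \<open>1 - x\<close> and \<open>x y\<close>.\<close>
  have one_w: "(\<one> \<ominus> x) \<otimes> w = \<one> \<ominus> x \<oplus> e \<ominus> e \<otimes> y"
    unfolding w_def by (rule ring_identity_mod[OF _ _ xx], (rule reify xc e)+, code_simp)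
  have x_w: "x \<otimes> w = x \<otimes> y \<oplus> e \<otimes> y \<ominus> e"
    unfolding w_def by (rule ring_identity_mod[OF _ _ xx], (rule reify xc e)+, code_simp)
  have triv: "u \<in> S" if u: "u \<in> carrier K" and uU: "\<And>z. z \<in> U \<Longrightarrow> u \<otimes> z \<in> U" for u
  proof -
    have ux: "u \<otimes> x \<in> E" and uw: "u \<otimes> w \<in> E" using uU xU wU UE by blast+
    have ue: "u \<otimes> (e \<otimes> y \<ominus> e) \<in> E" using uU MU e y UE by (meson E_M(2) M_closed(3) subsetD)
    have uE: "u \<in> E"
    proof (rule E_I[OF u])
      fix m assume m: "m \<in> M"
      then have mc: "m \<in> carrier K" by simp
      \<comment> \<open>By \<open>one_w\<close>, \<open>1 = x + (1 - x) w + (e y - e)\<close>, so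
        \<open>u\<close> is recovered from its products with \<open>x\<close>, \<open>w\<close> and
        an element of \<open>M\<close>; all three products lie in \<open>E\<close>.\<close>
      have "u \<otimes> m = m \<otimes> (u \<otimes> x) \<oplus> u \<otimes> m \<otimes> ((\<one> \<ominus> x) \<otimes> w) \<oplus> m \<otimes> (u \<otimes> (e \<otimes> y \<ominus> e))"
        unfolding one_w by (rule ring_identity, (rule reify mc u xc e)+, code_simp)
      also have "u \<otimes> m \<otimes> ((\<one> \<ominus> x) \<otimes> w) = (m \<otimes> (\<one> \<ominus> x)) \<otimes> (u \<otimes> w)"
        by (rule ring_identity, (rule reify mc u xc w)+, code_simp)
      finally show "u \<otimes> m \<in> M" using m ux uw ue x by simp
    qed
    obtain m1 \<alpha> \<beta> where 1: "m1 \<in> M" "\<alpha> \<in> S" "\<beta> \<in> S" "m1 \<in> carrier K" "\<alpha> \<in> carrier K" "\<beta> \<in> carrier K"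
      "u \<otimes> x = m1 \<oplus> \<alpha> \<otimes> x \<oplus> \<beta> \<otimes> w" using U_E[OF uU[OF xU]] by metis
    obtain m2 \<gamma> \<delta> where 2: "m2 \<in> M" "\<gamma> \<in> S" "\<delta> \<in> S" "m2 \<in> carrier K" "\<gamma> \<in> carrier K" "\<delta> \<in> carrier K"
      "u \<otimes> w = m2 \<oplus> \<gamma> \<otimes> x \<oplus> \<delta> \<otimes> w" using U_E[OF uU[OF wU]] by metis
    note c = xc e(3) w(2) u 1(4-6) 2(4-6)
    \<comment> \<open>Multiplying the expansion of \<open>u x\<close> by \<open>1 - x\<close> kills
      \<open>x\<close> modulo \<open>M\<close> and turns \<open>w\<close> into
      \<open>1 - x\<close>.\<close>
    have \<beta>: "\<beta> \<in> M"
    proof (rule smult_one_minus_x_M[OF 1(3)])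
      have "\<beta> \<otimes> (\<one> \<ominus> x) = (\<one> \<ominus> x) \<otimes> (m1 \<oplus> \<alpha> \<otimes> x \<oplus> \<beta> \<otimes> w) \<ominus> m1 \<otimes> (\<one> \<ominus> x) \<ominus> \<alpha> \<otimes> ((\<one> \<ominus> x) \<otimes> x)
         \<ominus> \<beta> \<otimes> ((\<one> \<ominus> x) \<otimes> w) \<oplus> \<beta> \<otimes> (\<one> \<ominus> x)"
        by (rule ring_identity, (rule reify c)+, code_simp)
      also have "\<dots> = (\<one> \<ominus> x) \<otimes> (u \<otimes> x) \<ominus> m1 \<otimes> (\<one> \<ominus> x) \<ominus> \<alpha> \<otimes> ((\<one> \<ominus> x) \<otimes> x)
         \<ominus> \<beta> \<otimes> (e \<ominus> e \<otimes> y)"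
        unfolding one_w 1(7)[symmetric] by (rule ring_identity, (rule reify c)+, code_simp)
      also have "\<dots> = \<ominus> (u \<otimes> e) \<ominus> m1 \<otimes> (\<one> \<ominus> x) \<oplus> \<alpha> \<otimes> e \<ominus> \<beta> \<otimes> (e \<ominus> e \<otimes> y)"
        by (rule ring_identity_mod[OF _ _ xx], (rule reify c)+, code_simp)
      also have "\<dots> \<in> M" using uE e(1) y x 1(1-3) by simp
      finally show "\<beta> \<otimes> (\<one> \<ominus> x) \<in> M" .
    qed
    \<comment> \<open>Two computations of \<open>u x y\<close>: from \<open>u x\<close>, and from
      \<open>u w\<close> by way of \<open>x w = x y + (e y - e)\<close>.\<close>
    have comb: "(\<alpha> \<ominus> \<delta>) \<otimes> (x \<otimes> y) \<ominus> \<gamma> \<otimes> x \<in> M"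
    proof -
      have "(\<alpha> \<ominus> \<delta>) \<otimes> (x \<otimes> y) \<ominus> \<gamma> \<otimes> x = (m1 \<oplus> \<alpha> \<otimes> x \<oplus> \<beta> \<otimes> w) \<otimes> y \<ominus> m1 \<otimes> y \<ominus> \<beta> \<otimes> (w \<otimes> y)
          \<ominus> (\<delta> \<otimes> (x \<otimes> y) \<oplus> \<gamma> \<otimes> x)"
        by (rule ring_identity, (rule reify c)+, code_simp)
      also have "\<dots> = u \<otimes> (x \<otimes> y) \<ominus> m1 \<otimes> y \<ominus> \<beta> \<otimes> (w \<otimes> y)
          \<ominus> (\<delta> \<otimes> (x \<otimes> y) \<oplus> \<gamma> \<otimes> x)"
        unfolding 1(7)[symmetric] by (rule ring_identity, (rule reify c)+, code_simp)
      also have "\<dots> = u \<otimes> (x \<otimes> w) \<ominus> u \<otimes> (e \<otimes> y \<ominus> e) \<ominus> m1 \<otimes> y \<ominus> \<beta> \<otimes> (w \<otimes> y)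
          \<ominus> (\<delta> \<otimes> (x \<otimes> w) \<ominus> \<delta> \<otimes> (e \<otimes> y \<ominus> e) \<oplus> \<gamma> \<otimes> x)"
        unfolding x_w by (rule ring_identity, (rule reify c)+, code_simp)
      also have "u \<otimes> (x \<otimes> w) = x \<otimes> (m2 \<oplus> \<gamma> \<otimes> x \<oplus> \<delta> \<otimes> w)"
        unfolding 2(7)[symmetric] by (rule ring_identity, (rule reify c)+, code_simp)
      also have "x \<otimes> (m2 \<oplus> \<gamma> \<otimes> x \<oplus> \<delta> \<otimes> w) \<ominus> u \<otimes> (e \<otimes> y \<ominus> e) \<ominus> m1 \<otimes> y \<ominus> \<beta> \<otimes> (w \<otimes> y)
          \<ominus> (\<delta> \<otimes> (x \<otimes> w) \<ominus> \<delta> \<otimes> (e \<otimes> y \<ominus> e) \<oplus> \<gamma> \<otimes> x)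
        = x \<otimes> m2 \<oplus> \<gamma> \<otimes> e \<ominus> u \<otimes> (e \<otimes> y \<ominus> e) \<ominus> m1 \<otimes> y \<ominus> \<beta> \<otimes> (w \<otimes> y) \<oplus> \<delta> \<otimes> (e \<otimes> y \<ominus> e)"
        by (rule ring_identity_mod[OF _ _ xx], (rule reify c)+, code_simp)
      also have "\<dots> \<in> M" using uE e(1) y x 1(1-3) 2(1-3) \<beta> w by simp
      finally show ?thesis .
    qed
    \<comment> \<open>A unit here would make \<open>x y\<close> a scalar multiple of
      \<open>x\<close> modulo \<open>M\<close>, which was excluded.\<close>
    have \<alpha>\<delta>: "\<alpha> \<ominus> \<delta> \<in> M"
    proof (rule ccontr)
      assume "\<alpha> \<ominus> \<delta> \<notin> M"
      then obtain v where v: "v \<in> S" "v \<in> carrier K" "(\<alpha> \<ominus> \<delta>) \<otimes> v = \<one>"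
        using 1(2) 2(3) notin_M_unit by (metis S_closed(5))
      have "v \<otimes> ((\<alpha> \<ominus> \<delta>) \<otimes> (x \<otimes> y) \<ominus> \<gamma> \<otimes> x) = ((\<alpha> \<ominus> \<delta>) \<otimes> v) \<otimes> (x \<otimes> y) \<ominus> (v \<otimes> \<gamma>) \<otimes> x"
        by (rule ring_identity, (rule reify c v)+, code_simp)
      then have "x \<otimes> y \<ominus> (v \<otimes> \<gamma>) \<otimes> x \<in> M" using v xc M_smult(1)[OF v(1) comb] by simp
      then show False using not v 2(2) S_closed(6) by blast
    qed
    have \<gamma>: "\<gamma> \<in> M"
    proof (rule smult_x_M[OF 2(2)])
      have "\<gamma> \<otimes> x = (\<alpha> \<ominus> \<delta>) \<otimes> (x \<otimes> y) \<ominus> ((\<alpha> \<ominus> \<delta>) \<otimes> (x \<otimes> y) \<ominus> \<gamma> \<otimes> x)"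
        by (rule ring_identity, (rule reify c)+, code_simp)
      also have "\<dots> \<in> M" using \<alpha>\<delta> comb x y by (meson E_M(2) E_closed(4) M_closed(3))
      finally show "\<gamma> \<otimes> x \<in> M" .
    qed
    have "u = u \<otimes> x \<oplus> u \<otimes> ((\<one> \<ominus> x) \<otimes> w) \<oplus> u \<otimes> (e \<otimes> y \<ominus> e)"
      unfolding one_w by (rule ring_identity, (rule reify c)+, code_simp)
    also have "u \<otimes> ((\<one> \<ominus> x) \<otimes> w) = (\<one> \<ominus> x) \<otimes> (u \<otimes> w)"
      by (rule ring_identity, (rule reify c)+, code_simp)
    also have "(\<one> \<ominus> x) \<otimes> (u \<otimes> w) = (\<one> \<ominus> x) \<otimes> (m2 \<oplus> \<gamma> \<otimes> x) \<oplus> \<delta> \<otimes> ((\<one> \<ominus> x) \<otimes> w)"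
      unfolding 2(7) by (rule ring_identity, (rule reify c)+, code_simp)
    also have "u \<otimes> x \<oplus> ((\<one> \<ominus> x) \<otimes> (m2 \<oplus> \<gamma> \<otimes> x) \<oplus> \<delta> \<otimes> ((\<one> \<ominus> x) \<otimes> w)) \<oplus> u \<otimes> (e \<otimes> y \<ominus> e)
      = \<alpha> \<oplus> (m1 \<oplus> \<beta> \<otimes> w \<ominus> (\<alpha> \<ominus> \<delta>) \<otimes> (\<one> \<ominus> x) \<oplus> (\<one> \<ominus> x) \<otimes> (m2 \<oplus> \<gamma> \<otimes> x)
          \<ominus> \<delta> \<otimes> (e \<otimes> y \<ominus> e) \<oplus> u \<otimes> (e \<otimes> y \<ominus> e))"
      unfolding one_w 1(7) by (rule ring_identity, (rule reify c)+, code_simp)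
    also have "\<dots> \<in> S"
      using 1(1) 2(1,3) \<alpha>\<delta> \<beta> \<gamma> e(1) y x uE w(1)
      by (intro S_closed(4)[OF 1(2) M_S] M_closed(2,3)) simp_all
    finally show "u \<in> S" .
  qed
  \<comment> \<open>A generator \<open>z\<close> differs from \<open>x\<close> by a unit, so
    \<open>w\<close> is a multiple of \<open>x\<close>; but then \<open>(1 - x) w\<close> lies in
    \<open>M\<close>, against \<open>one_w\<close>.\<close>
  obtain z where z: "z \<in> U" "\<And>y. y \<in> U \<Longrightarrow> \<exists>a\<in>S. y = z \<otimes> a"
    using principal_if_endo_trivial[OF sub UE U0 triv] by blast
  obtain a b where ab: "a \<in> S" "x = z \<otimes> a" "b \<in> S" "w = z \<otimes> b" using z(2) xU wU by meson
  have zE: "z \<in> E" "z \<in> carrier K" using z UE by auto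
  have "a \<notin> M" using ab zE x_M E_M by metis
  then obtain v where v: "v \<in> S" "v \<in> carrier K" "a \<otimes> v = \<one>" using ab notin_M_unit by metis
  have "z = x \<otimes> v" unfolding ab(2) using ab(1) v zE by (simp add: m_assoc)
  then have w_eq: "w = x \<otimes> v \<otimes> b" using ab by simp
  have bc: "b \<in> carrier K" using ab by simp
  have "(\<one> \<ominus> x) \<otimes> w = \<ominus> (e \<otimes> (v \<otimes> b))"
    unfolding w_eq by (rule ring_identity_mod[OF _ _ xx], (rule reify xc v e bc)+, code_simp)
  moreover have "\<one> \<ominus> x = (\<one> \<ominus> x) \<otimes> w \<ominus> e \<oplus> e \<otimes> y"
    unfolding one_w by (rule ring_identity, (rule reify xc e)+, code_simp)
  moreover have "\<ominus> (e \<otimes> (v \<otimes> b)) \<ominus> e \<oplus> e \<otimes> y \<in> M"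
    using e(1) y v(1) ab(3) by (intro M_closed) simp_all
  ultimately show False using x1_M by simp
qed

lemma idempotent_component':
  assumes y: "y \<in> E"
  obtains c where "c \<in> S" "c \<in> carrier K" "x \<otimes> y \<ominus> c \<otimes> x \<in> M"
  using idempotent_component[OF y] by auto

end

lemma idempotent_complement:
  assumes x: "x \<in> E" and idem: "x \<otimes> x \<ominus> x \<in> M" and x_M: "x \<notin> M"
  shows "\<one> \<ominus> x \<in> E" "(\<one> \<ominus> x) \<otimes> (\<one> \<ominus> x) \<ominus> (\<one> \<ominus> x) \<in> M" "\<one> \<ominus> (\<one> \<ominus> x) \<notin> M"
proof -
  have xc: "x \<in> carrier K" using x by simp
  show "\<one> \<ominus> x \<in> E" using x by simp
  have "(\<one> \<ominus> x) \<otimes> (\<one> \<ominus> x) \<ominus> (\<one> \<ominus> x) = x \<otimes> x \<ominus> x"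
    by (rule ring_identity, (rule reify xc)+, code_simp)
  then show "(\<one> \<ominus> x) \<otimes> (\<one> \<ominus> x) \<ominus> (\<one> \<ominus> x) \<in> M" using idem by simp
  have "\<one> \<ominus> (\<one> \<ominus> x) = x"
    by (rule ring_identity, (rule reify xc)+, code_simp)
  then show "\<one> \<ominus> (\<one> \<ominus> x) \<notin> M" using x_M by simp
qed

text \<open>On the \<open>x\<close> part \<open>w\<close> acts as a scalar \<open>c\<close>, whose
  square, and hence \<open>c\<close> itself, is in \<open>M\<close>.\<close>

lemma idempotent_reduced:
  assumes x: "x \<in> E" and idem: "x \<otimes> x \<ominus> x \<in> M" and x_M: "x \<notin> M" and x1_M: "\<one> \<ominus> x \<notin> M"
    and w: "w \<in> E" "w \<otimes> w \<in> M"
  shows "x \<otimes> w \<in> M"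
proof -
  obtain c where c: "c \<in> S" "c \<in> carrier K" "x \<otimes> w \<ominus> c \<otimes> x \<in> M"
    using idempotent_component'[OF x idem x_M x1_M w(1)] .
  have xc: "x \<in> carrier K" "w \<in> carrier K" using x w by simp_all
  have "(c \<otimes> c) \<otimes> x = x \<otimes> (w \<otimes> w) \<ominus> (x \<otimes> w \<ominus> c \<otimes> x) \<otimes> w \<ominus> c \<otimes> (x \<otimes> w \<ominus> c \<otimes> x)"
    by (rule ring_identity, (rule reify xc c)+, code_simp)
  also have "\<dots> \<in> M" using x w c by (intro M_closed) simp_all
  finally have "c \<otimes> c \<in> M" using c smult_x_M[OF x idem x_M x1_M] by simp
  then have "c \<in> M" using mult_notin_M[OF c(1) _ c(1)] by blast
  have "x \<otimes> w = (x \<otimes> w \<ominus> c \<otimes> x) \<oplus> c \<otimes> x"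
    by (rule ring_identity, (rule reify xc c)+, code_simp)
  also have "\<dots> \<in> M" using \<open>c \<in> M\<close> x c by simp
  finally show ?thesis .
qed

text \<open>Take for \<open>H\<close> the kernel of the projection of \<open>E\<close> to the
  \<open>x\<close> part; a product \<open>q t\<close> outside it is a nonzero scalar there, which
  \<open>c\<close> normalizes to \<open>1\<close>.\<close>

lemma idempotent_dual:
  assumes x: "x \<in> E" and idem: "x \<otimes> x \<ominus> x \<in> M" and x_M: "x \<notin> M" and x1_M: "\<one> \<ominus> x \<notin> M"
  obtains q t c where "q \<in> dual K M" "t \<in> M" "c \<in> S" "c \<in> carrier K"
    "x \<otimes> (q \<otimes> t) \<otimes> c \<ominus> x \<in> M"
proof -
  define H where "H = {y \<in> E. x \<otimes> y \<in> M}"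
  have "sum_closed K H" "\<one> \<notin> H" using x x_M by (auto simp: H_def sum_closed_def r_distr)
  then obtain q t where qt: "q \<in> dual K M" "t \<in> M" "q \<otimes> t \<notin> H"
    using invertible_over_endoE[OF invertible_M] by metis
  then have g: "q \<otimes> t \<in> E" "x \<otimes> (q \<otimes> t) \<notin> M" using dual_M_mult by (auto simp: H_def)
  define g where "g = q \<otimes> t"
  obtain c where c: "c \<in> S" "c \<in> carrier K" "x \<otimes> g \<ominus> c \<otimes> x \<in> M"
    using idempotent_component'[OF x idem x_M x1_M g(1)] unfolding g_def .
  have xc: "x \<in> carrier K" "g \<in> carrier K" using x g by (simp_all add: g_def)
  have "c \<notin> M"
  proof
    assume "c \<in> M"
    have "x \<otimes> g = (x \<otimes> g \<ominus> c \<otimes> x) \<oplus> c \<otimes> x"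
      by (rule ring_identity, (rule reify xc c)+, code_simp)
    also have "\<dots> \<in> M" using \<open>c \<in> M\<close> x c by simp
    finally show False using g by (simp add: g_def)
  qed
  then obtain v where v: "v \<in> S" "v \<in> carrier K" "c \<otimes> v = \<one>" using c notin_M_unit by metis
  have "x \<otimes> g \<otimes> v \<ominus> (c \<otimes> v) \<otimes> x = v \<otimes> (x \<otimes> g \<ominus> c \<otimes> x)"
    by (rule ring_identity, (rule reify xc c v)+, code_simp)
  then have "x \<otimes> g \<otimes> v \<ominus> x \<in> M" using v c xc by simp
  then show thesis using that qt v by (simp add: g_def)
qed

text \<open>Both parts are copies of the residue field, whence the first two claims. For the third,
  generators found on each part are glued along \<open>x\<close> and \<open>1 - x\<close> as in the
  Chinese remainder theorem.\<close>

lemma idempotent_case: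
  assumes x: "x \<in> E" and idem: "x \<otimes> x \<ominus> x \<in> M" and x_M: "x \<notin> M" and x1_M: "\<one> \<ominus> x \<notin> M"
  shows "E \<subseteq> lin x" and E_reduced and M_principal
proof -
  note 1 = x idem x_M x1_M
  note 2 = idempotent_complement(1,2)[OF 1(1-3)] x1_M idempotent_complement(3)[OF 1(1-3)]
  have xc: "x \<in> carrier K" using x by simp
  show "E \<subseteq> lin x"
  proof
    fix y assume y: "y \<in> E"
    obtain c where c: "c \<in> S" "c \<in> carrier K" "x \<otimes> y \<ominus> c \<otimes> x \<in> M"
      using idempotent_component'[OF 1 y] .
    obtain d where d: "d \<in> S" "d \<in> carrier K" "(\<one> \<ominus> x) \<otimes> y \<ominus> d \<otimes> (\<one> \<ominus> x) \<in> M"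
      using idempotent_component'[OF 2 y] .
    have yc: "y \<in> carrier K" using y by simp
    have "y = ((x \<otimes> y \<ominus> c \<otimes> x) \<oplus> ((\<one> \<ominus> x) \<otimes> y \<ominus> d \<otimes> (\<one> \<ominus> x)) \<oplus> d) \<oplus> (c \<ominus> d) \<otimes> x"
      by (rule ring_identity, (rule reify xc yc c d)+, code_simp)
    moreover have "(x \<otimes> y \<ominus> c \<otimes> x) \<oplus> ((\<one> \<ominus> x) \<otimes> y \<ominus> d \<otimes> (\<one> \<ominus> x)) \<oplus> d \<in> S"
      by (intro S_closed(4) M_S[OF c(3)] M_S[OF d(3)] d(1))
    ultimately show "y \<in> lin x" using c(1) d(1) by (intro linI) simp_all
  qed
  show E_reduced
    unfolding E_reduced_def
  proof (intro ballI impI)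
    fix w assume w: "w \<in> E" "w \<otimes> w \<in> M"
    have wc: "w \<in> carrier K" using w by simp
    have "w = x \<otimes> w \<oplus> (\<one> \<ominus> x) \<otimes> w"
      by (rule ring_identity, (rule reify xc wc)+, code_simp)
    moreover have "x \<otimes> w \<oplus> (\<one> \<ominus> x) \<otimes> w \<in> M"
      using idempotent_reduced[OF 1 w] idempotent_reduced[OF 2 w] by (rule M_closed)
    ultimately show "w \<in> M" by simp
  qed
  obtain q t c where q: "q \<in> dual K M" "t \<in> M" "c \<in> S" "c \<in> carrier K"
    and qt: "x \<otimes> (q \<otimes> t) \<otimes> c \<ominus> x \<in> M" using idempotent_dual[OF 1] .
  obtain q' t' c' where q': "q' \<in> dual K M" "t' \<in> M" "c' \<in> S" "c' \<in> carrier K"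
    and qt': "(\<one> \<ominus> x) \<otimes> (q' \<otimes> t') \<otimes> c' \<ominus> (\<one> \<ominus> x) \<in> M" using idempotent_dual[OF 2] .
  have E4: "q \<otimes> t \<in> E" "q' \<otimes> t' \<in> E" "q \<otimes> t' \<in> E" "q' \<otimes> t \<in> E" using q q' dual_M_mult by metis+
  have cc: "q \<in> carrier K" "t \<in> carrier K" "q' \<in> carrier K" "t' \<in> carrier K"
    using q q' dual_M_mult by auto
  define T where "T = x \<otimes> t \<oplus> (\<one> \<ominus> x) \<otimes> t'"
  define Q where "Q = x \<otimes> q \<oplus> (\<one> \<ominus> x) \<otimes> q'"
  define V where "V = c \<otimes> x \<oplus> c' \<otimes> (\<one> \<ominus> x)"
  have T: "T \<in> M" using q q' x by (simp add: T_def)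
  have Q: "Q \<in> dual K M"
  proof -
    have "Q \<otimes> (m \<otimes> m') \<in> M" if m: "m \<in> M" "m' \<in> M" for m m'
    proof -
      have mc: "m \<in> carrier K" "m' \<in> carrier K" using m by simp_all
      have "Q \<otimes> (m \<otimes> m') = x \<otimes> (q \<otimes> (m \<otimes> m')) \<oplus> (\<one> \<ominus> x) \<otimes> (q' \<otimes> (m \<otimes> m'))"
        unfolding Q_def by (rule ring_identity, (rule reify xc cc mc)+, code_simp)
      also have "\<dots> \<in> M"
        using m q(1) q'(1) x by (simp add: dual_def)
      finally show ?thesis .
    qed
    then show ?thesis using xc cc by (auto simp: dual_def Q_def)
  qed
  have V: "V \<in> E" using q q' x by (simp add: V_def S_E)
  have Tc: "T \<in> carrier K" "Q \<in> carrier K" "V \<in> carrier K" using T V dual_M_mult(2)[OF Q T] by auto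
  define e where "e = x \<otimes> x \<ominus> x"
  have e: "e \<in> M" "e \<in> carrier K" using idem x by (auto simp: e_def)
  have xx: "x \<otimes> x = x \<oplus> e" unfolding e_def
    by (rule ring_identity, (rule reify xc)+, code_simp)
  define g h r where "g = q \<otimes> t" and "h = q' \<otimes> t'" and "r = q \<otimes> t' \<oplus> q' \<otimes> t"
  have ghr: "g \<in> E" "h \<in> E" "r \<in> E" using E4 by (simp_all add: g_def h_def r_def)
  \<comment> \<open>The error of \<open>Q T V\<close> against \<open>1\<close>; the mixed terms
    carry the factor \<open>x (1 - x) = - e\<close>.\<close>
  define m where "m = (x \<otimes> g \<otimes> c \<ominus> x) \<oplus> ((\<one> \<ominus> x) \<otimes> h \<otimes> c' \<ominus> (\<one> \<ominus> x))
     \<oplus> e \<otimes> (g \<otimes> c \<ominus> g \<otimes> c' \<ominus> h \<otimes> c \<oplus> h \<otimes> c' \<oplus> (g \<oplus> h \<ominus> r) \<otimes> V)"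
  have m: "m \<in> M"
    unfolding m_def using qt[folded g_def] qt'[folded h_def] e(1) ghr V q(3) q'(3)
    by (intro M_closed(2)) (simp_all add: S_E)
  have QTV: "Q \<otimes> T \<otimes> V = \<one> \<oplus> m"
    unfolding m_def V_def g_def h_def r_def Q_def T_def
    by (rule ring_identity_mod[OF _ _ xx], (rule reify xc cc q(4) q'(4) e(2))+, code_simp)
  have "\<one> \<oplus> m \<in> S" "\<one> \<oplus> m \<notin> M"
    using m add_M_notin one_notin_M S_closed(1,4) M_S by blast+
  then obtain s where s: "s \<in> S" "s \<in> carrier K" "(\<one> \<oplus> m) \<otimes> s = \<one>" using notin_M_unit by metis
  have "Q \<otimes> T \<otimes> (V \<otimes> s) = \<one>"
    using s QTV Tc by (simp add: m_assoc[symmetric])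
  then show M_principal
    using M_principal_if_unit[OF Q T] V s S_E T unfolding M_principal_def by (meson E_closed(4))
qed

text \<open>Amounts to \<open>E\<close> being local with the residue field of \<open>S\<close>.
  Squares suffice because elements of \<open>E\<close> satisfy quadratic relations, so nilpotents of
  \<open>E/M\<close> have square zero.\<close>

definition E_local :: bool
  where "E_local \<longleftrightarrow> (\<forall>x\<in>E. \<exists>c\<in>S. (x \<ominus> c) \<otimes> (x \<ominus> c) \<in> M)"

text \<open>Decided by the quadratic equation of an \<open>x\<close> that violates
  \<open>E_local\<close>. Without a root modulo \<open>M\<close> the ring \<open>E/M\<close> is a
  field; two distinct roots yield an idempotent by interpolation; a double root \<open>c\<close>
  would give \<open>(x - c)^2\<close> in \<open>M\<close>, against the choice of
  \<open>x\<close>.\<close>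

lemma reduced_or_local:
  "(\<exists>x\<in>E. E \<subseteq> lin x) \<and> E_reduced \<and> M_principal \<or> E_local"
proof (cases E_local)
  case False
  then obtain x where x: "x \<in> E" and not: "\<And>c. c \<in> S \<Longrightarrow> (x \<ominus> c) \<otimes> (x \<ominus> c) \<notin> M"
    unfolding E_local_def by blast
  obtain a b where ab: "a \<in> S" "b \<in> S" "a \<in> carrier K" "b \<in> carrier K" "x \<otimes> x = a \<oplus> b \<otimes> x"
    using square_eq[OF x] .
  have xc: "x \<in> carrier K" using x by simp
  show ?thesis
  proof (cases "\<exists>c\<in>S. c \<otimes> c \<ominus> b \<otimes> c \<ominus> a \<in> M")
    case False
    then have nr: "\<And>c. c \<in> S \<Longrightarrow> c \<otimes> c \<ominus> b \<otimes> c \<ominus> a \<notin> M" by blast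
    note * = E_no_root[OF x ab(1,2,5) nr]
    show ?thesis
      using *(1) x reduced_no_root[OF *(2)] M_principal_local[OF sum_closed_M one_notin_M *(2)] by blast
  next
    case True
    then obtain c where c: "c \<in> S" "c \<otimes> c \<ominus> b \<otimes> c \<ominus> a \<in> M" by blast
    \<comment> \<open>The other root, the two having sum \<open>b\<close>.\<close>
    define d where "d = b \<ominus> c"
    have d: "d \<in> S" "d \<in> carrier K" "c \<in> carrier K" using c ab by (simp_all add: d_def)
    have "(x \<ominus> c) \<otimes> (x \<ominus> d) = \<ominus> (c \<otimes> c \<ominus> b \<otimes> c \<ominus> a)"
      unfolding d_def by (rule ring_identity_mod[OF _ _ ab(5)], (rule reify xc ab d)+, code_simp)
    then have cd: "(x \<ominus> c) \<otimes> (x \<ominus> d) \<in> M" using c by simp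
    have "d \<ominus> c \<notin> M"
    proof
      assume "d \<ominus> c \<in> M"
      have "(x \<ominus> c) \<otimes> (x \<ominus> c) = (x \<ominus> c) \<otimes> (x \<ominus> d) \<oplus> (x \<ominus> c) \<otimes> (d \<ominus> c)"
        by (rule ring_identity, (rule reify xc d)+, code_simp)
      also have "\<dots> \<in> M" using cd \<open>d \<ominus> c \<in> M\<close> x c by (simp add: S_E)
      finally show False using not c by simp
    qed
    then obtain v where v: "v \<in> S" "v \<in> carrier K" "(d \<ominus> c) \<otimes> v = \<one>"
      using notin_M_unit c d S_closed(5) by metis
    \<comment> \<open>\<open>(x - c) / (d - c)\<close> takes the values 0 and 1 at the two roots,
      hence is idempotent modulo \<open>M\<close>.\<close>
    define y where "y = v \<otimes> (x \<ominus> c)"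
    have y: "y \<in> E" using v x c by (simp add: y_def S_E)
    have dcy: "(d \<ominus> c) \<otimes> y = x \<ominus> c"
    proof -
      have "(d \<ominus> c) \<otimes> y = ((d \<ominus> c) \<otimes> v) \<otimes> (x \<ominus> c)"
        unfolding y_def by (rule ring_identity, (rule reify xc d v)+, code_simp)
      then show ?thesis using v xc d by simp
    qed
    have "y \<otimes> y \<ominus> y = y \<otimes> y \<ominus> ((d \<ominus> c) \<otimes> v) \<otimes> y" using y v by simp
    also have "\<dots> = (v \<otimes> v) \<otimes> ((x \<ominus> c) \<otimes> (x \<ominus> d))"
      unfolding y_def by (rule ring_identity, (rule reify xc d v)+, code_simp)
    also have "\<dots> \<in> M" using cd v by simp
    finally have idem: "y \<otimes> y \<ominus> y \<in> M" .
    have yM: "y \<notin> M"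
    proof
      assume "y \<in> M"
      then have "x \<ominus> c \<in> M" using dcy c d by (metis M_smult(1) S_closed(5))
      then show False using not[OF c(1)] M_S E_M x c by (metis E_closed(3) S_E)
    qed
    have y1M: "\<one> \<ominus> y \<notin> M"
    proof
      assume 1: "\<one> \<ominus> y \<in> M"
      have yc: "y \<in> carrier K" using y by simp
      have "x \<ominus> d = (x \<ominus> c) \<ominus> (d \<ominus> c)"
        by (rule ring_identity, (rule reify xc d)+, code_simp)
      also have "\<dots> = \<ominus> ((d \<ominus> c) \<otimes> (\<one> \<ominus> y))"
        unfolding dcy[symmetric] by (rule ring_identity, (rule reify yc xc d)+, code_simp)
      also have "\<dots> \<in> M" using 1 c d by simp
      finally show False using not[OF d(1)] x d by (metis E_M(1) E_closed(3) S_E)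
    qed
    show ?thesis using idempotent_case[OF y idem yM y1M] y by blast
  qed
qed blast

text \<open>Write \<open>x = c + n\<close> with \<open>n n\<close> in \<open>M\<close>. Then
  \<open>c\<close> is a unit, and \<open>c - n\<close>, that is \<open>c + c - x\<close>, multiplies
  \<open>x\<close> to the unit \<open>c c - n n\<close> of \<open>S\<close>.\<close>

lemma local_unit:
  assumes E_local and x: "x \<in> E" "x \<otimes> x \<notin> M"
  obtains y where "y \<in> E" "x \<otimes> y = \<one>"
proof -
  obtain c where c: "c \<in> S" "(x \<ominus> c) \<otimes> (x \<ominus> c) \<in> M" using assms unfolding E_local_def by blast
  have cc: "c \<in> carrier K" "x \<in> carrier K" using c x by simp_all
  have "c \<notin> M"
  proof
    assume "c \<in> M"
    have "x \<otimes> x = (x \<ominus> c) \<otimes> (x \<ominus> c) \<oplus> (x \<oplus> x \<ominus> c) \<otimes> c"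
      by (rule ring_identity, (rule reify cc)+, code_simp)
    also have "\<dots> \<in> M" using \<open>c \<in> M\<close> c x by (simp add: S_E)
    finally show False using x by simp
  qed
  then have "c \<otimes> c \<notin> M" using c mult_notin_M by blast
  then have "c \<otimes> c \<oplus> \<ominus> ((x \<ominus> c) \<otimes> (x \<ominus> c)) \<notin> M" using c by (intro add_M_notin) simp_all
  moreover have "c \<otimes> c \<oplus> \<ominus> ((x \<ominus> c) \<otimes> (x \<ominus> c)) \<in> S"
    using c M_S[OF M_closed(1)[OF c(2)]] by simp
  ultimately obtain v where v: "v \<in> S" "v \<in> carrier K" "(c \<otimes> c \<oplus> \<ominus> ((x \<ominus> c) \<otimes> (x \<ominus> c))) \<otimes> v = \<one>"
    using notin_M_unit by metis
  have "x \<otimes> ((c \<oplus> c \<ominus> x) \<otimes> v) = (c \<otimes> c \<oplus> \<ominus> ((x \<ominus> c) \<otimes> (x \<ominus> c))) \<otimes> v"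
    by (rule ring_identity, (rule reify cc v)+, code_simp)
  then show thesis using that[of "(c \<oplus> c \<ominus> x) \<otimes> v"] v c x by (simp add: S_E)
qed

lemma nonunits_E:
  assumes E_local
  shows "nonunits K E = {x \<in> E. x \<otimes> x \<in> M}"
proof (intro equalityI subsetI)
  fix x assume "x \<in> nonunits K E"
  then have "x \<in> E" "\<not> (\<exists>y\<in>E. x \<otimes> y = \<one>)" by (auto simp: nonunits_def)
  then show "x \<in> {x \<in> E. x \<otimes> x \<in> M}" using local_unit[OF assms] by blast
next
  fix x assume "x \<in> {x \<in> E. x \<otimes> x \<in> M}"
  then have x: "x \<in> E" "x \<otimes> x \<in> M" by auto
  have "x \<otimes> y \<noteq> \<one>" if y: "y \<in> E" for y
  proof
    assume xy: "x \<otimes> y = \<one>"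
    have c: "x \<in> carrier K" "y \<in> carrier K" using x y by simp_all
    have "(x \<otimes> y) \<otimes> (x \<otimes> y) = (y \<otimes> y) \<otimes> (x \<otimes> x)"
      by (rule ring_identity, (rule reify c)+, code_simp)
    then have "\<one> \<in> M" using xy x y by (metis E_M(1) E_closed(4) l_one one_closed)
    then show False using one_notin_M by simp
  qed
  then show "x \<in> nonunits K E" using x by (simp add: nonunits_def)
qed

text \<open>The cube of \<open>x + y\<close> is a combination of \<open>x x\<close> and
  \<open>y y\<close>, so it lies in \<open>M\<close>, and no multiple of it is
  \<open>1\<close>.\<close>

lemma nonunits_E_add:
  assumes E_local and x: "x \<in> nonunits K E" and y: "y \<in> nonunits K E"
  shows "x \<oplus> y \<in> nonunits K E"
proof -
  have xy: "x \<in> E" "x \<otimes> x \<in> M" "y \<in> E" "y \<otimes> y \<in> M" using assms nonunits_E by auto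
  have c: "x \<in> carrier K" "y \<in> carrier K" using xy by simp_all
  have "(x \<oplus> y) \<otimes> z \<noteq> \<one>" if z: "z \<in> E" for z
  proof
    assume 1: "(x \<oplus> y) \<otimes> z = \<one>"
    have zc: "z \<in> carrier K" using z by simp
    have "((x \<oplus> y) \<otimes> z) \<otimes> ((x \<oplus> y) \<otimes> z) \<otimes> ((x \<oplus> y) \<otimes> z) =
      (z \<otimes> z \<otimes> z) \<otimes> ((x \<oplus> y \<oplus> y \<oplus> y) \<otimes> (x \<otimes> x) \<oplus> (x \<oplus> x \<oplus> x \<oplus> y) \<otimes> (y \<otimes> y))"
      by (rule ring_identity, (rule reify c zc)+, code_simp)
    also have "\<dots> \<in> M" using z xy by simp
    finally show False using 1 one_notin_M by simp
  qed
  then show ?thesis using xy by (simp add: nonunits_def)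
qed

end

section \<open>Integral closure over a fixed base ring\<close>

text \<open>A substitute for integrality over \<open>R\<close>, with \<open>d\<close> the degree of an integral equation, that passes
  to all intermediate rings.\<close>

definition power_bounded :: "('a, 'm) ring_scheme \<Rightarrow> 'a set \<Rightarrow> 'a set"
  where "power_bounded K R = {z \<in> carrier K. \<exists>d::nat. \<forall>S. subring S K \<and> R \<subseteq> S \<longrightarrow>
    (\<forall>c\<in>S. c \<otimes>\<^bsub>K\<^esub> z \<in> S \<longrightarrow> (\<exists>s\<in>S. (c \<otimes>\<^bsub>K\<^esub> z) [^]\<^bsub>K\<^esub> d = c \<otimes>\<^bsub>K\<^esub> s))}"

context field
begin

text \<open>Halving the exponent, rounded up, reduces to the hypothesis on squares; the surplus
  power of \<open>w\<close> is absorbed into \<open>s\<close>.\<close>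

lemma radical_power:
  assumes S: "subring S R" and p: "p \<in> S"
    and rad: "\<And>w s. \<lbrakk>w \<in> S; s \<in> S; w \<otimes> w = p \<otimes> s\<rbrakk> \<Longrightarrow> \<exists>s\<in>S. w = p \<otimes> s"
    and w: "w \<in> S"
  shows "s \<in> S \<Longrightarrow> w [^] (d::nat) = p \<otimes> s \<Longrightarrow> \<exists>s\<in>S. w = p \<otimes> s"
proof (induction d arbitrary: s rule: less_induct)
  case (less d)
  have Sc: "x \<in> carrier R" if "x \<in> S" for x using subringE(1)[OF S] that by blast
  have Sm: "x \<otimes> y \<in> S" if "x \<in> S" "y \<in> S" for x y using subringE(6)[OF S] that .
  have pw: "w [^] (n::nat) \<in> S" for n
    by (induction n) (use Sm w subringE(3)[OF S] in auto)
  note c = Sc[OF p] Sc[OF w] Sc[OF less.prems(1)]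
  consider "d = 0" | "d = 1" | "d \<ge> 2" by linarith
  then show ?case
  proof cases
    case 1
    then have "p \<otimes> s \<otimes> w = w" using less.prems(2) c by (metis l_one nat_pow_0)
    then have "w = p \<otimes> (s \<otimes> w)" using c by (simp add: m_assoc)
    then show ?thesis using Sm[OF less.prems(1) w] by blast
  next
    case 2
    then show ?thesis using less.prems c by auto
  next
    case 3
    define k where "k = (d + 1) div 2"
    have k: "k < d" "d \<le> k + k" using 3 by (auto simp: k_def)
    have "w [^] k \<otimes> w [^] k = w [^] (d + (k + k - d))"
      using c k by (simp add: nat_pow_mult)
    also have "\<dots> = w [^] d \<otimes> w [^] (k + k - d)" using c(2) by (rule nat_pow_mult[symmetric])
    also have "\<dots> = p \<otimes> (s \<otimes> w [^] (k + k - d))" using less.prems(2) c by (simp add: m_assoc)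
    finally obtain s' where "s' \<in> S" "w [^] k = p \<otimes> s'"
      using rad[OF pw] Sm[OF less.prems(1) pw] by blast
    then show ?thesis using less.IH[OF k(1)] by blast
  qed
qed

text \<open>Take the least \<open>n\<close> with \<open>p^n z\<close> in \<open>S\<close>. If
  \<open>n > 0\<close>, boundedness with \<open>c = p^n\<close> puts a power of \<open>p^n z\<close>
  into \<open>p S\<close>; that ideal being radical, one factor \<open>p\<close> can be cancelled,
  against minimality.\<close>

lemma power_bounded_mem:
  assumes S: "subring S R" "A \<subseteq> S" and p: "p \<in> S" "p \<noteq> \<zero>"
    and rad: "\<And>w s. \<lbrakk>w \<in> S; s \<in> S; w \<otimes> w = p \<otimes> s\<rbrakk> \<Longrightarrow> \<exists>s\<in>S. w = p \<otimes> s"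
    and absorb: "\<exists>n::nat. p [^] n \<otimes> z \<in> S"
    and z: "z \<in> power_bounded R A"
  shows "z \<in> S"
proof -
  have Sc: "x \<in> carrier R" if "x \<in> S" for x using subringE(1)[OF S(1)] that by blast
  have Sm: "x \<otimes> y \<in> S" if "x \<in> S" "y \<in> S" for x y using subringE(6)[OF S(1)] that .
  have pw: "p [^] (n::nat) \<in> S" for n
    by (induction n) (use Sm p subringE(3)[OF S(1)] in auto)
  have zc: "z \<in> carrier R" using z by (simp add: power_bounded_def)
  define n :: nat where "n = (LEAST n. p [^] n \<otimes> z \<in> S)"
  have n: "p [^] n \<otimes> z \<in> S" unfolding n_def by (rule LeastI_ex[of "\<lambda>n. p [^] n \<otimes> z \<in> S", OF absorb])
  obtain d :: nat where d: "\<And>c. \<lbrakk>c \<in> S; c \<otimes> z \<in> S\<rbrakk> \<Longrightarrow> \<exists>s\<in>S. (c \<otimes> z) [^] d = c \<otimes> s"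
  proof -
    from z obtain d :: nat where "\<forall>S. subring S R \<and> A \<subseteq> S \<longrightarrow>
        (\<forall>c\<in>S. c \<otimes> z \<in> S \<longrightarrow> (\<exists>s\<in>S. (c \<otimes> z) [^] d = c \<otimes> s))"
      unfolding power_bounded_def by auto
    then show thesis using S by (intro that[of d]) simp
  qed
  show ?thesis
  proof (cases n)
    case 0
    then show ?thesis using n zc by simp
  next
    case (Suc k)
    obtain s where s: "s \<in> S" "(p [^] n \<otimes> z) [^] d = p [^] n \<otimes> s" using d[OF pw n] by blast
    have "p [^] n \<otimes> s = p \<otimes> (p [^] k \<otimes> s)"
      using Suc Sc[OF p(1)] Sc[OF s(1)] by (metis m_assoc nat_pow_Suc2 nat_pow_closed)
    then have e: "(p [^] n \<otimes> z) [^] d = p \<otimes> (p [^] k \<otimes> s)" using s(2) by simp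
    have "\<exists>s\<in>S. p [^] n \<otimes> z = p \<otimes> s"
      by (rule radical_power[OF S(1) p(1) _ n Sm[OF pw s(1)] e]) (rule rad)
    then obtain s' where s': "s' \<in> S" "p [^] n \<otimes> z = p \<otimes> s'" by blast
    have "p [^] n \<otimes> z = p \<otimes> (p [^] k \<otimes> z)"
      using Suc Sc[OF p(1)] zc by (metis m_assoc nat_pow_Suc2 nat_pow_closed)
    then have "p [^] k \<otimes> z = s'"
      using s' m_lcancel[OF p(2) Sc[OF p(1)], of "p [^] k \<otimes> z" s'] zc Sc p(1) by simp
    then have "p [^] k \<otimes> z \<in> S" using s' by simp
    then have "n \<le> k" unfolding n_def by (rule Least_le)
    then show ?thesis using Suc by simp
  qed
qed

end

text \<open>\<open>N\<close> will be the closure over the base ring. That \<open>W\<close> also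
  contains the endomorphism ring of the nonunits is what lets the property descend along the
  chain.\<close>

definition two_generated_closure :: "('a, 'm) ring_scheme \<Rightarrow> 'a set \<Rightarrow> 'a set \<Rightarrow> bool"
  where "two_generated_closure K N S \<longleftrightarrow>
    (\<exists>W x. subring W K \<and> x \<in> W \<and> W = affine_span K S x \<and> endo_nonunits K S \<subseteq> W \<and> N \<subseteq> W)"

context stable_subring
begin

lemma M_subset_nonunits_E: "\<lbrakk>E_local; m \<in> M\<rbrakk> \<Longrightarrow> m \<in> nonunits K E"
  by (simp add: nonunits_E S_E M_S)

text \<open>A module over \<open>E\<close> is one over \<open>S\<close>, and multiplying its
  denominator by a nonzero element of \<open>M\<close> brings it from \<open>E\<close> into
  \<open>S\<close>. The square of a nonunit of \<open>E\<close> is in \<open>M\<close>, where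
  \<open>absorbing\<close> applies.\<close>

lemma stable_subring_E:
  assumes loc: E_local
  shows "stable_subring K E"
proof (intro stable_subring.intro stable_subring_axioms.intro)
  show "field K" by (rule field_axioms)
  show "subring E K" by (rule subring_E)
  show "x \<oplus> y \<in> nonunits K E" if "x \<in> nonunits K E" "y \<in> nonunits K E" for x y
    using nonunits_E_add[OF loc that] .
  obtain m where m: "m \<in> M" "m \<noteq> \<zero>" "m \<in> carrier K" by (rule nonzero_nonunit)
  show "nonunits K E \<noteq> {\<zero>}" using M_subset_nonunits_E[OF loc m(1)] m(2) by auto
  show "invertible_over_endo K I"
    if I: "submodule_over K E I" "I \<noteq> {\<zero>}" and c: "c \<in> carrier K" "c \<noteq> \<zero>" "\<And>x. x \<in> I \<Longrightarrow> c \<otimes> x \<in> E" for I c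
  proof (rule invertible_fractional[OF _ I(2)])
    show "submodule_over K S I" using I(1) by (auto simp: submodule_over_def S_E)
    show "m \<otimes> c \<in> carrier K" using m c by simp
    show "m \<otimes> c \<noteq> \<zero>" using m c by (simp add: integral_iff)
    show "m \<otimes> c \<otimes> x \<in> S" if "x \<in> I" for x
    proof -
      have "x \<in> carrier K" using that I by (auto simp: submodule_over_def)
      then have "m \<otimes> c \<otimes> x = m \<otimes> (c \<otimes> x)" using m c by (simp add: m_assoc)
      then show ?thesis using m c(3)[OF that] by (simp add: M_S)
    qed
  qed
  show "\<exists>n::nat. x [^] n \<otimes> z \<in> E" if x: "x \<in> nonunits K E" "x \<noteq> \<zero>" and z: "z \<in> carrier K" for x z
  proof -
    have x': "x \<in> E" "x \<otimes> x \<in> M" using x nonunits_E[OF loc] by auto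
    have xc: "x \<in> carrier K" using x' by simp
    then have "x \<otimes> x \<noteq> \<zero>" using x by (simp add: integral_iff)
    then obtain n :: nat where n: "(x \<otimes> x) [^] n \<otimes> z \<in> S" using absorbing[OF x'(2) _ z] by blast
    have "(x \<otimes> x) [^] n = x [^] (2 * n)"
      using xc by (metis nat_pow_pow numeral_2_eq_2 nat_pow_0 nat_pow_Suc l_one)
    then show ?thesis using n S_E by metis
  qed
qed

text \<open>In the local case the elements of \<open>E\<close> outside its nonunits are units, so
  \<open>M_principal_local\<close> applies; the other case of \<open>reduced_or_local\<close>
  includes the claim.\<close>

lemma M_principal_always: M_principal
proof -
  have M_principal if loc: E_local
  proof (rule M_principal_local)
    interpret E1: stable_subring K E by (rule stable_subring_E[OF loc])
    show "sum_closed K (nonunits K E)" by (rule E1.sum_closed_M)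
    show "\<one> \<notin> nonunits K E" by (rule E1.one_notin_M)
    show "\<exists>v\<in>E. w \<otimes> v = \<one>" if "w \<in> E" "w \<notin> nonunits K E" for w
      using that unfolding nonunits_def[of K E] by blast
  qed
  then show ?thesis using reduced_or_local by blast
qed

lemma lin_eq_E: "\<lbrakk>x \<in> E; E \<subseteq> lin x\<rbrakk> \<Longrightarrow> E = lin x"
  using submodule_lin(2) by blast

text \<open>When \<open>E/M\<close> is reduced, \<open>M = t E\<close> is a radical ideal of
  \<open>E\<close>, so \<open>power_bounded_mem\<close> puts the closure inside
  \<open>E = S + S x\<close>.\<close>

lemma two_generated_reduced:
  assumes A: "A \<subseteq> S" and x: "x \<in> E" "E \<subseteq> lin x" and red: E_reduced
  shows "two_generated_closure K (power_bounded K A) S"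
proof -
  obtain t where t: "t \<in> M" "\<And>m. m \<in> M \<Longrightarrow> \<exists>e\<in>E. m = t \<otimes> e"
    using M_principal_always unfolding M_principal_def by blast
  have t0: "t \<noteq> \<zero>"
  proof
    assume "t = \<zero>"
    obtain m where m: "m \<in> M" "m \<noteq> \<zero>" "m \<in> carrier K" by (rule nonzero_nonunit)
    then show False using t(2)[OF m(1)] \<open>t = \<zero>\<close> by auto
  qed
  have "power_bounded K A \<subseteq> E"
  proof
    fix z assume z: "z \<in> power_bounded K A"
    show "z \<in> E"
    proof (rule power_bounded_mem[OF subring_E _ _ t0 _ _ z])
      show "A \<subseteq> E" using A S_E by blast
      show "t \<in> E" using t by (simp add: S_E M_S)
      show "\<exists>s\<in>E. w = t \<otimes> s" if "w \<in> E" "s \<in> E" "w \<otimes> w = t \<otimes> s" for w s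
        using red that t unfolding E_reduced_def by (metis E_M(2))
      show "\<exists>n::nat. t [^] n \<otimes> z \<in> E"
        using absorbing[OF t(1) t0, of z] z S_E by (auto simp: power_bounded_def)
    qed
  qed
  then show ?thesis
    unfolding two_generated_closure_def using subring_E x lin_eq_E[OF x] by blast
qed

lemma E_decomp:
  assumes loc: E_local and y: "y \<in> E"
  obtains c m where "c \<in> S" "c \<in> carrier K" "m \<in> nonunits K E" "m \<in> E" "m \<in> carrier K" "y = c \<oplus> m"
proof -
  obtain c where c: "c \<in> S" "(y \<ominus> c) \<otimes> (y \<ominus> c) \<in> M" using loc y unfolding E_local_def by blast
  have cc: "c \<in> carrier K" "y \<in> carrier K" using c y by simp_all
  have "y = c \<oplus> (y \<ominus> c)"
    by (rule ring_identity, (rule reify cc)+, code_simp)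
  moreover have "y \<ominus> c \<in> E" using c y by (simp add: S_E)
  moreover have "y \<ominus> c \<in> nonunits K E" using c \<open>y \<ominus> c \<in> E\<close> nonunits_E[OF loc] by simp
  ultimately show thesis using that[of c "y \<ominus> c"] c by simp
qed

text \<open>If \<open>x\<close> generates the nonunits of \<open>E\<close>, they form a radical
  principal ideal, and \<open>E\<close> again contains the closure. Two steps of
  \<open>E = S + x E\<close> give \<open>E = S + S x + x x E\<close>, and \<open>x x E\<close> lies
  in \<open>M\<close>.\<close>

lemma two_generated_principal:
  assumes A: "A \<subseteq> S" and loc: E_local
    and x: "x \<in> nonunits K E" and prin: "\<And>y. y \<in> nonunits K E \<Longrightarrow> \<exists>e\<in>E. y = x \<otimes> e"
  shows "two_generated_closure K (power_bounded K A) S"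
proof -
  interpret E1: stable_subring K E by (rule stable_subring_E[OF loc])
  have x': "x \<in> E" "x \<otimes> x \<in> M" "x \<in> carrier K" using x nonunits_E[OF loc] by auto
  have x0: "x \<noteq> \<zero>"
  proof
    assume "x = \<zero>"
    obtain m where m: "m \<in> nonunits K E" "m \<noteq> \<zero>" "m \<in> carrier K" by (rule E1.nonzero_nonunit)
    then show False using prin[OF m(1)] \<open>x = \<zero>\<close> by auto
  qed
  have "E \<subseteq> lin x"
  proof
    fix y assume y: "y \<in> E"
    obtain c m where c: "c \<in> S" "c \<in> carrier K" "m \<in> nonunits K E" "y = c \<oplus> m"
      using E_decomp[OF loc y] by metis
    obtain e where e: "e \<in> E" "m = x \<otimes> e" using prin[OF c(3)] by blast
    obtain c' m' where c': "c' \<in> S" "c' \<in> carrier K" "m' \<in> nonunits K E" "e = c' \<oplus> m'"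
      using E_decomp[OF loc e(1)] by metis
    obtain e' where e': "e' \<in> E" "m' = x \<otimes> e'" using prin[OF c'(3)] by blast
    have e'c: "e' \<in> carrier K" using e' by simp
    have "y = (c \<oplus> (x \<otimes> x) \<otimes> e') \<oplus> c' \<otimes> x"
      unfolding c(4) e(2) c'(4) e'(2)
      by (rule ring_identity, (rule reify c c' e'c x')+, code_simp)
    moreover have "c \<oplus> (x \<otimes> x) \<otimes> e' \<in> S" using c x' e' by (simp add: M_S)
    ultimately show "y \<in> lin x" using c' by (intro linI) auto
  qed
  moreover have "power_bounded K A \<subseteq> E"
  proof
    fix z assume z: "z \<in> power_bounded K A"
    show "z \<in> E"
    proof (rule power_bounded_mem[OF subring_E _ x'(1) x0 _ _ z])
      show "A \<subseteq> E" using A S_E by blast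
      show "\<exists>s\<in>E. w = x \<otimes> s" if "w \<in> E" "s \<in> E" "w \<otimes> w = x \<otimes> s" for w s
        using prin E1.mult_notin_M[OF that(1) _ that(1)] that x by (metis E1.M_smult(2))
      show "\<exists>n::nat. x [^] n \<otimes> z \<in> E"
        using E1.absorbing[OF x x0, of z] z by (auto simp: power_bounded_def)
    qed
  qed
  ultimately show ?thesis
    unfolding two_generated_closure_def using subring_E x' lin_eq_E[OF x'(1)] by blast
qed

text \<open>First \<open>a\<close> is a nonunit of \<open>E\<close> lying in \<open>S\<close>, so it
  is in \<open>M\<close>. Multiplying the relation by \<open>x\<close> then leaves only terms with a
  factor \<open>x x\<close> or \<open>a\<close>, so \<open>c (x y)\<close> lies in
  \<open>M\<close>.\<close>

lemma nonunits_E_mult_aux: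
  assumes loc: E_local and x: "x \<in> nonunits K E" and y: "y \<in> nonunits K E"
    and abc: "a \<in> S" "b \<in> S" "c \<in> S" and xy: "x \<otimes> y = a \<oplus> b \<otimes> x \<oplus> c \<otimes> y"
  shows "c \<in> M \<or> x \<otimes> y \<in> M" "a \<in> M"
proof -
  interpret E1: stable_subring K E by (rule stable_subring_E[OF loc])
  have xy': "x \<in> E" "x \<otimes> x \<in> M" "y \<in> E" "y \<otimes> y \<in> M" using x y nonunits_E[OF loc] by auto
  have cc: "x \<in> carrier K" "y \<in> carrier K" "a \<in> carrier K" "b \<in> carrier K" "c \<in> carrier K"
    using xy' abc by simp_all
  have "a = (a \<oplus> b \<otimes> x \<oplus> c \<otimes> y) \<ominus> b \<otimes> x \<ominus> c \<otimes> y"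
    by (rule ring_identity, (rule reify cc)+, code_simp)
  also have "\<dots> \<in> nonunits K E"
    unfolding xy[symmetric] using x y xy' abc by (intro E1.M_closed(3)) (simp_all add: S_E)
  finally have "a \<otimes> a \<in> M" using nonunits_E[OF loc] by simp
  then show a: "a \<in> M" using mult_notin_M[OF abc(1) _ abc(1)] by blast
  have "c \<otimes> (x \<otimes> y) = x \<otimes> (a \<oplus> b \<otimes> x \<oplus> c \<otimes> y) \<ominus> x \<otimes> a \<ominus> b \<otimes> (x \<otimes> x)"
    by (rule ring_identity, (rule reify cc)+, code_simp)
  also have "\<dots> = (x \<otimes> x) \<otimes> y \<ominus> x \<otimes> a \<ominus> b \<otimes> (x \<otimes> x)"
    unfolding xy[symmetric] by (rule ring_identity, (rule reify cc)+, code_simp)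
  also have "\<dots> \<in> M" using xy' a abc by simp
  finally have cxy: "c \<otimes> (x \<otimes> y) \<in> M" .
  show "c \<in> M \<or> x \<otimes> y \<in> M"
  proof (rule disjCI)
    assume "x \<otimes> y \<notin> M"
    show "c \<in> M"
    proof (rule ccontr)
      assume "c \<notin> M"
      then obtain v where v: "v \<in> S" "v \<in> carrier K" "c \<otimes> v = \<one>" using abc notin_M_unit by metis
      have "x \<otimes> y = (c \<otimes> v) \<otimes> (x \<otimes> y)" using v cc by simp
      also have "\<dots> = v \<otimes> (c \<otimes> (x \<otimes> y))"
        by (rule ring_identity, (rule reify cc v)+, code_simp)
      finally show False using \<open>x \<otimes> y \<notin> M\<close> cxy v M_smult by metis
    qed
  qed
qed

text \<open>Unless \<open>x y\<close> is in \<open>M\<close> already, all three coefficients of its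
  relation are in \<open>M\<close>, and then it is in \<open>M\<close> all the same.\<close>

lemma nonunits_E_mult:
  assumes loc: E_local and x: "x \<in> nonunits K E" and y: "y \<in> nonunits K E"
  shows "x \<otimes> y \<in> M"
proof -
  have xy: "x \<in> E" "y \<in> E" using x y nonunits_E[OF loc] by auto
  have cc: "x \<in> carrier K" "y \<in> carrier K" using xy by simp_all
  obtain a b c where abc: "a \<in> S" "b \<in> S" "c \<in> S" "a \<in> carrier K" "b \<in> carrier K" "c \<in> carrier K"
    "x \<otimes> y = a \<oplus> b \<otimes> x \<oplus> c \<otimes> y" using mult_eq[OF xy] .
  have yx: "y \<otimes> x = a \<oplus> c \<otimes> y \<oplus> b \<otimes> x"
  proof -
    have "y \<otimes> x = x \<otimes> y" using cc by (simp add: m_comm)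
    also have "\<dots> = a \<oplus> c \<otimes> y \<oplus> b \<otimes> x"
      unfolding abc(7) by (rule ring_identity, (rule reify cc abc)+, code_simp)
    finally show ?thesis .
  qed
  have "c \<in> M \<or> x \<otimes> y \<in> M" "a \<in> M" using nonunits_E_mult_aux[OF loc x y abc(1-3,7)] by auto
  moreover have "b \<in> M \<or> x \<otimes> y \<in> M"
    using nonunits_E_mult_aux(1)[OF loc y x abc(1) abc(3) abc(2) yx] cc by (simp add: m_comm)
  moreover have "x \<otimes> y \<in> M" if "a \<in> M" "b \<in> M" "c \<in> M" using abc(7) that xy by simp
  ultimately show ?thesis by blast
qed

text \<open>Let \<open>t1\<close> generate the nonunits \<open>N\<close> of \<open>E\<close> over
  their endomorphism ring \<open>E1\<close>, and let \<open>t = t1 e\<close>. Because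
  \<open>t1 N\<close> lies in \<open>M = t E\<close>, each member of \<open>N\<close> is
  \<open>e f\<close> with \<open>f\<close> in \<open>E\<close>. In \<open>t1 = e f\<close> the
  factor \<open>f\<close> is a nonunit of \<open>E\<close>, as otherwise \<open>e\<close> would
  generate \<open>N\<close> over \<open>E\<close>; so \<open>f = t1 g\<close>, whence
  \<open>e g = 1\<close> and \<open>t\<close> generates \<open>N\<close> as well as
  \<open>t1\<close> does.\<close>

lemma nonunits_E_generated:
  assumes loc: E_local and t: "t \<in> M" "\<And>m. m \<in> M \<Longrightarrow> \<exists>e\<in>E. m = t \<otimes> e"
    and nonprin: "\<And>x. x \<in> nonunits K E \<Longrightarrow> \<exists>y\<in>nonunits K E. \<forall>e\<in>E. y \<noteq> x \<otimes> e"
    and m: "m \<in> nonunits K E"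
  shows "\<exists>e\<in>endo_nonunits K E. m = t \<otimes> e"
proof -
  interpret E1: stable_subring K E by (rule stable_subring_E[OF loc])
  obtain t1 where t1: "t1 \<in> nonunits K E" "\<And>m. m \<in> nonunits K E \<Longrightarrow> \<exists>e\<in>E1.E. m = t1 \<otimes> e"
    using E1.M_principal_always unfolding E1.M_principal_def by blast
  have t10: "t1 \<noteq> \<zero>" "t1 \<in> carrier K"
  proof -
    obtain m where "m \<in> nonunits K E" "m \<noteq> \<zero>" "m \<in> carrier K" by (rule E1.nonzero_nonunit)
    then show "t1 \<noteq> \<zero>" using t1(2) by fastforce
    show "t1 \<in> carrier K" using t1(1) by simp
  qed
  obtain e where e: "e \<in> E1.E" "t = t1 \<otimes> e" using t1(2) M_subset_nonunits_E[OF loc t(1)] by blast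
  have ec: "e \<in> carrier K" using e by simp
  have div_e: "\<exists>f\<in>E. y = e \<otimes> f" if y: "y \<in> nonunits K E" for y
  proof -
    have yc: "y \<in> carrier K" using y by simp
    have "t1 \<otimes> y \<in> M" using nonunits_E_mult[OF loc t1(1) y] .
    then obtain f where f: "f \<in> E" "t1 \<otimes> y = t \<otimes> f" using t(2) by blast
    have "t1 \<otimes> y = t1 \<otimes> (e \<otimes> f)" using f e ec t10 by (simp add: m_assoc)
    then have "y = e \<otimes> f" using m_lcancel[OF t10] yc ec f by simp
    then show ?thesis using f by blast
  qed
  obtain f where f: "f \<in> E" "t1 = e \<otimes> f" using div_e[OF t1(1)] by blast
  have fc: "f \<in> carrier K" using f by simp
  have "f \<in> nonunits K E"
  proof (rule ccontr)
    assume "f \<notin> nonunits K E"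
    then obtain v where v: "v \<in> E" "v \<in> carrier K" "f \<otimes> v = \<one>" using f E1.notin_M_unit by metis
    have "e = t1 \<otimes> v" unfolding f(2) using v fc ec by (simp add: m_assoc)
    then have "e \<in> nonunits K E" using t1 v by simp
    then show False using nonprin div_e by blast
  qed
  then obtain g where g: "g \<in> E1.E" "f = t1 \<otimes> g" using t1(2) by blast
  have gc: "g \<in> carrier K" using g by simp
  have "t1 \<otimes> (e \<otimes> g) = e \<otimes> (t1 \<otimes> g)"
    by (rule ring_identity, (rule reify t10 ec gc)+, code_simp)
  also have "\<dots> = t1 \<otimes> \<one>"
    by (simp only: g(2)[symmetric] f(2)[symmetric] r_one[OF t10(2)])
  finally have eg: "e \<otimes> g = \<one>" using m_lcancel[OF t10] ec gc by simp
  obtain w where w: "w \<in> E1.E" "m = t1 \<otimes> w" using t1(2)[OF m] by blast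
  have wc: "w \<in> carrier K" using w by simp
  have "t \<otimes> (g \<otimes> w) = t1 \<otimes> (e \<otimes> g) \<otimes> w"
    unfolding e(2) by (rule ring_identity, (rule reify t10 ec gc wc)+, code_simp)
  then have "m = t \<otimes> (g \<otimes> w)" using eg w t10 by simp
  then show ?thesis using g w E1.E_closed(4) by blast
qed

text \<open>From \<open>E = S + t E1\<close> one gets \<open>W = S + S x + t W\<close>, because
  \<open>E1\<close> lies in \<open>W\<close>; and \<open>t W = t E + t E x\<close> lies in
  \<open>M + M x\<close>. Hence the same \<open>x\<close> works over \<open>S\<close>.\<close>

lemma two_generated_descend:
  assumes loc: E_local and t: "t \<in> M" and gen: "\<And>m. m \<in> nonunits K E \<Longrightarrow> \<exists>e\<in>endo_nonunits K E. m = t \<otimes> e"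
    and D: "two_generated_closure K N E"
  shows "two_generated_closure K N S"
proof -
  interpret E1: stable_subring K E by (rule stable_subring_E[OF loc])
  obtain W x where W: "subring W K" "x \<in> W" "W = E1.lin x" "E1.E \<subseteq> W" "N \<subseteq> W"
    using D unfolding two_generated_closure_def by blast
  have Wc: "w \<in> carrier K" if "w \<in> W" for w using subringE(1)[OF W(1)] that by blast
  have xc: "x \<in> carrier K" and tc: "t \<in> carrier K" using Wc W(2) t by auto
  have EW: "E \<subseteq> W" using W(4) E1.S_E by blast
  have tW: "\<exists>a\<in>M. \<exists>b\<in>M. t \<otimes> w = a \<oplus> b \<otimes> x" if w: "w \<in> W" for w
  proof -
    obtain a b where ab: "a \<in> E" "b \<in> E" "a \<in> carrier K" "b \<in> carrier K" "w = a \<oplus> b \<otimes> x"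
      by (rule E1.linE[OF w[unfolded W(3)]])
    have "t \<otimes> w = t \<otimes> a \<oplus> (t \<otimes> b) \<otimes> x"
      unfolding ab(5) by (rule ring_identity, (rule reify ab xc tc)+, code_simp)
    then show ?thesis using ab t by (metis E_M(2))
  qed
  have "W = lin x"
  proof
    show "lin x \<subseteq> W"
    proof
      fix y assume "y \<in> lin x"
      then obtain a b where ab: "a \<in> S" "b \<in> S" "y = a \<oplus> b \<otimes> x" by (metis linE)
      then have "a \<in> W" "b \<in> W" using EW S_E by blast+
      then show "y \<in> W" unfolding ab(3) by (intro subringE(6,7)[OF W(1)] W(2))
    qed
    show "W \<subseteq> lin x"
    proof
      fix y assume y: "y \<in> W"
      obtain a b where ab: "a \<in> E" "b \<in> E" "a \<in> carrier K" "b \<in> carrier K" "y = a \<oplus> b \<otimes> x"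
        by (rule E1.linE[OF y[unfolded W(3)]])
      obtain c m where c: "c \<in> S" "c \<in> carrier K" "m \<in> nonunits K E" "m \<in> carrier K" "a = c \<oplus> m"
        using E_decomp[OF loc ab(1)] by metis
      obtain d n where d: "d \<in> S" "d \<in> carrier K" "n \<in> nonunits K E" "n \<in> carrier K" "b = d \<oplus> n"
        using E_decomp[OF loc ab(2)] by metis
      obtain e where e: "e \<in> E1.E" "m = t \<otimes> e" using gen[OF c(3)] by blast
      obtain f where f: "f \<in> E1.E" "n = t \<otimes> f" using gen[OF d(3)] by blast
      have ef: "e \<in> W" "f \<in> W" "e \<in> carrier K" "f \<in> carrier K" using e f W(4) Wc by auto
      have "e \<oplus> f \<otimes> x \<in> W" by (intro subringE(6,7)[OF W(1)] W(2) ef)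
      then obtain p q where pq: "p \<in> M" "q \<in> M" "t \<otimes> (e \<oplus> f \<otimes> x) = p \<oplus> q \<otimes> x" using tW by blast
      have pqc: "p \<in> carrier K" "q \<in> carrier K" using pq by simp_all
      have "y = c \<oplus> d \<otimes> x \<oplus> t \<otimes> (e \<oplus> f \<otimes> x)"
        unfolding ab(5) c(5) d(5) e(2) f(2)
        by (rule ring_identity, (rule reify c d ef xc tc)+, code_simp)
      also have "\<dots> = (c \<oplus> p) \<oplus> (d \<oplus> q) \<otimes> x"
        unfolding pq(3) by (rule ring_identity, (rule reify c d pqc xc)+, code_simp)
      finally show "y \<in> lin x"
        by (rule linI[OF S_closed(4)[OF c(1) M_S[OF pq(1)]] S_closed(4)[OF d(1) M_S[OF pq(2)]]])
    qed
  qed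
  then show ?thesis unfolding two_generated_closure_def using W EW by blast
qed

end

section \<open>The chain of endomorphism rings\<close>

text \<open>\<open>A\<close> is the base ring and stays fixed along the chain, as does
  \<open>t\<close>; only \<open>S\<close> moves.\<close>

locale bad_subring = stable_subring +
  fixes A t
  assumes A_S: "A \<subseteq> S"
    and bad: "\<not> two_generated_closure K (power_bounded K A) S"
    and t_M: "t \<in> nonunits K S"
    and t_gen: "m \<in> nonunits K S \<Longrightarrow> \<exists>e\<in>endo_nonunits K S. m = t \<otimes> e"
begin

lemma local_E: E_local
  using reduced_or_local two_generated_reduced[OF A_S] bad by blast

lemma nonprincipal_E: "x \<in> nonunits K E \<Longrightarrow> \<exists>y\<in>nonunits K E. \<forall>e\<in>E. y \<noteq> x \<otimes> e"
  using two_generated_principal[OF A_S local_E] bad by blast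

lemma bad_subring_E: "bad_subring K E A t"
proof (intro bad_subring.intro bad_subring_axioms.intro)
  show "stable_subring K E" by (rule stable_subring_E[OF local_E])
  show "A \<subseteq> E" using A_S S_E by blast
  show gen: "\<exists>e\<in>endo_nonunits K E. m = t \<otimes> e" if "m \<in> nonunits K E" for m
    using nonunits_E_generated[OF local_E t_M t_gen nonprincipal_E that] by blast
  show "\<not> two_generated_closure K (power_bounded K A) E"
    using two_generated_descend[OF local_E t_M gen] bad by blast
  show "t \<in> nonunits K E" by (rule M_subset_nonunits_E[OF local_E t_M])
qed

text \<open>If \<open>M = t S\<close>, then \<open>t E\<close> lies in \<open>t S\<close>, so
  \<open>E = S\<close> and the nonunits of \<open>E\<close> would be principal over
  \<open>E\<close>.\<close>

lemma M_not_generated: "\<exists>m\<in>M. \<forall>s\<in>S. m \<noteq> t \<otimes> s"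
proof (rule ccontr)
  assume "\<not> ?thesis"
  then have all: "\<And>m. m \<in> M \<Longrightarrow> \<exists>s\<in>S. m = t \<otimes> s" by blast
  have t0: "t \<noteq> \<zero>" "t \<in> carrier K"
  proof -
    obtain m where "m \<in> M" "m \<noteq> \<zero>" "m \<in> carrier K" by (rule nonzero_nonunit)
    then show "t \<noteq> \<zero>" using all[of m] by auto
    show "t \<in> carrier K" using t_M by simp
  qed
  have ES: "E \<subseteq> S"
  proof
    fix e assume e: "e \<in> E"
    obtain s where s: "s \<in> S" "t \<otimes> e = t \<otimes> s" using all[of "t \<otimes> e"] e t_M by auto
    then have "e = s" using m_lcancel[OF t0] e by simp
    then show "e \<in> S" using s by simp
  qed
  then have "E = S" using S_E by blast
  then show False using nonprincipal_E[of t] all t_M by (metis (no_types))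
qed

end

fun endo_chain :: "('a, 'm) ring_scheme \<Rightarrow> 'a set \<Rightarrow> nat \<Rightarrow> 'a set"
  where "endo_chain K S 0 = S"
  | "endo_chain K S (Suc n) = endo_nonunits K (endo_chain K S n)"

context bad_subring
begin

abbreviation C :: "nat \<Rightarrow> 'a set" where "C \<equiv> endo_chain K S"

lemma bad_subring_C: "bad_subring K (C n) A t"
proof (induction n)
  case 0
  then show ?case using bad_subring_axioms by simp
next
  case (Suc n)
  then show ?case using bad_subring.bad_subring_E by simp
qed

lemma stable_subring_C: "stable_subring K (C n)"
  by (rule bad_subring.axioms(1)[OF bad_subring_C])

lemma C_carr: "x \<in> C n \<Longrightarrow> x \<in> carrier K"
  using stable_subring.S_carr[OF stable_subring_C] .

lemma C_mono_Suc: "x \<in> C n \<Longrightarrow> x \<in> C (Suc n)"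
  using stable_subring.S_E[OF stable_subring_C] by simp

lemma C_mono: "m \<le> n \<Longrightarrow> C m \<subseteq> C n"
  by (rule lift_Suc_mono_le[of C]) (use C_mono_Suc in blast)

lemma t_carr: "t \<in> carrier K" using t_M by simp

lemma t_nonunit_C: "t \<in> nonunits K (C n)"
  using bad_subring.t_M[OF bad_subring_C] .

lemma nonunits_C: "nonunits K (C n) = {t \<otimes> w | w. w \<in> C (Suc n)}"
proof (intro equalityI subsetI)
  show "m \<in> {t \<otimes> w | w. w \<in> C (Suc n)}" if "m \<in> nonunits K (C n)" for m
    using bad_subring.t_gen[OF bad_subring_C that] by auto
  show "m \<in> nonunits K (C n)" if "m \<in> {t \<otimes> w | w. w \<in> C (Suc n)}" for m
    using that stable_subring.E_M(2)[OF stable_subring_C] t_nonunit_C by auto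
qed

lemma t_zero: "t \<noteq> \<zero>"
proof
  assume "t = \<zero>"
  obtain m where m: "m \<in> M" "m \<noteq> \<zero>" "m \<in> carrier K" by (rule nonzero_nonunit)
  then show False using t_gen[OF m(1)] \<open>t = \<zero>\<close> by auto
qed

text \<open>No residue field is enlarged along the chain: an element of \<open>C (Suc n)\<close> is
  one of \<open>C n\<close> plus a nonunit \<open>t w\<close>, and the recursion collects the
  remainders into one multiple of \<open>t\<close>.\<close>

lemma C_decomp: "x \<in> C n \<Longrightarrow> \<exists>c\<in>S. \<exists>w\<in>C (Suc n). x = c \<oplus> t \<otimes> w"
proof (induction n arbitrary: x)
  case 0
  then show ?case using C_mono_Suc[of \<zero> 0] t_carr by (intro bexI[of _ x] bexI[of _ \<zero>]) auto
next
  case (Suc n)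
  interpret Cn: bad_subring K "C n" A t by (rule bad_subring_C)
  obtain c m where c: "c \<in> C n" "m \<in> nonunits K (C (Suc n))" "x = c \<oplus> m"
    using Cn.E_decomp[OF Cn.local_E, of x] Suc.prems by (metis endo_chain.simps(2))
  obtain w where w: "w \<in> C (Suc (Suc n))" "m = t \<otimes> w" using c(2) nonunits_C by blast
  obtain c' w' where c': "c' \<in> S" "w' \<in> C (Suc n)" "c = c' \<oplus> t \<otimes> w'" using Suc.IH[OF c(1)] by blast
  have w'2: "w' \<in> C (Suc (Suc n))" using c'(2) C_mono_Suc by blast
  have sum: "w \<oplus> w' \<in> C (Suc (Suc n))"
    using stable_subring.S_closed(4)[OF stable_subring_C w(1) w'2] .
  have cc: "c' \<in> carrier K" "w \<in> carrier K" "w' \<in> carrier K"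
    using c'(1) C_carr[OF w(1)] C_carr[OF w'2] by simp_all
  note tc = t_carr
  have "x = c' \<oplus> t \<otimes> (w \<oplus> w')"
    unfolding c(3) c'(3) w(2) by (rule ring_identity, (rule reify cc tc)+, code_simp)
  then show ?case using c'(1) sum by blast
qed

lemma t_power_C: "w \<in> C n \<Longrightarrow> t [^] n \<otimes> w \<in> S"
proof (induction n arbitrary: w)
  case 0
  then show ?case by simp
next
  case (Suc n)
  have "t \<otimes> w \<in> C n"
    using Suc.prems nonunits_C stable_subring.M_S[OF stable_subring_C] by blast
  then have "t [^] n \<otimes> (t \<otimes> w) \<in> S" by (rule Suc.IH)
  then show ?case using C_carr[OF Suc.prems] t_carr by (simp add: m_assoc)
qed

definition I :: "nat \<Rightarrow> 'a set"
  where "I n = {t [^] n \<otimes> w | w. w \<in> C n}"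

lemma I_0: "I 0 = S"
  unfolding I_def by force

lemma I_1: "I (Suc 0) = M"
  unfolding I_def using nonunits_C[of 0] t_carr by simp

lemma I_add:
  assumes "x \<in> I n" "y \<in> I n"
  shows "x \<oplus> y \<in> I n"
proof -
  obtain w where w: "w \<in> C n" "x = t [^] n \<otimes> w" using assms unfolding I_def by blast
  obtain v where v: "v \<in> C n" "y = t [^] n \<otimes> v" using assms unfolding I_def by blast
  have "x \<oplus> y = t [^] n \<otimes> (w \<oplus> v)"
    unfolding w(2) v(2) using C_carr w(1) v(1) t_carr by (simp add: r_distr)
  moreover have "w \<oplus> v \<in> C n" using stable_subring.S_closed(4)[OF stable_subring_C w(1) v(1)] .
  ultimately show ?thesis unfolding I_def by blast
qed

lemma I_smult:
  assumes "s \<in> S" "x \<in> I n"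
  shows "s \<otimes> x \<in> I n"
proof -
  obtain w where w: "w \<in> C n" "x = t [^] n \<otimes> w" using assms unfolding I_def by blast
  have s: "s \<in> C n" using C_mono[of 0 n] assms by auto
  have "s \<otimes> x = t [^] n \<otimes> (s \<otimes> w)"
    unfolding w(2) using C_carr[OF s] C_carr[OF w(1)] t_carr by (simp add: m_lcomm)
  moreover have "s \<otimes> w \<in> C n" using stable_subring.S_closed(6)[OF stable_subring_C s w(1)] .
  ultimately show ?thesis unfolding I_def by blast
qed

lemma I_Suc: "I (Suc n) \<subseteq> I n"
proof
  fix x assume "x \<in> I (Suc n)"
  then obtain w where w: "w \<in> C (Suc n)" "x = t [^] Suc n \<otimes> w" unfolding I_def by blast
  have "t \<otimes> w \<in> C n"
    using w nonunits_C stable_subring.M_S[OF stable_subring_C] by blast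
  moreover have "x = t [^] n \<otimes> (t \<otimes> w)" using w(2) C_carr[OF w(1)] t_carr by (simp add: m_assoc)
  ultimately show "x \<in> I n" unfolding I_def by blast
qed

lemma t_power_I: "t [^] n \<in> I n"
proof -
  have "\<one> \<in> C n" using stable_subring.S_closed(1)[OF stable_subring_C] .
  then show ?thesis unfolding I_def using t_carr by force
qed

text \<open>Cancelling \<open>t^n\<close> would turn a nonunit \<open>t w\<close> of
  \<open>C n\<close> into \<open>1\<close>.\<close>

lemma t_power_not_I: "t [^] n \<notin> I (Suc n)"
proof
  assume "t [^] n \<in> I (Suc n)"
  then obtain w where w: "w \<in> C (Suc n)" "t [^] n = t [^] Suc n \<otimes> w" unfolding I_def by blast
  have wc: "w \<in> carrier K" using w C_carr by blast
  have "t [^] n \<otimes> (t \<otimes> w) = t [^] n \<otimes> \<one>" using w(2) wc t_carr by (simp add: m_assoc)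
  moreover have "t [^] n \<noteq> \<zero>" using t_zero t_carr
    by (induction n) (auto simp: integral_iff)
  ultimately have "t \<otimes> w = \<one>"
    using m_lcancel[of "t [^] n" "t \<otimes> w" \<one>] wc t_carr by simp
  moreover have "t \<otimes> w \<in> nonunits K (C n)" using w nonunits_C by blast
  ultimately show False using stable_subring.one_notin_M[OF stable_subring_C] by simp
qed

text \<open>The product is \<open>t^n\<close> times an element of \<open>t^n C n\<close>, and
  \<open>t_power_C\<close> places the latter in \<open>S\<close>.\<close>

lemma I_mult:
  assumes "x \<in> I n" "y \<in> I n"
  shows "\<exists>s\<in>S. x \<otimes> y = t [^] n \<otimes> s"
proof -
  obtain w where w: "w \<in> C n" "x = t [^] n \<otimes> w" using assms unfolding I_def by blast
  obtain v where v: "v \<in> C n" "y = t [^] n \<otimes> v" using assms unfolding I_def by blast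
  have c: "w \<in> carrier K" "v \<in> carrier K" using w v C_carr by auto
  have "x \<otimes> y = t [^] n \<otimes> (t [^] n \<otimes> (w \<otimes> v))"
    unfolding w(2) v(2) using c t_carr by (simp add: m_ac)
  moreover have "t [^] n \<otimes> (w \<otimes> v) \<in> S"
    using t_power_C stable_subring.S_closed(6)[OF stable_subring_C w(1) v(1)] by blast
  ultimately show ?thesis by blast
qed

lemma I_t:
  assumes "x \<in> I n"
  shows "t \<otimes> x \<in> I (Suc n)"
proof -
  obtain w where w: "w \<in> C n" "x = t [^] n \<otimes> w" using assms unfolding I_def by blast
  have "t \<otimes> x = t [^] Suc n \<otimes> w" unfolding w(2) using C_carr[OF w(1)] t_carr by (simp add: m_ac)
  then show ?thesis unfolding I_def using C_mono_Suc[OF w(1)] by blast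
qed

lemma I_step:
  assumes "x \<in> I n"
  shows "\<exists>c\<in>S. x \<ominus> t [^] n \<otimes> c \<in> I (Suc n)"
proof -
  obtain w where w: "w \<in> C n" "x = t [^] n \<otimes> w" using assms unfolding I_def by blast
  obtain c v where c: "c \<in> S" "v \<in> C (Suc n)" "w = c \<oplus> t \<otimes> v" using C_decomp[OF w(1)] by blast
  have cc: "c \<in> carrier K" "v \<in> carrier K" using c(1) C_carr[OF c(2)] by simp_all
  define p where "p = t [^] n"
  have pc: "p \<in> carrier K" using t_carr by (simp add: p_def)
  note tc = t_carr
  have "x \<ominus> p \<otimes> c = (p \<otimes> t) \<otimes> v"
    unfolding w(2) c(3) p_def[symmetric]
    by (rule ring_identity, (rule reify cc tc pc)+, code_simp)
  then have "x \<ominus> t [^] n \<otimes> c = t [^] Suc n \<otimes> v" by (simp add: p_def)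
  then show ?thesis unfolding I_def using c by blast
qed

end

section \<open>Stable ideals\<close>

context "domain"
begin

abbreviation (input) Endo where "Endo I \<equiv> endo_ring R (ideal_module R I)"
abbreviation (input) EndoMod where "EndoMod I \<equiv> endo_module (ideal_module R I)"

lemma Endo_carrier_iff:
  "\<phi> \<in> carrier (Endo I) \<longleftrightarrow> \<phi> \<in> extensional I \<and> (\<forall>x\<in>I. \<phi> x \<in> I) \<and>
    (\<forall>x\<in>I. \<forall>y\<in>I. \<phi> (x \<oplus> y) = \<phi> x \<oplus> \<phi> y) \<and> (\<forall>a\<in>carrier R. \<forall>x\<in>I. \<phi> (a \<otimes> x) = a \<otimes> \<phi> x)"
  by (auto simp: endo_ring_def module_homs_def ideal_module_def)

lemma Endo_ops:
  "mult (Endo I) = compose I" "one (Endo I) = (\<lambda>x\<in>I. x)" "zero (Endo I) = (\<lambda>x\<in>I. \<zero>)"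
  "(\<oplus>\<^bsub>Endo I\<^esub>) = (\<lambda>f g. \<lambda>x\<in>I. f x \<oplus> g x)"
  by (simp_all add: endo_ring_def ideal_module_def)

lemma EndoMod_ops:
  "carrier (EndoMod I) = I" "(\<oplus>\<^bsub>EndoMod I\<^esub>) = (\<oplus>)" "smult (EndoMod I) = (\<lambda>f x. f x)"
  by (simp_all add: endo_module_def ideal_module_def)

lemma free_module_ops:
  "carrier (free_module E J) = {f \<in> J \<rightarrow>\<^sub>E carrier E. finite {x \<in> J. f x \<noteq> \<zero>\<^bsub>E\<^esub>}}"
  "(\<oplus>\<^bsub>free_module E J\<^esub>) = (\<lambda>f g. \<lambda>x\<in>J. f x \<oplus>\<^bsub>E\<^esub> g x)"
  "smult (free_module E J) = (\<lambda>a f. \<lambda>x\<in>J. a \<otimes>\<^bsub>E\<^esub> f x)"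
  by (simp_all add: free_module_def)

lemma EndoI:
  assumes "\<And>x. x \<in> I \<Longrightarrow> \<phi> x \<in> I" "\<And>x y. \<lbrakk>x \<in> I; y \<in> I\<rbrakk> \<Longrightarrow> \<phi> (x \<oplus> y) = \<phi> x \<oplus> \<phi> y"
    "\<And>a x. \<lbrakk>a \<in> carrier R; x \<in> I\<rbrakk> \<Longrightarrow> \<phi> (a \<otimes> x) = a \<otimes> \<phi> x" "\<phi> \<in> extensional I"
  shows "\<phi> \<in> carrier (Endo I)"
  using assms by (simp add: Endo_carrier_iff)

lemma EndoD:
  assumes "\<phi> \<in> carrier (Endo I)"
  shows "x \<in> I \<Longrightarrow> \<phi> x \<in> I" "\<lbrakk>x \<in> I; y \<in> I\<rbrakk> \<Longrightarrow> \<phi> (x \<oplus> y) = \<phi> x \<oplus> \<phi> y"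
    "\<lbrakk>a \<in> carrier R; x \<in> I\<rbrakk> \<Longrightarrow> \<phi> (a \<otimes> x) = a \<otimes> \<phi> x" "\<phi> \<in> extensional I"
  using assms by (simp_all add: Endo_carrier_iff)

text \<open>The map \<open>y \<mapsto> (z \<mapsto> y z / x)\<close> embeds \<open>I\<close> into
  its endomorphism ring, linearly over that ring, and evaluation at \<open>x\<close> retracts it; so
  \<open>I\<close> is a summand of a free module of rank one.\<close>

lemma stable_idealI:
  assumes I: "ideal I R" and x: "x \<in> I" "x \<noteq> \<zero>"
    and sq: "\<And>y z. \<lbrakk>y \<in> I; z \<in> I\<rbrakk> \<Longrightarrow> \<exists>w\<in>I. y \<otimes> z = x \<otimes> w"
  shows "stable_ideal R I"
proof -
  interpret I: ideal I R by fact
  note Ic = I.Icarr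
  have xc: "x \<in> carrier R" using x Ic by blast
  have canc: "u = v" if "x \<otimes> u = x \<otimes> v" "u \<in> I" "v \<in> I" for u v
    using that m_lcancel[OF x(2) xc] Ic by blast
  define \<phi> where "\<phi> y = (\<lambda>z\<in>I. SOME w. w \<in> I \<and> y \<otimes> z = x \<otimes> w)" for y
  have \<phi>: "\<phi> y z \<in> I" "y \<otimes> z = x \<otimes> \<phi> y z" if "y \<in> I" "z \<in> I" for y z
  proof -
    have "\<exists>w. w \<in> I \<and> y \<otimes> z = x \<otimes> w" using sq[OF that] by blast
    from someI_ex[OF this] show "\<phi> y z \<in> I" "y \<otimes> z = x \<otimes> \<phi> y z" using that by (auto simp: \<phi>_def)
  qed
  have ext: "\<phi> y \<in> extensional I" for y by (simp add: \<phi>_def)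
  have \<phi>_eq: "\<phi> y z = w" if "y \<in> I" "z \<in> I" "w \<in> I" "y \<otimes> z = x \<otimes> w" for y z w
    using canc[of "\<phi> y z" w] \<phi>[OF that(1,2)] that by simp
  have \<phi>_Endo: "\<phi> y \<in> carrier (Endo I)" if y: "y \<in> I" for y
  proof (rule EndoI)
    show "\<phi> y z \<in> I" if "z \<in> I" for z using \<phi> y that by blast
    show "\<phi> y (u \<oplus> v) = \<phi> y u \<oplus> \<phi> y v" if "u \<in> I" "v \<in> I" for u v
      using \<phi>[OF y that(1)] \<phi>[OF y that(2)] that y Ic xc
      by (intro \<phi>_eq) (simp_all add: r_distr)
    show "\<phi> y (a \<otimes> u) = a \<otimes> \<phi> y u" if a: "a \<in> carrier R" and u: "u \<in> I" for a u
    proof (rule \<phi>_eq[OF y])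
      show "a \<otimes> u \<in> I" "a \<otimes> \<phi> y u \<in> I" using I.I_l_closed a u \<phi>(1)[OF y u] by auto
      have "y \<otimes> (a \<otimes> u) = a \<otimes> (y \<otimes> u)" using Ic[OF y] Ic[OF u] a by (simp add: m_lcomm)
      also have "\<dots> = x \<otimes> (a \<otimes> \<phi> y u)"
        unfolding \<phi>(2)[OF y u] using Ic[OF \<phi>(1)[OF y u]] xc a by (simp add: m_lcomm)
      finally show "y \<otimes> (a \<otimes> u) = x \<otimes> (a \<otimes> \<phi> y u)" .
    qed
  qed (rule ext)
  have \<phi>_add: "\<phi> (y \<oplus> z) = (\<lambda>u\<in>I. \<phi> y u \<oplus> \<phi> z u)" if "y \<in> I" "z \<in> I" for y z
  proof (rule extensionalityI[OF ext restrict_extensional])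
    fix u assume u: "u \<in> I"
    have "\<phi> (y \<oplus> z) u = \<phi> y u \<oplus> \<phi> z u"
      using \<phi>[OF that(1) u] \<phi>[OF that(2) u] that u Ic xc
      by (intro \<phi>_eq) (simp_all add: l_distr r_distr)
    then show "\<phi> (y \<oplus> z) u = (\<lambda>u\<in>I. \<phi> y u \<oplus> \<phi> z u) u" using u by simp
  qed
  have \<phi>_smult: "\<phi> (e y) = compose I e (\<phi> y)" if e: "e \<in> carrier (Endo I)" and y: "y \<in> I" for e y
  proof (rule extensionalityI[OF ext compose_extensional])
    fix u assume u: "u \<in> I"
    have ey: "e y \<in> I" "e (\<phi> y u) \<in> I" using EndoD(1)[OF e] y \<phi>(1)[OF y u] by auto
    have "e y \<otimes> u = u \<otimes> e y" using Ic[OF ey(1)] Ic[OF u] by (rule m_comm)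
    also have "\<dots> = e (u \<otimes> y)" using EndoD(3)[OF e Ic[OF u] y] by simp
    also have "u \<otimes> y = x \<otimes> \<phi> y u" using \<phi>(2)[OF y u] Ic[OF u] Ic[OF y] by (simp add: m_comm)
    also have "e (x \<otimes> \<phi> y u) = x \<otimes> e (\<phi> y u)" using EndoD(3)[OF e xc \<phi>(1)[OF y u]] .
    finally have "\<phi> (e y) u = e (\<phi> y u)" using ey u by (intro \<phi>_eq)
    then show "\<phi> (e y) u = compose I e (\<phi> y) u" using u by (simp add: compose_def)
  qed
  define i where "i = (\<lambda>y. \<lambda>k\<in>{x}. \<phi> y)"
  \<comment> \<open>The first \<open>x\<close> is the only index of the basis, the second one the
    point of evaluation.\<close>
  define p where "p = (\<lambda>f::'a \<Rightarrow> 'a \<Rightarrow> 'a. f x x)"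
  have "i \<in> module_homs (Endo I) (EndoMod I) (free_module (Endo I) {x})"
    unfolding module_homs_def
    using \<phi>_Endo EndoD(1)
    by (auto simp: EndoMod_ops free_module_ops Endo_ops i_def \<phi>_add \<phi>_smult fun_eq_iff restrict_def)
  moreover have "p \<in> module_homs (Endo I) (free_module (Endo I) {x}) (EndoMod I)"
    unfolding module_homs_def
    using EndoD(1) x by (auto simp: EndoMod_ops free_module_ops Endo_ops p_def compose_def)
  moreover have "p (i y) = y" if "y \<in> I" for y
    unfolding p_def i_def using that x Ic xc by (auto intro!: \<phi>_eq simp: m_comm)
  ultimately show ?thesis
    unfolding stable_ideal_def projective_module_def using I by (auto simp: EndoMod_ops)
qed

text \<open>A dual basis argument with denominators cleared: \<open>x0 = p (i x0)\<close> is a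
  finite sum of elements \<open>g = e x\<close>, with \<open>e\<close> a coordinate of
  \<open>i x0\<close> and \<open>x\<close> the image of a basis element. The condition in
  \<open>G\<close> says that \<open>g / (x0 x)\<close> carries products of two elements of
  \<open>I\<close> into \<open>I\<close>, so the fractions \<open>g / x0\<close> are products of an
  element of the dual with one of \<open>I\<close>, and they add up to \<open>1\<close>.\<close>

lemma stable_ideal_dual:
  assumes st: "stable_ideal R I" and x0: "x0 \<in> I"
    and H: "sum_closed R H"
    and G: "\<And>g x. \<lbrakk>g \<in> I; x \<in> I; x \<noteq> \<zero>; \<And>y z. \<lbrakk>y \<in> I; z \<in> I\<rbrakk> \<Longrightarrow> \<exists>w\<in>I. g \<otimes> (y \<otimes> z) = x0 \<otimes> (x \<otimes> w)\<rbrakk>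
      \<Longrightarrow> g \<in> H"
  shows "x0 \<in> H"
proof -
  have I: "ideal I R" using st by (simp add: stable_ideal_def)
  interpret I: ideal I R by fact
  note Ic = I.Icarr
  obtain J :: "'a set" and i p where
    i: "i \<in> module_homs (Endo I) (EndoMod I) (free_module (Endo I) J)"
    and p: "p \<in> module_homs (Endo I) (free_module (Endo I) J) (EndoMod I)"
    and pi: "\<And>x. x \<in> I \<Longrightarrow> p (i x) = x"
    using st unfolding stable_ideal_def projective_module_def by (auto simp: EndoMod_ops)
  let ?Fr = "carrier (free_module (Endo I) J)"
  have i_Fr: "i y \<in> ?Fr" if "y \<in> I" for y
    using i that unfolding module_homs_def by (auto simp: EndoMod_ops)
  have i_smult: "i (e y) = (\<lambda>j\<in>J. compose I e (i y j))" if "e \<in> carrier (Endo I)" "y \<in> I" for e y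
    using i that unfolding module_homs_def by (simp add: EndoMod_ops free_module_ops Endo_ops)
  have p_I: "p f \<in> I" if "f \<in> ?Fr" for f
    using p that unfolding module_homs_def by (auto simp: EndoMod_ops)
  have p_add: "p (\<lambda>j\<in>J. \<lambda>x\<in>I. f j x \<oplus> g j x) = p f \<oplus> p g" if "f \<in> ?Fr" "g \<in> ?Fr" for f g
    using p that unfolding module_homs_def by (simp add: EndoMod_ops free_module_ops Endo_ops)
  have p_smult: "p (\<lambda>j\<in>J. compose I e (f j)) = e (p f)" if "e \<in> carrier (Endo I)" "f \<in> ?Fr" for e f
    using p that unfolding module_homs_def by (simp add: EndoMod_ops free_module_ops Endo_ops)
  define zE where "zE = (\<lambda>x\<in>I. \<zero>)"
  define oE where "oE = (\<lambda>x\<in>I. x)"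
  have zE: "zE \<in> carrier (Endo I)" unfolding zE_def by (rule EndoI) (auto simp: I.I_l_closed)
  have oE: "oE \<in> carrier (Endo I)" unfolding oE_def by (rule EndoI) (auto simp: I.I_l_closed)
  have Fr_iff: "f \<in> ?Fr \<longleftrightarrow> f \<in> extensional J \<and> (\<forall>j\<in>J. f j \<in> carrier (Endo I)) \<and> finite {j \<in> J. f j \<noteq> zE}" for f
    by (auto simp: free_module_ops Endo_ops zE_def PiE_iff)
  have hom0: "e \<zero> = \<zero>" if "e \<in> carrier (Endo I)" for e
    using EndoD(3)[OF that zero_closed I.zero_closed] EndoD(1)[OF that I.zero_closed] Ic by simp
  define b where "b k = (\<lambda>j\<in>J. if j = k then oE else zE)" for k
  have bFr: "b k \<in> ?Fr" for k
  proof -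
    have "{j \<in> J. b k j \<noteq> zE} \<subseteq> {k}" unfolding b_def by auto
    then have "finite {j \<in> J. b k j \<noteq> zE}" by (rule finite_subset) simp
    then show ?thesis unfolding Fr_iff using zE oE by (auto simp: b_def)
  qed
  \<comment> \<open>Induction over a finite set containing the support of \<open>f\<close>; in the
    step the coordinate \<open>k\<close> is split off as a multiple of the basis element
    \<open>b k\<close>.\<close>
  have main: "p f \<in> H" if "finite A" "f \<in> ?Fr" "{j \<in> J. f j \<noteq> zE} \<subseteq> A"
    "\<And>j. j \<in> J \<Longrightarrow> f j (p (b j)) \<in> H" for A f
    using that
  proof (induction A arbitrary: f rule: finite_induct)
    case empty
    have z: "f j = zE" if "j \<in> J" for j using empty that by blast
    \<comment> \<open>A family with empty support is \<open>zE\<close> times itself, so linearity of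
      \<open>p\<close> gives the value zero.\<close>
    have "f = (\<lambda>j\<in>J. compose I zE (f j))"
    proof (rule extensionalityI[of _ J])
      show "f \<in> extensional J" using empty(1) Fr_iff by blast
      show "(\<lambda>j\<in>J. compose I zE (f j)) \<in> extensional J" by simp
      show "f j = (\<lambda>j\<in>J. compose I zE (f j)) j" if "j \<in> J" for j
        using that z by (auto simp: zE_def compose_def fun_eq_iff)
    qed
    then have "p f = p (\<lambda>j\<in>J. compose I zE (f j))" by (rule arg_cong)
    also have "\<dots> = zE (p f)" by (rule p_smult[OF zE empty(1)])
    also have "\<dots> = \<zero>" using p_I[OF empty(1)] by (simp add: zE_def)
    finally show ?case using H by (simp add: sum_closed_def)
  next
    case (insert k A)
    have fext: "f \<in> extensional J" and fE: "\<And>j. j \<in> J \<Longrightarrow> f j \<in> carrier (Endo I)"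
      using insert.prems(1) Fr_iff by blast+
    show ?case
    proof (cases "k \<in> J")
      case False
      then have "{j \<in> J. f j \<noteq> zE} \<subseteq> A" using insert.prems(2) by auto
      then show ?thesis using insert.IH[OF insert.prems(1)] insert.prems(3) by blast
    next
      case True
      define f' where "f' = (\<lambda>j\<in>J. if j = k then zE else f j)"
      have f'A: "{j \<in> J. f' j \<noteq> zE} \<subseteq> A" using insert.prems(2) by (auto simp: f'_def)
      have f'Fr: "f' \<in> ?Fr"
        unfolding Fr_iff using finite_subset[OF f'A insert.hyps(1)] fE zE by (auto simp: f'_def)
      have zero_p: "zE (p (b j)) \<in> H" for j
        using p_I[OF bFr] H by (simp add: zE_def sum_closed_def)
      have "p f' \<in> H"
      proof (rule insert.IH[OF f'Fr f'A])
        show "f' j (p (b j)) \<in> H" if "j \<in> J" for j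
          using insert.prems(3)[OF that] zero_p that by (simp add: f'_def)
      qed
      have kFr: "(\<lambda>j\<in>J. compose I (f k) (b k j)) \<in> ?Fr"
      proof -
        have 1: "compose I (f k) oE = f k"
          using EndoD(4)[OF fE[OF True]] by (auto simp: compose_def oE_def fun_eq_iff extensional_def restrict_def)
        have 2: "compose I (f k) zE = zE"
          using hom0[OF fE[OF True]] by (auto simp: compose_def zE_def fun_eq_iff)
        have "{j \<in> J. (\<lambda>j\<in>J. compose I (f k) (b k j)) j \<noteq> zE} \<subseteq> {k}" using 2 by (auto simp: b_def)
        then have "finite {j \<in> J. (\<lambda>j\<in>J. compose I (f k) (b k j)) j \<noteq> zE}" by (rule finite_subset) simp
        then show ?thesis unfolding Fr_iff using 1 2 fE[OF True] zE by (auto simp: b_def)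
      qed
      have "f = (\<lambda>j\<in>J. \<lambda>x\<in>I. f' j x \<oplus> (\<lambda>j\<in>J. compose I (f k) (b k j)) j x)"
      proof (rule extensionalityI[OF fext])
        show "(\<lambda>j\<in>J. \<lambda>x\<in>I. f' j x \<oplus> (\<lambda>j\<in>J. compose I (f k) (b k j)) j x) \<in> extensional J" by simp
        fix j assume j: "j \<in> J"
        show "f j = (\<lambda>j\<in>J. \<lambda>x\<in>I. f' j x \<oplus> (\<lambda>j\<in>J. compose I (f k) (b k j)) j x) j"
        proof (rule extensionalityI[of _ I])
          show "f j \<in> extensional I" using EndoD(4)[OF fE[OF j]] .
          show "(\<lambda>j\<in>J. \<lambda>x\<in>I. f' j x \<oplus> (\<lambda>j\<in>J. compose I (f k) (b k j)) j x) j \<in> extensional I"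
            using j by simp
          fix u assume u: "u \<in> I"
          have "f j u \<in> carrier R" "f k u \<in> carrier R" using EndoD(1)[OF fE] j True u Ic by blast+
          then show "f j u = (\<lambda>j\<in>J. \<lambda>x\<in>I. f' j x \<oplus> (\<lambda>j\<in>J. compose I (f k) (b k j)) j x) j u"
            using j u True hom0[OF fE[OF True]] by (simp add: f'_def b_def zE_def oE_def compose_def)
        qed
      qed
      then have "p f = p (\<lambda>j\<in>J. \<lambda>x\<in>I. f' j x \<oplus> (\<lambda>j\<in>J. compose I (f k) (b k j)) j x)" by (rule arg_cong)
      also have "\<dots> = p f' \<oplus> p (\<lambda>j\<in>J. compose I (f k) (b k j))" by (rule p_add[OF f'Fr kFr])
      also have "p (\<lambda>j\<in>J. compose I (f k) (b k j)) = f k (p (b k))" by (rule p_smult[OF fE[OF True] bFr])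
      finally show ?thesis using \<open>p f' \<in> H\<close> insert.prems(3)[OF True] H by (simp add: sum_closed_def)
    qed
  qed
  have iE: "i y j \<in> carrier (Endo I)" if "y \<in> I" "j \<in> J" for y j
    using i_Fr[OF that(1)] that(2) Fr_iff by blast
  \<comment> \<open>Both sides are the coordinate \<open>j\<close> of \<open>i (x0 y)\<close> at
    \<open>z\<close>: multiplication by an element of \<open>I\<close> is an endomorphism, over
    which \<open>i\<close> is linear.\<close>
  have swap: "y \<otimes> i x0 j z = x0 \<otimes> i y j z" if y: "y \<in> I" and z: "z \<in> I" and j: "j \<in> J" for y z j
  proof -
    have mu: "(\<lambda>u\<in>I. a \<otimes> u) \<in> carrier (Endo I)" if "a \<in> I" for a
      using that Ic by (intro EndoI) (auto simp: I.I_l_closed r_distr m_lcomm)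
    have *: "i (a \<otimes> u) j z = a \<otimes> i u j z" if "a \<in> I" "u \<in> I" for a u
      using fun_cong[OF i_smult[OF mu[OF that(1)] that(2)], of j] that j z EndoD(1)[OF iE[OF that(2) j] z]
      by (simp add: compose_def)
    have "y \<otimes> i x0 j z = i (y \<otimes> x0) j z" using *[OF y x0] by simp
    also have "y \<otimes> x0 = x0 \<otimes> y" using Ic[OF x0] Ic[OF y] by (rule m_comm[rotated])
    also have "i (x0 \<otimes> y) j z = x0 \<otimes> i y j z" using *[OF x0 y] .
    finally show ?thesis .
  qed
  have "p (i x0) \<in> H"
  proof (rule main)
    show "finite {j \<in> J. i x0 j \<noteq> zE}" "i x0 \<in> ?Fr" using i_Fr[OF x0] Fr_iff by blast+
    fix j assume j: "j \<in> J"
    define x where "x = p (b j)"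
    have x: "x \<in> I" unfolding x_def by (rule p_I[OF bFr])
    note e = iE[OF x0 j]
    show "i x0 j (p (b j)) \<in> H"
    proof (cases "x = \<zero>")
      case True
      then show ?thesis using hom0[OF e] H by (simp add: x_def sum_closed_def)
    next
      case False
      have "i x0 j x \<in> H"
      proof (rule G[OF EndoD(1)[OF e x] x False])
        fix y z assume yz: "y \<in> I" "z \<in> I"
        have c: "i x0 j x \<in> carrier R" "i x0 j z \<in> carrier R" "i y j z \<in> carrier R"
          using EndoD(1)[OF e] EndoD(1)[OF iE[OF yz(1) j]] x yz Ic by blast+
        note cc = c Ic[OF x] Ic[OF yz(1)] Ic[OF yz(2)] Ic[OF x0]
        have "z \<otimes> i x0 j x = i x0 j (z \<otimes> x)" using EndoD(3)[OF e Ic[OF yz(2)] x] by simp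
        also have "z \<otimes> x = x \<otimes> z" using cc by (simp add: m_comm)
        also have "i x0 j (x \<otimes> z) = x \<otimes> i x0 j z" using EndoD(3)[OF e Ic[OF x] yz(2)] .
        finally have zx: "z \<otimes> i x0 j x = x \<otimes> i x0 j z" .
        have "i x0 j x \<otimes> (y \<otimes> z) = y \<otimes> (z \<otimes> i x0 j x)" using cc by (simp add: m_ac)
        also have "\<dots> = x \<otimes> (y \<otimes> i x0 j z)" unfolding zx using cc by (simp add: m_lcomm)
        also have "\<dots> = x0 \<otimes> (x \<otimes> i y j z)" unfolding swap[OF yz j] using cc by (simp add: m_lcomm)
        finally show "\<exists>w\<in>I. i x0 j x \<otimes> (y \<otimes> z) = x0 \<otimes> (x \<otimes> w)"
          using EndoD(1)[OF iE[OF yz(1) j] yz(2)] by blast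
      qed
      then show ?thesis by (simp add: x_def)
    qed
  qed simp
  then show ?thesis using pi[OF x0] by simp
qed

end

section \<open>Square-zero primes of the completion\<close>

text \<open>The ideal of \<open>x = k g\<close> and \<open>y = l g\<close> contains its generator
  \<open>g\<close>, so \<open>1 = a k + b l\<close> unless \<open>g\<close> is zero; in a local ring
  \<open>k\<close> or \<open>l\<close> is then a unit.\<close>

lemma (in principal_domain) quasilocal_divides_total:
  assumes ql: "quasilocal R" and x: "x \<in> carrier R" and y: "y \<in> carrier R"
  shows "x \<in> PIdl y \<or> y \<in> PIdl x"
proof -
  obtain g where g: "g \<in> carrier R" "PIdl x <+>\<^bsub>R\<^esub> PIdl y = PIdl g"
    using exists_gen[OF add_ideals[OF cgenideal_ideal[OF x] cgenideal_ideal[OF y]]] by blast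
  have mem: "w \<in> PIdl g \<longleftrightarrow> (\<exists>a\<in>carrier R. \<exists>b\<in>carrier R. w = a \<otimes> x \<oplus> b \<otimes> y)" for w
    unfolding g(2)[symmetric] by (auto simp: set_add_def' cgenideal_def)
  have "x = \<one> \<otimes> x \<oplus> \<zero> \<otimes> y" "y = \<zero> \<otimes> x \<oplus> \<one> \<otimes> y" using x y by simp_all
  then have "x \<in> PIdl g" "y \<in> PIdl g" using mem by blast+
  then obtain k l where k: "k \<in> carrier R" "x = k \<otimes> g" and l: "l \<in> carrier R" "y = l \<otimes> g"
    by (auto simp: PIdl_iff)
  obtain a b where ab: "a \<in> carrier R" "b \<in> carrier R" "g = a \<otimes> x \<oplus> b \<otimes> y"
    using mem cgenideal_self[OF g(1)] by blast
  show ?thesis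
  proof (cases "g = \<zero>")
    case True
    then have "x = \<zero>" using k by simp
    then show ?thesis using PIdl_closed(2)[OF y] by simp
  next
    case False
    have "g \<otimes> (a \<otimes> k \<oplus> b \<otimes> l) = a \<otimes> (k \<otimes> g) \<oplus> b \<otimes> (l \<otimes> g)"
      by (rule ring_identity, (rule reify ab(1,2) k(1) l(1) g(1))+, code_simp)
    also have "\<dots> = g \<otimes> \<one>" using ab(3) k(2) l(2) g(1) by simp
    finally have one: "a \<otimes> k \<oplus> b \<otimes> l = \<one>"
      using m_lcancel[OF False g(1)] ab(1,2) k(1) l(1) by simp
    interpret M: maximalideal "carrier R - Units R" R by (rule quasilocal_maximal[OF ql])
    have "k \<in> Units R \<or> l \<in> Units R"
    proof (rule ccontr)
      assume "\<not> ?thesis"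
      then have "a \<otimes> k \<oplus> b \<otimes> l \<in> carrier R - Units R"
        using ab(1,2) k(1) l(1) by (intro M.a_closed M.I_l_closed) auto
      then show False unfolding one by simp
    qed
    then show ?thesis
    proof
      assume u: "k \<in> Units R"
      have "g = inv k \<otimes> x" using k g u by (simp add: m_assoc[symmetric])
      then have "g \<in> PIdl x" using u by (auto simp: PIdl_iff)
      then show ?thesis unfolding l(2) using PIdl_closed(6)[OF x _ l(1)] by blast
    next
      assume u: "l \<in> Units R"
      have "g = inv l \<otimes> y" using l g u by (simp add: m_assoc[symmetric])
      then have "g \<in> PIdl y" using u by (auto simp: PIdl_iff)
      then show ?thesis unfolding k(2) using PIdl_closed(6)[OF y _ k(1)] by blast
    qed
  qed
qed

text \<open>In a principal domain ascending chains of ideals stop, so some \<open>x\<close> in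
  \<open>A\<close> generates a maximal one among the ideals \<open>PIdl x\<close>; as divisibility
  is total, it is the largest. In a discrete valuation ring this is an element of least
  value.\<close>

lemma (in principal_domain) quasilocal_least_divisor:
  assumes ql: "quasilocal R" and A: "A \<subseteq> carrier R" "A \<noteq> {}"
  obtains x where "x \<in> A" "A \<subseteq> PIdl x"
proof -
  define S where "S = {PIdl x | x. x \<in> A}"
  have "\<exists>M\<in>S. \<forall>J\<in>S. M \<subseteq> J \<longrightarrow> J = M"
  proof (rule subset_Zorn_nonempty)
    show "S \<noteq> {}" using A(2) unfolding S_def by blast
    fix Ch assume Ch: "Ch \<noteq> {}" "subset.chain S Ch"
    have "S \<subseteq> {I. ideal I R}" unfolding S_def using A(1) cgenideal_ideal by blast
    then have "subset.chain {I. ideal I R} Ch" using Ch(2) unfolding subset_chain_def by blast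
    then have "\<Union>Ch \<in> Ch" using ideal_chain_is_trivial[OF Ch(1)] by blast
    then show "\<Union>Ch \<in> S" using Ch(2) unfolding subset_chain_def by blast
  qed
  then obtain x where x: "x \<in> A" "\<And>y. \<lbrakk>y \<in> A; PIdl x \<subseteq> PIdl y\<rbrakk> \<Longrightarrow> PIdl y = PIdl x"
    unfolding S_def by blast
  have "y \<in> PIdl x" if y: "y \<in> A" for y
  proof -
    have c: "x \<in> carrier R" "y \<in> carrier R" using x y A by auto
    show ?thesis
      using quasilocal_divides_total[OF ql c]
    proof
      assume "x \<in> PIdl y"
      then have "PIdl y = PIdl x" using x(2)[OF y] PIdl_subset_iff[OF c(2,1)] by blast
      then show ?thesis using cgenideal_self[OF c(2)] by blast
    qed
  qed
  then show thesis using that[OF x(1)] by blast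
qed

locale square_zero_prime = "domain" R for R (structure) +
  fixes P
  assumes P_prime: "primeideal P (completion R)"
    and P_nonzero: "P \<noteq> {\<zero>\<^bsub>completion R\<^esub>}"
    and P_square: "P \<cdot>\<^bsub>completion R\<^esub> P = {\<zero>\<^bsub>completion R\<^esub>}"
    and P_dvr: "dvr (completion R Quot P)"
begin

sublocale C: cring "completion R" by (rule completion_cring)

sublocale \<iota>: ring_hom_cring R "completion R" \<iota>
  by (intro ring_hom_cringI ring_hom_ringI2 ring_axioms C.ring_axioms is_cring completion_cring \<iota>_hom)

abbreviation C where "C \<equiv> completion R"

lemma P_ideal: "ideal P C"
  using P_prime by (rule primeideal.axioms(1))

lemma P_carr: "p \<in> P \<Longrightarrow> p \<in> carrier C"
  using ideal.Icarr[OF P_ideal] .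

lemma P_mult: "\<lbrakk>p \<in> P; q \<in> P\<rbrakk> \<Longrightarrow> p \<otimes>\<^bsub>C\<^esub> q = \<zero>\<^bsub>C\<^esub>"
proof -
  assume "p \<in> P" "q \<in> P"
  then have "p \<otimes>\<^bsub>C\<^esub> q \<in> P \<cdot>\<^bsub>C\<^esub> P" by (rule ideal_prod.prod)
  then show ?thesis unfolding P_square by blast
qed

lemma \<iota>_zero_iff: "a \<in> carrier R \<Longrightarrow> \<iota> a = \<zero>\<^bsub>C\<^esub> \<longleftrightarrow> a = \<zero>"
proof
  assume a: "a \<in> carrier R" "\<iota> a = \<zero>\<^bsub>C\<^esub>"
  show "a = \<zero>"
  proof (rule ccontr)
    assume "a \<noteq> \<zero>"
    then have nz: "a \<in> nz" using a(1) unfolding nz_iff by blast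
    have "\<iota> a \<otimes>\<^bsub>C\<^esub> \<one>\<^bsub>C\<^esub> = \<zero>\<^bsub>C\<^esub>" unfolding a(2) by (rule C.l_null[OF C.one_closed])
    then have "\<one>\<^bsub>C\<^esub> = \<zero>\<^bsub>C\<^esub>" by (rule \<iota>_regular[OF nz C.one_closed])
    then have "\<one>\<^bsub>C\<^esub> \<in> P" using additive_subgroup.zero_closed[OF ideal.axioms(1)[OF P_ideal]] by metis
    then have "P = carrier C" by (rule ideal.one_imp_carrier[OF P_ideal])
    then show False using primeideal.I_notcarr[OF P_prime] by blast
  qed
qed (simp add: \<iota>.hom_zero)

text \<open>The square of an element of \<open>P\<close> is zero, and the ring, a domain, embeds in
  the completion.\<close>

lemma \<iota>_P: "\<lbrakk>a \<in> carrier R; \<iota> a \<in> P\<rbrakk> \<Longrightarrow> a = \<zero>"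
proof -
  assume a: "a \<in> carrier R" "\<iota> a \<in> P"
  have "\<iota> (a \<otimes> a) = \<zero>\<^bsub>C\<^esub>" unfolding \<iota>.hom_mult[OF a(1) a(1)] by (rule P_mult[OF a(2) a(2)])
  then have "a \<otimes> a = \<zero>" using \<iota>_zero_iff a(1) by blast
  then show "a = \<zero>" using integral a(1) by blast
qed

text \<open>Since \<open>P\<^sup>2 = 0\<close>, the product \<open>(a - s u) (b - s v)\<close> vanishes; approximating \<open>u\<close> and \<open>v\<close>
  modulo \<open>s\<close> by elements of \<open>R\<close> gives a relation in \<open>R\<close>.\<close>

lemma quadratic_relation:
  assumes ab: "a \<in> carrier R" "b \<in> carrier R" and s: "s \<in> nz"
    and u: "u \<in> carrier C" "\<iota> a \<ominus>\<^bsub>C\<^esub> \<iota> s \<otimes>\<^bsub>C\<^esub> u \<in> P"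
    and v: "v \<in> carrier C" "\<iota> b \<ominus>\<^bsub>C\<^esub> \<iota> s \<otimes>\<^bsub>C\<^esub> v \<in> P"
  obtains p q r where "p \<in> carrier R" "q \<in> carrier R" "r \<in> carrier R"
    "a \<otimes> b = s \<otimes> (p \<otimes> a \<oplus> q \<otimes> b \<oplus> s \<otimes> r)"
proof -
  \<comment> \<open>The labels are crossed: in the expanded product \<open>v\<close> multiplies
    \<open>a\<close> and \<open>u\<close> multiplies \<open>b\<close>, so \<open>p\<close>
    approximates \<open>v\<close> and \<open>q\<close> approximates \<open>u\<close>.\<close>
  obtain q u' where u': "q \<in> carrier R" "u' \<in> carrier C" "u = \<iota> q \<oplus>\<^bsub>C\<^esub> \<iota> s \<otimes>\<^bsub>C\<^esub> u'"
    by (rule completion_dense[OF u(1) s])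
  obtain p v' where v': "p \<in> carrier R" "v' \<in> carrier C" "v = \<iota> p \<oplus>\<^bsub>C\<^esub> \<iota> s \<otimes>\<^bsub>C\<^esub> v'"
    by (rule completion_dense[OF v(1) s])
  have sc: "s \<in> carrier R" using s by simp
  define A B T Q P' where "A = \<iota> a" and "B = \<iota> b" and "T = \<iota> s" and "Q = \<iota> q" and "P' = \<iota> p"
  have c: "A \<in> carrier C" "B \<in> carrier C" "T \<in> carrier C" "Q \<in> carrier C" "P' \<in> carrier C"
    "u' \<in> carrier C" "v' \<in> carrier C" "u \<in> carrier C" "v \<in> carrier C"
    using ab sc u' v' u v by (auto simp: A_def B_def T_def Q_def P'_def)
  have 0: "(A \<ominus>\<^bsub>C\<^esub> T \<otimes>\<^bsub>C\<^esub> u) \<otimes>\<^bsub>C\<^esub> (B \<ominus>\<^bsub>C\<^esub> T \<otimes>\<^bsub>C\<^esub> v) = \<zero>\<^bsub>C\<^esub>"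
    using P_mult[OF u(2) v(2)] unfolding A_def B_def T_def .
  define y where "y = v' \<otimes>\<^bsub>C\<^esub> A \<oplus>\<^bsub>C\<^esub> u' \<otimes>\<^bsub>C\<^esub> B \<ominus>\<^bsub>C\<^esub> u \<otimes>\<^bsub>C\<^esub> v"
  have y: "y \<in> carrier C" unfolding y_def using c by simp
  have "A \<otimes>\<^bsub>C\<^esub> B \<ominus>\<^bsub>C\<^esub> T \<otimes>\<^bsub>C\<^esub> (P' \<otimes>\<^bsub>C\<^esub> A \<oplus>\<^bsub>C\<^esub> Q \<otimes>\<^bsub>C\<^esub> B) =
    (A \<ominus>\<^bsub>C\<^esub> T \<otimes>\<^bsub>C\<^esub> u) \<otimes>\<^bsub>C\<^esub> (B \<ominus>\<^bsub>C\<^esub> T \<otimes>\<^bsub>C\<^esub> v) \<oplus>\<^bsub>C\<^esub> (T \<otimes>\<^bsub>C\<^esub> T) \<otimes>\<^bsub>C\<^esub> y"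
    unfolding y_def u'(3) v'(3) Q_def[symmetric] P'_def[symmetric] T_def[symmetric]
    by (rule C.ring_identity, (rule C.reify c)+, code_simp)
  then have eq: "A \<otimes>\<^bsub>C\<^esub> B \<ominus>\<^bsub>C\<^esub> T \<otimes>\<^bsub>C\<^esub> (P' \<otimes>\<^bsub>C\<^esub> A \<oplus>\<^bsub>C\<^esub> Q \<otimes>\<^bsub>C\<^esub> B) = (T \<otimes>\<^bsub>C\<^esub> T) \<otimes>\<^bsub>C\<^esub> y"
    unfolding 0 using c y by simp
  \<comment> \<open>\<open>d\<close> is divisible by \<open>s s\<close> in the completion, hence
    already in the ring.\<close>
  define d where "d = a \<otimes> b \<oplus> \<ominus> (s \<otimes> (p \<otimes> a \<oplus> q \<otimes> b))"
  have d: "d \<in> carrier R" using ab sc u' v' by (simp add: d_def)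
  have "\<iota> d = \<iota> (s \<otimes> s) \<otimes>\<^bsub>C\<^esub> y"
    using eq ab sc u'(1) v'(1) by (simp add: d_def A_def B_def T_def Q_def P'_def C.minus_eq)
  then have "d \<in> PIdl (s \<otimes> s)" using \<iota>_dvd_\<iota>_iff[OF nz_mult[OF s s] d] y by blast
  then obtain r where r: "r \<in> carrier R" "d = r \<otimes> (s \<otimes> s)" by (auto simp: PIdl_iff)
  note cc = ab sc u'(1) v'(1) r(1)
  have "a \<otimes> b = d \<oplus> s \<otimes> (p \<otimes> a \<oplus> q \<otimes> b)"
    unfolding d_def by (rule ring_identity, (rule reify cc)+, code_simp)
  also have "\<dots> = s \<otimes> (p \<otimes> a \<oplus> q \<otimes> b \<oplus> s \<otimes> r)"
    unfolding r(2) by (rule ring_identity, (rule reify cc)+, code_simp)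
  finally show thesis using that u'(1) v'(1) r(1) by blast
qed

text \<open>Among the images of \<open>I\<close> in the discrete valuation ring
  \<open>C / P\<close>, the image of \<open>x\<close> divides all others. It is not zero because
  \<open>P\<close> meets the ring only in zero.\<close>

lemma minimal_value:
  assumes I: "ideal I R" and I0: "I \<noteq> {\<zero>}"
  shows "\<exists>x\<in>I. x \<in> nz \<and> (\<forall>y\<in>I. \<exists>z\<in>carrier C. \<iota> y \<ominus>\<^bsub>C\<^esub> \<iota> x \<otimes>\<^bsub>C\<^esub> z \<in> P)"
proof -
  interpret I: ideal I R by fact
  interpret P: ideal P C by (rule P_ideal)
  interpret h: ring_hom_cring C "C Quot P" "(+>\<^bsub>C\<^esub>) P" by (rule P.rcos_ring_hom_cring[OF C.is_cring])
  have pd: "principal_domain (C Quot P)" and ql: "quasilocal (C Quot P)" using P_dvr by (auto simp: dvr_def)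
  define A where "A = (\<lambda>x. P +>\<^bsub>C\<^esub> \<iota> x) ` I"
  have \<iota>I: "\<iota> x \<in> carrier C" if "x \<in> I" for x using that I.Icarr by simp
  have "A \<subseteq> carrier (C Quot P)" unfolding A_def using \<iota>I h.hom_closed by blast
  moreover have "A \<noteq> {}" unfolding A_def using I.zero_closed by blast
  ultimately obtain Y where Y: "Y \<in> A" "A \<subseteq> PIdl\<^bsub>C Quot P\<^esub> Y"
    using principal_domain.quasilocal_least_divisor[OF pd ql] by metis
  then obtain x where x: "x \<in> I" "Y = P +>\<^bsub>C\<^esub> \<iota> x" unfolding A_def by blast
  have div: "\<exists>z\<in>carrier C. \<iota> y \<ominus>\<^bsub>C\<^esub> \<iota> x \<otimes>\<^bsub>C\<^esub> z \<in> P" if y: "y \<in> I" for y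
  proof -
    have "P +>\<^bsub>C\<^esub> \<iota> y \<in> PIdl\<^bsub>C Quot P\<^esub> Y" using Y(2) y unfolding A_def by blast
    then obtain k where k: "k \<in> carrier (C Quot P)" "P +>\<^bsub>C\<^esub> \<iota> y = k \<otimes>\<^bsub>C Quot P\<^esub> Y"
      unfolding cgenideal_def by blast
    obtain z where z: "z \<in> carrier C" "k = P +>\<^bsub>C\<^esub> z" using C.FactRing_carrierE[OF k(1)] by blast
    have "P +>\<^bsub>C\<^esub> \<iota> y = P +>\<^bsub>C\<^esub> (z \<otimes>\<^bsub>C\<^esub> \<iota> x)"
      unfolding k(2) z(2) x(2) by (rule h.hom_mult[OF z(1) \<iota>I[OF x(1)], symmetric])
    then have "\<iota> y \<ominus>\<^bsub>C\<^esub> z \<otimes>\<^bsub>C\<^esub> \<iota> x \<in> P"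
      using C.ideal_coset_eq_iff[OF P_ideal \<iota>I[OF y] C.m_closed[OF z(1) \<iota>I[OF x(1)]]] by blast
    then show ?thesis using C.m_comm[OF z(1) \<iota>I[OF x(1)]] z(1) by metis
  qed
  have "x \<noteq> \<zero>"
  proof
    assume x0: "x = \<zero>"
    have "y = \<zero>" if y: "y \<in> I" for y
    proof -
      obtain z where z: "z \<in> carrier C" "\<iota> y \<ominus>\<^bsub>C\<^esub> \<iota> x \<otimes>\<^bsub>C\<^esub> z \<in> P" using div[OF y] by blast
      have "\<iota> y \<in> P" using z \<iota>I[OF y] unfolding x0 by (simp only: \<iota>.hom_zero C.l_null C.minus_0_r)
      then show ?thesis using \<iota>_P I.Icarr y by blast
    qed
    then show False using I0 I.zero_closed by blast
  qed
  then have "x \<in> nz" using x(1) I.Icarr unfolding nz_iff by blast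
  then show ?thesis using x(1) div by blast
qed

text \<open>In the quadratic relation with \<open>s = x\<close> the factor beside \<open>x\<close>
  is a combination of elements of \<open>I\<close>, which is the hypothesis of
  \<open>stable_idealI\<close>.\<close>

lemma stable: "stable_domain R"
  unfolding stable_domain_def
proof (intro conjI allI impI)
  show "domain R" by (rule domain_axioms)
  fix I assume "ideal I R \<and> I \<noteq> {\<zero>}"
  then have I: "ideal I R" "I \<noteq> {\<zero>}" by auto
  interpret I: ideal I R by fact
  obtain x where x: "x \<in> I" "x \<in> nz" "\<And>y. y \<in> I \<Longrightarrow> \<exists>z\<in>carrier C. \<iota> y \<ominus>\<^bsub>C\<^esub> \<iota> x \<otimes>\<^bsub>C\<^esub> z \<in> P"
    using minimal_value[OF I] by blast
  show "stable_ideal R I"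
  proof (rule stable_idealI[OF I(1) x(1) nzD(2)[OF x(2)]])
    fix y z assume yz: "y \<in> I" "z \<in> I"
    obtain u where u: "u \<in> carrier C" "\<iota> y \<ominus>\<^bsub>C\<^esub> \<iota> x \<otimes>\<^bsub>C\<^esub> u \<in> P" using x(3)[OF yz(1)] by blast
    obtain v where v: "v \<in> carrier C" "\<iota> z \<ominus>\<^bsub>C\<^esub> \<iota> x \<otimes>\<^bsub>C\<^esub> v \<in> P" using x(3)[OF yz(2)] by blast
    obtain p q r where pqr: "p \<in> carrier R" "q \<in> carrier R" "r \<in> carrier R"
      "y \<otimes> z = x \<otimes> (p \<otimes> y \<oplus> q \<otimes> z \<oplus> x \<otimes> r)"
      by (rule quadratic_relation[OF I.Icarr[OF yz(1)] I.Icarr[OF yz(2)] x(2) u v])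
    have "p \<otimes> y \<oplus> q \<otimes> z \<oplus> x \<otimes> r \<in> I"
      by (intro I.a_closed I.I_l_closed[OF yz(1) pqr(1)] I.I_l_closed[OF yz(2) pqr(2)]
          I.I_r_closed[OF x(1) pqr(3)])
    then show "\<exists>w\<in>I. y \<otimes> z = x \<otimes> w" using pqr(4) by blast
  qed
qed

end

section \<open>Unbounded denominators in the normalization\<close>

context domain_fractions
begin

lemma quadratic_normalization:
  assumes z: "z \<in> carrier Frac" and pq: "p \<in> carrier R" "q \<in> carrier R"
    and zz: "z \<otimes>\<^bsub>Frac\<^esub> z = embed p \<otimes>\<^bsub>Frac\<^esub> z \<oplus>\<^bsub>Frac\<^esub> embed q"
  shows "z \<in> normalization R"
proof -
  define A B where "A = embed p" and "B = embed q"
  have c: "A \<in> carrier Frac" "B \<in> carrier Frac" "z \<in> carrier Frac" using pq z by (auto simp: A_def B_def)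
  define f where "f = [\<one>\<^bsub>Frac\<^esub>, \<ominus>\<^bsub>Frac\<^esub> A, \<ominus>\<^bsub>Frac\<^esub> B]"
  have neg: "\<ominus>\<^bsub>Frac\<^esub> A = embed (\<ominus> p)" "\<ominus>\<^bsub>Frac\<^esub> B = embed (\<ominus> q)" "\<one>\<^bsub>Frac\<^esub> = embed \<one>"
    using pq by (simp_all add: A_def B_def)
  have "set f \<subseteq> frac_image R"
    unfolding frac_image_eq f_def neg using pq by (simp del: emb.hom_a_inv emb.hom_one)
  then have "polynomial\<^bsub>Frac\<^esub> (frac_image R) f"
    by (simp add: polynomial_def f_def)
  moreover have "Fr.eval f z = \<zero>\<^bsub>Frac\<^esub>"
  proof -
    have "Fr.eval f z = z \<otimes>\<^bsub>Frac\<^esub> z \<oplus>\<^bsub>Frac\<^esub> (\<ominus>\<^bsub>Frac\<^esub> A \<otimes>\<^bsub>Frac\<^esub> z \<oplus>\<^bsub>Frac\<^esub> \<ominus>\<^bsub>Frac\<^esub> B)"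
      using c by (simp add: f_def numeral_2_eq_2)
    also have "\<dots> = \<zero>\<^bsub>Frac\<^esub>"
      unfolding zz A_def[symmetric] B_def[symmetric]
      by (rule Fr.ring_identity, (rule Fr.reify c)+, code_simp)
    finally show ?thesis .
  qed
  moreover have "f \<noteq> []" "lead_coeff f = \<one>\<^bsub>Frac\<^esub>" by (simp_all add: f_def)
  ultimately have "integral_over Frac (frac_image R) z" unfolding integral_over_def by blast
  then show ?thesis using z unfolding normalization_def by blast
qed

lemma Span_Cons:
  "z \<in> Fr.Span K (u # us) \<longleftrightarrow> (\<exists>k\<in>K. \<exists>w\<in>Fr.Span K us. z = k \<otimes>\<^bsub>Frac\<^esub> u \<oplus>\<^bsub>Frac\<^esub> w)"
  by (auto simp: Fr.line_extension_def set_add_def' r_coset_def)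

lemma Span_denominator:
  assumes "set us \<subseteq> carrier Frac"
  shows "\<exists>s\<in>nz. \<forall>z\<in>Fr.Span (frac_image R) us. z \<in> carrier Frac \<and> embed s \<otimes>\<^bsub>Frac\<^esub> z \<in> frac_image R"
  using assms
proof (induction us)
  case Nil
  have "\<one> \<in> nz" unfolding nz_iff by simp
  moreover have "embed \<one> \<otimes>\<^bsub>Frac\<^esub> \<zero>\<^bsub>Frac\<^esub> = embed \<zero>" by simp
  then have "embed \<one> \<otimes>\<^bsub>Frac\<^esub> \<zero>\<^bsub>Frac\<^esub> \<in> frac_image R" unfolding frac_image_eq by blast
  ultimately show ?case by (intro bexI[of _ \<one>]) simp_all
next
  case (Cons u us)
  then obtain s where s: "s \<in> nz" "\<And>z. z \<in> Fr.Span (frac_image R) us \<Longrightarrow> z \<in> carrier Frac"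
    "\<And>z. z \<in> Fr.Span (frac_image R) us \<Longrightarrow> embed s \<otimes>\<^bsub>Frac\<^esub> z \<in> frac_image R" by auto
  have uc: "u \<in> carrier Frac" using Cons.prems by simp
  then obtain a r where ar: "a \<in> carrier R" "r \<in> carrier R" "r \<noteq> \<zero>" "embed r \<otimes>\<^bsub>Frac\<^esub> u = embed a"
    by (rule Frac_denominator)
  have r: "r \<in> nz" using ar unfolding nz_iff by blast
  have sc: "s \<in> carrier R" using s by simp
  have "z \<in> carrier Frac \<and> embed (s \<otimes> r) \<otimes>\<^bsub>Frac\<^esub> z \<in> frac_image R"
    if z: "z \<in> Fr.Span (frac_image R) (u # us)" for z
  proof -
    obtain k w where kw: "k \<in> frac_image R" "w \<in> Fr.Span (frac_image R) us"
      "z = k \<otimes>\<^bsub>Frac\<^esub> u \<oplus>\<^bsub>Frac\<^esub> w" using z Span_Cons by blast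
    obtain k' where k': "k' \<in> carrier R" "k = embed k'" using kw unfolding frac_image_eq by blast
    obtain w' where w': "w' \<in> carrier R" "embed s \<otimes>\<^bsub>Frac\<^esub> w = embed w'"
      using s(3)[OF kw(2)] unfolding frac_image_eq by blast
    define A B T where "A = embed s" and "B = embed r" and "T = embed k'"
    have wc: "w \<in> carrier Frac" using s(2)[OF kw(2)] .
    have c: "A \<in> carrier Frac" "B \<in> carrier Frac" "T \<in> carrier Frac" "u \<in> carrier Frac" "w \<in> carrier Frac"
      using sc ar k' uc wc by (auto simp: A_def B_def T_def)
    have "(A \<otimes>\<^bsub>Frac\<^esub> B) \<otimes>\<^bsub>Frac\<^esub> (T \<otimes>\<^bsub>Frac\<^esub> u \<oplus>\<^bsub>Frac\<^esub> w) =
      (A \<otimes>\<^bsub>Frac\<^esub> T) \<otimes>\<^bsub>Frac\<^esub> (B \<otimes>\<^bsub>Frac\<^esub> u) \<oplus>\<^bsub>Frac\<^esub> B \<otimes>\<^bsub>Frac\<^esub> (A \<otimes>\<^bsub>Frac\<^esub> w)"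
      by (rule Fr.ring_identity, (rule Fr.reify c)+, code_simp)
    then have "embed (s \<otimes> r) \<otimes>\<^bsub>Frac\<^esub> z = embed (s \<otimes> k' \<otimes> a \<oplus> r \<otimes> w')"
      unfolding kw(3) k'(2) using sc ar k' w' by (simp add: A_def B_def T_def)
    moreover have "s \<otimes> k' \<otimes> a \<oplus> r \<otimes> w' \<in> carrier R" using sc ar k' w' by simp
    moreover have "z \<in> carrier Frac" unfolding kw(3) k'(2) using k' uc wc by simp
    ultimately show ?thesis unfolding frac_image_eq by blast
  qed
  then show ?case using nz_mult[OF s(1) r] by blast
qed

end

context square_zero_prime
begin

text \<open>Given a common denominator \<open>s\<close> of the normalization and \<open>p\<close> in
  \<open>P\<close> not divisible by \<open>s'\<close>, approximate \<open>p\<close> modulo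
  \<open>d = s s'\<close> by \<open>c\<close> in the ring. The quadratic relation for
  \<open>c\<close> makes \<open>c / d\<close> integral, so \<open>s c / d\<close> is in the ring;
  that is, \<open>s'\<close> divides \<open>c\<close> and with it \<open>p\<close>.\<close>

lemma not_finite_normalization: "\<not> finite_normalization R"
proof
  interpret D: domain_fractions R by unfold_locales
  assume "finite_normalization R"
  then obtain us where us: "set us \<subseteq> normalization R" "normalization R = D.Fr.Span (frac_image R) us"
    unfolding finite_normalization_def by blast
  have "normalization R \<subseteq> carrier Frac" unfolding normalization_def by blast
  then obtain s where s: "s \<in> nz" "\<And>z. z \<in> normalization R \<Longrightarrow> embed s \<otimes>\<^bsub>Frac\<^esub> z \<in> frac_image R"
    using D.Span_denominator[of us] us by blast
  obtain p where p: "p \<in> P" "p \<noteq> \<zero>\<^bsub>C\<^esub>"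
    using P_nonzero additive_subgroup.zero_closed[OF ideal.axioms(1)[OF P_ideal]] by blast
  then obtain s' where s': "s' \<in> nz" "\<not> (\<exists>z\<in>carrier C. p = \<iota> s' \<otimes>\<^bsub>C\<^esub> z)"
    using completion_separated[OF P_carr[OF p(1)]] by blast
  define d where "d = s \<otimes> s'"
  have d: "d \<in> nz" unfolding d_def using nz_mult s(1) s'(1) by blast
  obtain c w where c: "c \<in> carrier R" "w \<in> carrier C" "p = \<iota> c \<oplus>\<^bsub>C\<^esub> \<iota> d \<otimes>\<^bsub>C\<^esub> w"
    by (rule completion_dense[OF P_carr[OF p(1)] d])
  have sc: "s \<in> carrier R" "s' \<in> carrier R" "d \<in> carrier R" "d \<noteq> \<zero>" "s \<noteq> \<zero>"
    using nzD[OF d] nzD[OF s(1)] nzD[OF s'(1)] by auto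
  define A T where "A = \<iota> c" and "T = \<iota> d"
  have cc: "A \<in> carrier C" "T \<in> carrier C" "w \<in> carrier C" using c sc by (auto simp: A_def T_def)
  \<comment> \<open>The sign is adjusted to the form \<open>c - d u\<close> demanded by
    \<open>quadratic_relation\<close>.\<close>
  have "A \<ominus>\<^bsub>C\<^esub> T \<otimes>\<^bsub>C\<^esub> (\<ominus>\<^bsub>C\<^esub> w) = A \<oplus>\<^bsub>C\<^esub> T \<otimes>\<^bsub>C\<^esub> w"
    by (rule C.ring_identity, (rule C.reify cc)+, code_simp)
  then have cP: "\<iota> c \<ominus>\<^bsub>C\<^esub> \<iota> d \<otimes>\<^bsub>C\<^esub> (\<ominus>\<^bsub>C\<^esub> w) \<in> P" using p(1) unfolding c(3) A_def T_def by simp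
  obtain a b r where abr: "a \<in> carrier R" "b \<in> carrier R" "r \<in> carrier R"
    "c \<otimes> c = d \<otimes> (a \<otimes> c \<oplus> b \<otimes> c \<oplus> d \<otimes> r)"
    by (rule quadratic_relation[OF c(1) c(1) d C.a_inv_closed[OF c(2)] cP C.a_inv_closed[OF c(2)] cP])
  define z where "z = fraction R c d"
  have z: "z \<in> carrier Frac" unfolding z_def using fraction_closed c sc by blast
  have "z \<otimes>\<^bsub>Frac\<^esub> z = embed (a \<oplus> b) \<otimes>\<^bsub>Frac\<^esub> z \<oplus>\<^bsub>Frac\<^esub> embed r"
  proof -
    have "embed (a \<oplus> b) \<otimes>\<^bsub>Frac\<^esub> z \<oplus>\<^bsub>Frac\<^esub> embed r = fraction R ((a \<oplus> b) \<otimes> c \<oplus> r \<otimes> d) d"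
      unfolding z_def embed_def using abr(1-3) c sc by (simp add: fraction_mult fraction_add)
    moreover have "z \<otimes>\<^bsub>Frac\<^esub> z = fraction R (c \<otimes> c) (d \<otimes> d)"
      unfolding z_def using c sc by (simp add: fraction_mult)
    moreover have "fraction R (c \<otimes> c) (d \<otimes> d) = fraction R ((a \<oplus> b) \<otimes> c \<oplus> r \<otimes> d) d"
    proof (rule fraction_eqI)
      show "(c \<otimes> c) \<otimes> d = ((a \<oplus> b) \<otimes> c \<oplus> r \<otimes> d) \<otimes> (d \<otimes> d)"
        unfolding abr(4) by (rule ring_identity, (rule reify abr(1-3) c(1) sc(3))+, code_simp)
    qed (use abr(1-3) c(1) sc in \<open>simp_all add: integral_iff\<close>)
    ultimately show ?thesis by simp
  qed
  then have "z \<in> normalization R"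
    by (rule D.quadratic_normalization[OF z a_closed[OF abr(1,2)] abr(3)])
  then obtain e where e: "e \<in> carrier R" "embed s \<otimes>\<^bsub>Frac\<^esub> z = embed e"
    using s(2) unfolding frac_image_eq by blast
  have "(s \<otimes> c) \<otimes> \<one> = e \<otimes> d"
    using e c(1) sc unfolding z_def embed_def by (simp add: fraction_mult fraction_eq_iff)
  then have "s \<otimes> c = s \<otimes> (e \<otimes> s')" using c(1) sc e(1) unfolding d_def by (simp add: m_lcomm)
  then have "c = e \<otimes> s'" using m_lcancel[OF sc(5,1) c(1) m_closed[OF e(1) sc(2)]] by blast
  then have ce: "c = s' \<otimes> e" using e(1) sc(2) by (simp add: m_comm)
  have "p = \<iota> s' \<otimes>\<^bsub>C\<^esub> (\<iota> e \<oplus>\<^bsub>C\<^esub> \<iota> s \<otimes>\<^bsub>C\<^esub> w)"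
    unfolding c(3) ce d_def using e(1) sc c(2) by (simp add: C.r_distr C.m_ac)
  then show False using s'(2) e(1) sc c(2) by (metis C.a_closed C.m_closed \<iota>.hom_closed)
qed

lemma bad_stable:
  assumes "quasilocal R" "krull_dim R = 1"
  shows "bad_stable_ring R"
  unfolding bad_stable_ring_def using assms stable not_finite_normalization by blast

end

section \<open>Stable domains inside their fields of fractions\<close>

text \<open>A list of length \<open>n\<close> has degree below \<open>n\<close>, so in each term at
  least one factor \<open>c\<close> is left after the powers of \<open>z\<close> have been
  cleared.\<close>

lemma (in field) cleared_eval:
  assumes S: "subring S R" and c: "c \<in> S" and z: "z \<in> carrier R" "c \<otimes> z \<in> S"
    and q: "set q \<subseteq> S"
  shows "\<exists>s\<in>S. c [^] length q \<otimes> eval q z = c \<otimes> s"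
  using q
proof (induction q)
  case Nil
  have "c \<in> carrier R" "\<zero> \<in> S" using subringE(1,2)[OF S] c by auto
  then show ?case by (intro bexI[of _ \<zero>]) simp_all
next
  case (Cons a q)
  obtain s where s: "s \<in> S" "c [^] length q \<otimes> eval q z = c \<otimes> s" using Cons by auto
  have aS: "a \<in> S" using Cons.prems by simp
  have Sc: "x \<in> carrier R" if "x \<in> S" for x using subringE(1)[OF S] that by blast
  have pw: "(c \<otimes> z) [^] (n::nat) \<in> S" for n
    by (induction n) (use subringE(3,6)[OF S] z in auto)
  define n where "n = length q"
  define e u v where "e = eval q z" and "u = c [^] n" and "v = z [^] n"
  have carr: "a \<in> carrier R" "c \<in> carrier R" "s \<in> carrier R" "u \<in> carrier R" "v \<in> carrier R" "e \<in> carrier R"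
    using Sc aS c s(1) z(1) eval_in_carrier[of q z] Cons.prems by (auto simp: u_def v_def e_def)
  have uv: "u \<otimes> v = (c \<otimes> z) [^] n" using carr(2) z(1) by (simp add: u_def v_def nat_pow_distrib)
  have "c [^] length (a # q) \<otimes> eval (a # q) z = (u \<otimes> c) \<otimes> (a \<otimes> v \<oplus> e)"
    by (simp add: u_def v_def e_def n_def)
  also have "\<dots> = c \<otimes> (a \<otimes> (u \<otimes> v)) \<oplus> c \<otimes> (u \<otimes> e)"
    by (rule ring_identity, (rule reify carr)+, code_simp)
  also have "u \<otimes> e = c \<otimes> s" using s(2) by (simp add: u_def e_def n_def)
  also have "c \<otimes> (a \<otimes> (u \<otimes> v)) \<oplus> c \<otimes> (c \<otimes> s) = c \<otimes> (a \<otimes> (u \<otimes> v) \<oplus> c \<otimes> s)"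
    by (rule ring_identity, (rule reify carr)+, code_simp)
  finally show ?case
    using subringE(6)[OF S aS pw[of n]] subringE(6)[OF S c s(1)] subringE(7)[OF S] unfolding uv by blast
qed

text \<open>The exponent is the degree of the monic equation: its lower terms, multiplied by that
  power of \<open>c\<close>, form a multiple of \<open>c\<close>.\<close>

lemma (in field) integral_power_bounded:
  assumes A: "A \<subseteq> carrier R" and x: "x \<in> carrier R" and int: "integral_over R A x"
  shows "x \<in> power_bounded R A"
proof -
  obtain p where p: "polynomial\<^bsub>R\<^esub> A p" "p \<noteq> []" "lead_coeff p = \<one>" "eval p x = \<zero>"
    using int unfolding integral_over_def by blast
  obtain q where q: "p = \<one> # q" using p(2,3) by (cases p) auto
  have qA: "set q \<subseteq> A" using p(1) unfolding q polynomial_def by auto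
  have "\<exists>s\<in>S. (c \<otimes> x) [^] length q = c \<otimes> s"
    if S: "subring S R" "A \<subseteq> S" and c: "c \<in> S" "c \<otimes> x \<in> S" for S c
  proof -
    have qS: "set q \<subseteq> S" using qA S(2) by blast
    obtain s where s: "s \<in> S" "c [^] length q \<otimes> eval q x = c \<otimes> s"
      using cleared_eval[OF S(1) c(1) x c(2) qS] by blast
    have sc: "s \<in> carrier R" "c \<in> carrier R" using s(1) c(1) subringE(1)[OF S(1)] by auto
    define e u v where "e = eval q x" and "u = c [^] length q" and "v = x [^] length q"
    have ec: "e \<in> carrier R" "u \<in> carrier R" "v \<in> carrier R"
      using eval_in_carrier[of q x] qA A x sc by (auto simp: e_def u_def v_def)
    have ve: "v \<oplus> e = \<zero>" using p(4) x unfolding q by (simp add: e_def v_def)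
    have "(c \<otimes> x) [^] length q = u \<otimes> v" using sc x by (simp add: u_def v_def nat_pow_distrib)
    also have "\<dots> = u \<otimes> (v \<oplus> e) \<ominus> u \<otimes> e"
      by (rule ring_identity, (rule reify ec)+, code_simp)
    also have "\<dots> = \<ominus> (c \<otimes> s)" unfolding ve using s(2) ec sc by (simp add: u_def e_def)
    also have "\<dots> = c \<otimes> (\<ominus> s)" using sc by (simp add: r_minus)
    finally show ?thesis using subringE(5)[OF S(1) s(1)] by blast
  qed
  then show ?thesis unfolding power_bounded_def using x by blast
qed

context domain_fractions
begin

lemma subring_frac_image: "subring (frac_image R) Frac"
  unfolding frac_image_eq
proof (rule Fr.subringI)
  show "embed ` carrier R \<subseteq> carrier Frac" by auto
  show "\<one>\<^bsub>Frac\<^esub> \<in> embed ` carrier R" using emb.hom_one one_closed by (metis imageI)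
  show "\<ominus>\<^bsub>Frac\<^esub> h \<in> embed ` carrier R" if "h \<in> embed ` carrier R" for h
    using that by (auto simp flip: emb.hom_a_inv)
  show "h1 \<otimes>\<^bsub>Frac\<^esub> h2 \<in> embed ` carrier R" "h1 \<oplus>\<^bsub>Frac\<^esub> h2 \<in> embed ` carrier R"
    if "h1 \<in> embed ` carrier R" "h2 \<in> embed ` carrier R" for h1 h2
    using that by (auto simp flip: emb.hom_mult emb.hom_add)
qed

lemma nonunits_frac_image: "nonunits Frac (frac_image R) = embed ` (carrier R - Units R)"
proof -
  have iff: "(\<forall>y\<in>carrier R. embed x \<otimes>\<^bsub>Frac\<^esub> embed y \<noteq> \<one>\<^bsub>Frac\<^esub>) \<longleftrightarrow> x \<notin> Units R"
    if x: "x \<in> carrier R" for x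
  proof -
    have "embed x \<otimes>\<^bsub>Frac\<^esub> embed y = \<one>\<^bsub>Frac\<^esub> \<longleftrightarrow> x \<otimes> y = \<one>" if "y \<in> carrier R" for y
      using embed_inj[of "x \<otimes> y" \<one>] x that by simp
    then show ?thesis using x Units_r_inv_ex unit_factor[of x] by (metis Units_one_closed)
  qed
  show ?thesis unfolding nonunits_def frac_image_eq using iff by auto
qed

text \<open>Integral elements are power bounded and so lie in \<open>W\<close>; conversely
  \<open>x x\<close> is in \<open>W\<close>, so all of \<open>W\<close> is quadratic over the
  ring.\<close>

lemma finite_normalizationI:
  assumes tg: "two_generated_closure Frac (power_bounded Frac (frac_image R)) (frac_image R)"
  shows "finite_normalization R"
proof -
  obtain W x where W: "subring W Frac" "x \<in> W" "W = affine_span Frac (frac_image R) x"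
    "power_bounded Frac (frac_image R) \<subseteq> W" using tg unfolding two_generated_closure_def by blast
  have Wc: "w \<in> carrier Frac" if "w \<in> W" for w using subringE(1)[OF W(1)] that by blast
  have xc: "x \<in> carrier Frac" using Wc W(2) .
  have We: "\<exists>a\<in>carrier R. \<exists>b\<in>carrier R. w = embed a \<oplus>\<^bsub>Frac\<^esub> embed b \<otimes>\<^bsub>Frac\<^esub> x" if "w \<in> W" for w
    using that unfolding W(3) affine_span_def frac_image_eq by blast
  obtain p q where pq: "p \<in> carrier R" "q \<in> carrier R"
    "x \<otimes>\<^bsub>Frac\<^esub> x = embed p \<oplus>\<^bsub>Frac\<^esub> embed q \<otimes>\<^bsub>Frac\<^esub> x"
    using We[OF subringE(6)[OF W(1) W(2) W(2)]] by blast
  have "normalization R \<subseteq> W"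
  proof
    fix z assume "z \<in> normalization R"
    then have "z \<in> power_bounded Frac (frac_image R)"
      unfolding normalization_def
      using Fr.integral_power_bounded[OF subringE(1)[OF subring_frac_image]] by blast
    then show "z \<in> W" using W(4) by blast
  qed
  moreover have "W \<subseteq> normalization R"
  proof
    fix z assume z: "z \<in> W"
    obtain a b where ab: "a \<in> carrier R" "b \<in> carrier R"
      "z = embed a \<oplus>\<^bsub>Frac\<^esub> embed b \<otimes>\<^bsub>Frac\<^esub> x" using We[OF z] by blast
    define A B P Q where "A = embed a" and "B = embed b" and "P = embed p" and "Q = embed q"
    have c: "A \<in> carrier Frac" "B \<in> carrier Frac" "P \<in> carrier Frac" "Q \<in> carrier Frac" "x \<in> carrier Frac"
      using ab pq xc by (auto simp: A_def B_def P_def Q_def)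
    have xx: "x \<otimes>\<^bsub>Frac\<^esub> x = P \<oplus>\<^bsub>Frac\<^esub> Q \<otimes>\<^bsub>Frac\<^esub> x" using pq by (simp add: P_def Q_def)
    \<comment> \<open>The coefficients are the trace and the negative norm of \<open>A + B x\<close>
      for the equation \<open>x x = P + Q x\<close>.\<close>
    have "(A \<oplus>\<^bsub>Frac\<^esub> B \<otimes>\<^bsub>Frac\<^esub> x) \<otimes>\<^bsub>Frac\<^esub> (A \<oplus>\<^bsub>Frac\<^esub> B \<otimes>\<^bsub>Frac\<^esub> x) =
      (A \<oplus>\<^bsub>Frac\<^esub> A \<oplus>\<^bsub>Frac\<^esub> B \<otimes>\<^bsub>Frac\<^esub> Q) \<otimes>\<^bsub>Frac\<^esub> (A \<oplus>\<^bsub>Frac\<^esub> B \<otimes>\<^bsub>Frac\<^esub> x) \<oplus>\<^bsub>Frac\<^esub>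
      (B \<otimes>\<^bsub>Frac\<^esub> B \<otimes>\<^bsub>Frac\<^esub> P \<ominus>\<^bsub>Frac\<^esub> A \<otimes>\<^bsub>Frac\<^esub> A \<ominus>\<^bsub>Frac\<^esub> A \<otimes>\<^bsub>Frac\<^esub> B \<otimes>\<^bsub>Frac\<^esub> Q)"
      by (rule Fr.ring_identity_mod[OF _ _ xx], (rule Fr.reify c)+, code_simp)
    then have "z \<otimes>\<^bsub>Frac\<^esub> z = embed (a \<oplus> a \<oplus> b \<otimes> q) \<otimes>\<^bsub>Frac\<^esub> z \<oplus>\<^bsub>Frac\<^esub>
        embed (b \<otimes> b \<otimes> p \<oplus> \<ominus> (a \<otimes> a) \<oplus> \<ominus> (a \<otimes> b \<otimes> q))"
      unfolding ab(3) using ab(1,2) pq(1,2) by (simp add: A_def B_def P_def Q_def Fr.minus_eq)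
    then show "z \<in> normalization R"
      by (rule quadratic_normalization[rotated 3]) (use Wc[OF z] ab(1,2) pq(1,2) in simp_all)
  qed
  ultimately have N: "normalization R = W" by blast
  have "W = Fr.Span (frac_image R) [\<one>\<^bsub>Frac\<^esub>, x]"
  proof -
    have s1: "z \<in> Fr.Span (frac_image R) [\<one>\<^bsub>Frac\<^esub>, x] \<longleftrightarrow>
      (\<exists>a\<in>frac_image R. \<exists>b\<in>frac_image R. z = a \<otimes>\<^bsub>Frac\<^esub> \<one>\<^bsub>Frac\<^esub> \<oplus>\<^bsub>Frac\<^esub> (b \<otimes>\<^bsub>Frac\<^esub> x \<oplus>\<^bsub>Frac\<^esub> \<zero>\<^bsub>Frac\<^esub>))" for z
      unfolding Span_Cons[of z "frac_image R" "\<one>\<^bsub>Frac\<^esub>" "[x]"] Bex_def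
        Span_Cons[of _ "frac_image R" x "[]"] by auto
    have s2: "a \<otimes>\<^bsub>Frac\<^esub> \<one>\<^bsub>Frac\<^esub> \<oplus>\<^bsub>Frac\<^esub> (b \<otimes>\<^bsub>Frac\<^esub> x \<oplus>\<^bsub>Frac\<^esub> \<zero>\<^bsub>Frac\<^esub>) = a \<oplus>\<^bsub>Frac\<^esub> b \<otimes>\<^bsub>Frac\<^esub> x"
      if "a \<in> frac_image R" "b \<in> frac_image R" for a b
      using that xc subringE(1)[OF subring_frac_image] by (simp add: subset_iff)
    have s3: "z \<in> Fr.Span (frac_image R) [\<one>\<^bsub>Frac\<^esub>, x] \<longleftrightarrow>
      (\<exists>a\<in>frac_image R. \<exists>b\<in>frac_image R. z = a \<oplus>\<^bsub>Frac\<^esub> b \<otimes>\<^bsub>Frac\<^esub> x)" for z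
      unfolding s1 using s2 by (intro bex_cong refl) simp
    show ?thesis unfolding W(3) affine_span_def set_eq_iff s3 by blast
  qed
  moreover have "\<one>\<^bsub>Frac\<^esub> \<in> W" using subringE(3)[OF W(1)] .
  ultimately show ?thesis
    unfolding finite_normalization_def N using W(2) by (intro exI[of _ "[\<one>\<^bsub>Frac\<^esub>, x]"]) auto
qed

text \<open>Stability concerns ideals of the ring, so \<open>I\<close> is replaced by the ideal
  \<open>L = c I\<close>. For a nonzero \<open>x0\<close> in \<open>L\<close>,
  \<open>stable_ideal_dual\<close> is applied to the set \<open>H'\<close> of all \<open>a\<close>
  with \<open>a / x0\<close> in \<open>H\<close>, and \<open>x0 \<in> H'\<close> says
  \<open>1 \<in> H\<close>.\<close>

lemma invertible_fractional_ideal: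
  assumes st: "stable_domain R" and sub: "submodule_over Frac (frac_image R) I" and I0: "I \<noteq> {\<zero>\<^bsub>Frac\<^esub>}"
    and c: "c \<in> carrier Frac" "c \<noteq> \<zero>\<^bsub>Frac\<^esub>" and cI: "\<And>x. x \<in> I \<Longrightarrow> c \<otimes>\<^bsub>Frac\<^esub> x \<in> frac_image R"
  shows "invertible_over_endo Frac I"
proof -
  have Ic: "x \<in> carrier Frac" if "x \<in> I" for x using sub that by (auto simp: submodule_over_def)
  have I_zero: "\<zero>\<^bsub>Frac\<^esub> \<in> I" and I_add: "\<And>x y. \<lbrakk>x \<in> I; y \<in> I\<rbrakk> \<Longrightarrow> x \<oplus>\<^bsub>Frac\<^esub> y \<in> I"
    and I_smult: "\<And>a x. \<lbrakk>a \<in> carrier R; x \<in> I\<rbrakk> \<Longrightarrow> embed a \<otimes>\<^bsub>Frac\<^esub> x \<in> I"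
    using sub by (auto simp: submodule_over_def frac_image_eq)
  define L where "L = {a \<in> carrier R. \<exists>x\<in>I. embed a = c \<otimes>\<^bsub>Frac\<^esub> x}"
  have L: "\<exists>a\<in>L. embed a = c \<otimes>\<^bsub>Frac\<^esub> x" if "x \<in> I" for x
    using cI[OF that] that unfolding L_def frac_image_eq by (auto 4 4)
  have Lc: "a \<in> carrier R" if "a \<in> L" for a using that by (simp add: L_def)
  have L_smult: "b \<otimes> a \<in> L" if a: "a \<in> L" and b: "b \<in> carrier R" for a b
  proof -
    obtain x where x: "x \<in> I" "embed a = c \<otimes>\<^bsub>Frac\<^esub> x" using a by (auto simp: L_def)
    have "embed (b \<otimes> a) = c \<otimes>\<^bsub>Frac\<^esub> (embed b \<otimes>\<^bsub>Frac\<^esub> x)"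
      using x b Lc[OF a] c Ic[OF x(1)] by (simp add: Fr.m_lcomm)
    then show ?thesis using I_smult[OF b x(1)] b Lc[OF a] unfolding L_def by blast
  qed
  have idL: "ideal L R"
  proof (rule idealI[OF ring_axioms])
    show "subgroup L (add_monoid R)"
    proof (rule add.subgroupI)
      show "L \<subseteq> carrier R" using Lc by blast
      have "embed \<zero> = c \<otimes>\<^bsub>Frac\<^esub> \<zero>\<^bsub>Frac\<^esub>" using c by simp
      then show "L \<noteq> {}" unfolding L_def using I_zero zero_closed by blast
      show "a \<oplus> b \<in> L" if ab: "a \<in> L" "b \<in> L" for a b
      proof -
        obtain x where x: "x \<in> I" "embed a = c \<otimes>\<^bsub>Frac\<^esub> x" using ab(1) by (auto simp: L_def)
        obtain y where y: "y \<in> I" "embed b = c \<otimes>\<^bsub>Frac\<^esub> y" using ab(2) by (auto simp: L_def)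
        have "embed (a \<oplus> b) = c \<otimes>\<^bsub>Frac\<^esub> (x \<oplus>\<^bsub>Frac\<^esub> y)"
          using x y Lc[OF ab(1)] Lc[OF ab(2)] c Ic[OF x(1)] Ic[OF y(1)] by (simp add: Fr.r_distr)
        then show ?thesis
          using I_add[OF x(1) y(1)] a_closed[OF Lc[OF ab(1)] Lc[OF ab(2)]] unfolding L_def by blast
      qed
      show "\<ominus> a \<in> L" if "a \<in> L" for a
        using L_smult[OF that, of "\<ominus> \<one>"] Lc[OF that] by (simp add: l_minus)
    qed
    show "b \<otimes> a \<in> L" if "a \<in> L" "b \<in> carrier R" for a b using L_smult that by blast
    then show "a \<otimes> b \<in> L" if "a \<in> L" "b \<in> carrier R" for a b using that Lc m_comm by metis
  qed
  obtain x0' where x0': "x0' \<in> I" "x0' \<noteq> \<zero>\<^bsub>Frac\<^esub>" using I0 I_zero by blast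
  obtain x0 where x0: "x0 \<in> L" "embed x0 = c \<otimes>\<^bsub>Frac\<^esub> x0'" using L[OF x0'(1)] by blast
  have e0: "embed x0 \<noteq> \<zero>\<^bsub>Frac\<^esub>" unfolding x0(2) using c x0' Ic by (simp add: Fr.integral_iff)
  then have x00: "x0 \<noteq> \<zero>" using emb.hom_zero by auto
  have stL: "stable_ideal R L" using st idL x0(1) x00 unfolding stable_domain_def by blast
  have e0c: "embed x0 \<in> carrier Frac" using Lc[OF x0(1)] by simp
  have inverse: "\<exists>v\<in>carrier Frac. x \<otimes>\<^bsub>Frac\<^esub> v = \<one>\<^bsub>Frac\<^esub>"
    if "x \<in> carrier Frac" "x \<noteq> \<zero>\<^bsub>Frac\<^esub>" for x
  proof (rule Fr.Units_r_inv_ex)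
    show "x \<in> Units Frac" unfolding Fr.field_Units using that by blast
  qed
  obtain v where v: "v \<in> carrier Frac" "embed x0 \<otimes>\<^bsub>Frac\<^esub> v = \<one>\<^bsub>Frac\<^esub>"
    using inverse[OF e0c e0] by blast
  show ?thesis
    unfolding invertible_over_endo_def
  proof (intro allI impI, elim conjE)
    fix H assume H: "sum_closed Frac H" "\<forall>q\<in>dual Frac I. \<forall>x\<in>I. q \<otimes>\<^bsub>Frac\<^esub> x \<in> H"
    define H' where "H' = {a \<in> carrier R. embed a \<otimes>\<^bsub>Frac\<^esub> v \<in> H}"
    have H': "sum_closed R H'"
      using H(1) v(1) unfolding sum_closed_def H'_def by (auto simp: Fr.l_distr)
    have "x0 \<in> H'"
    proof (rule stable_ideal_dual[OF stL x0(1) H'])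
      fix g x assume g: "g \<in> L" and x: "x \<in> L" "x \<noteq> \<zero>"
        and gyz: "\<And>y z. \<lbrakk>y \<in> L; z \<in> L\<rbrakk> \<Longrightarrow> \<exists>w\<in>L. g \<otimes> (y \<otimes> z) = x0 \<otimes> (x \<otimes> w)"
      obtain x' where x': "x' \<in> I" "embed x = c \<otimes>\<^bsub>Frac\<^esub> x'" using x by (auto simp: L_def)
      have x'c: "x' \<in> carrier Frac" using Ic[OF x'(1)] .
      have "x' \<noteq> \<zero>\<^bsub>Frac\<^esub>"
      proof
        assume "x' = \<zero>\<^bsub>Frac\<^esub>"
        then have "embed x = embed \<zero>" using x'(2) c by simp
        then show False using embed_inj x Lc by blast
      qed
      then obtain u where u: "u \<in> carrier Frac" "x' \<otimes>\<^bsub>Frac\<^esub> u = \<one>\<^bsub>Frac\<^esub>"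
        using inverse[OF x'c] by blast
      obtain c' where c': "c' \<in> carrier Frac" "c \<otimes>\<^bsub>Frac\<^esub> c' = \<one>\<^bsub>Frac\<^esub>"
        using inverse[OF c] by blast
      define G Z where "G = embed g" and "Z = embed x0"
      have GZ: "G \<in> carrier Frac" "Z \<in> carrier Frac" using Lc[OF g] Lc[OF x0(1)] by (auto simp: G_def Z_def)
      have Zv: "Z \<otimes>\<^bsub>Frac\<^esub> v = \<one>\<^bsub>Frac\<^esub>" using v(2) by (simp add: Z_def)
      \<comment> \<open>\<open>v\<close>, \<open>u\<close>, \<open>c'\<close> invert
        \<open>x0\<close>, \<open>x'\<close>, \<open>c\<close>. After cancelling \<open>c c\<close>
        the hypothesis on \<open>g\<close> says \<open>g y z = x0 x' w\<close>, so
        \<open>g / (x0 x')\<close> is in the dual of \<open>I\<close>.\<close>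
      have "G \<otimes>\<^bsub>Frac\<^esub> v \<otimes>\<^bsub>Frac\<^esub> u \<otimes>\<^bsub>Frac\<^esub> (y \<otimes>\<^bsub>Frac\<^esub> z) \<in> I" if y: "y \<in> I" and z: "z \<in> I" for y z
      proof -
        obtain y' where y': "y' \<in> L" "embed y' = c \<otimes>\<^bsub>Frac\<^esub> y" using L[OF y] by blast
        obtain z' where z': "z' \<in> L" "embed z' = c \<otimes>\<^bsub>Frac\<^esub> z" using L[OF z] by blast
        obtain w' where w': "w' \<in> L" "g \<otimes> (y' \<otimes> z') = x0 \<otimes> (x \<otimes> w')" using gyz[OF y'(1) z'(1)] by blast
        obtain w where w: "w \<in> I" "embed w' = c \<otimes>\<^bsub>Frac\<^esub> w" using w'(1) by (auto simp: L_def)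
        have cc: "y \<in> carrier Frac" "z \<in> carrier Frac" "w \<in> carrier Frac" "c \<in> carrier Frac" "c' \<in> carrier Frac"
          "u \<in> carrier Frac" "v \<in> carrier Frac" "x' \<in> carrier Frac"
          using Ic y z w c c' u v x'c by auto
        have "embed (g \<otimes> (y' \<otimes> z')) = embed (x0 \<otimes> (x \<otimes> w'))" using w'(2) by simp
        then have "G \<otimes>\<^bsub>Frac\<^esub> ((c \<otimes>\<^bsub>Frac\<^esub> y) \<otimes>\<^bsub>Frac\<^esub> (c \<otimes>\<^bsub>Frac\<^esub> z)) =
            Z \<otimes>\<^bsub>Frac\<^esub> ((c \<otimes>\<^bsub>Frac\<^esub> x') \<otimes>\<^bsub>Frac\<^esub> (c \<otimes>\<^bsub>Frac\<^esub> w))"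
          using Lc g y'(1) z'(1) x0(1) x(1) w'(1) by (simp add: G_def Z_def flip: y'(2) z'(2) x'(2) w(2))
        then have e: "c' \<otimes>\<^bsub>Frac\<^esub> c' \<otimes>\<^bsub>Frac\<^esub> v \<otimes>\<^bsub>Frac\<^esub> u \<otimes>\<^bsub>Frac\<^esub> (G \<otimes>\<^bsub>Frac\<^esub> ((c \<otimes>\<^bsub>Frac\<^esub> y) \<otimes>\<^bsub>Frac\<^esub> (c \<otimes>\<^bsub>Frac\<^esub> z))) =
            c' \<otimes>\<^bsub>Frac\<^esub> c' \<otimes>\<^bsub>Frac\<^esub> v \<otimes>\<^bsub>Frac\<^esub> u \<otimes>\<^bsub>Frac\<^esub> (Z \<otimes>\<^bsub>Frac\<^esub> ((c \<otimes>\<^bsub>Frac\<^esub> x') \<otimes>\<^bsub>Frac\<^esub> (c \<otimes>\<^bsub>Frac\<^esub> w)))" by simp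
        have "G \<otimes>\<^bsub>Frac\<^esub> v \<otimes>\<^bsub>Frac\<^esub> u \<otimes>\<^bsub>Frac\<^esub> (y \<otimes>\<^bsub>Frac\<^esub> z) =
          c' \<otimes>\<^bsub>Frac\<^esub> c' \<otimes>\<^bsub>Frac\<^esub> v \<otimes>\<^bsub>Frac\<^esub> u \<otimes>\<^bsub>Frac\<^esub> (G \<otimes>\<^bsub>Frac\<^esub> ((c \<otimes>\<^bsub>Frac\<^esub> y) \<otimes>\<^bsub>Frac\<^esub> (c \<otimes>\<^bsub>Frac\<^esub> z)))"
          by (rule Fr.ring_identity_mod[OF _ _ c'(2)], (rule Fr.reify GZ cc)+, code_simp)
        also have "\<dots> = w"
          unfolding e by (rule Fr.ring_identity_mod3[OF _ _ c'(2) Zv u(2)], (rule Fr.reify GZ cc)+, code_simp)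
        finally show ?thesis using w(1) by simp
      qed
      then have "G \<otimes>\<^bsub>Frac\<^esub> v \<otimes>\<^bsub>Frac\<^esub> u \<in> dual Frac I"
        unfolding dual_def using GZ v(1) u(1) by auto
      then have "G \<otimes>\<^bsub>Frac\<^esub> v \<otimes>\<^bsub>Frac\<^esub> u \<otimes>\<^bsub>Frac\<^esub> x' \<in> H" using H(2) x'(1) by blast
      moreover have "G \<otimes>\<^bsub>Frac\<^esub> v \<otimes>\<^bsub>Frac\<^esub> u \<otimes>\<^bsub>Frac\<^esub> x' = G \<otimes>\<^bsub>Frac\<^esub> v \<otimes>\<^bsub>Frac\<^esub> (x' \<otimes>\<^bsub>Frac\<^esub> u)"
        using GZ v(1) u(1) x'c by (simp add: Fr.m_ac)
      ultimately have "G \<otimes>\<^bsub>Frac\<^esub> v \<in> H" using u(2) GZ v(1) by simp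
      then show "g \<in> H'" unfolding H'_def using Lc[OF g] by (simp add: G_def)
    qed
    then show "\<one>\<^bsub>Frac\<^esub> \<in> H" unfolding H'_def using v(2) by simp
  qed
qed

text \<open>Dimension one enters through \<open>absorbing\<close> and through the existence of a
  nonzero nonunit.\<close>

lemma stable_subring_frac_image:
  assumes st: "stable_domain R" and ql: "quasilocal R" and dim: "krull_dim R = 1"
  shows "stable_subring Frac (frac_image R)"
proof (intro stable_subring.intro stable_subring_axioms.intro)
  show "field Frac" by (rule Frac_field)
  show "subring (frac_image R) Frac" by (rule subring_frac_image)
  interpret M: maximalideal "carrier R - Units R" R by (rule quasilocal_maximal[OF ql])
  show "x \<oplus>\<^bsub>Frac\<^esub> y \<in> nonunits Frac (frac_image R)"
    if xy: "x \<in> nonunits Frac (frac_image R)" "y \<in> nonunits Frac (frac_image R)" for x y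
  proof -
    obtain a b where ab: "a \<in> carrier R - Units R" "b \<in> carrier R - Units R" "x = embed a" "y = embed b"
      using xy unfolding nonunits_frac_image by blast
    have "x \<oplus>\<^bsub>Frac\<^esub> y = embed (a \<oplus> b)" using ab by simp
    then show ?thesis using M.a_closed[OF ab(1,2)] unfolding nonunits_frac_image by blast
  qed
  show "invertible_over_endo Frac I"
    if "submodule_over Frac (frac_image R) I" "I \<noteq> {\<zero>\<^bsub>Frac\<^esub>}" "c \<in> carrier Frac" "c \<noteq> \<zero>\<^bsub>Frac\<^esub>"
      "\<And>x. x \<in> I \<Longrightarrow> c \<otimes>\<^bsub>Frac\<^esub> x \<in> frac_image R" for I c
    using invertible_fractional_ideal[OF st that] .
  show "\<exists>n::nat. m [^]\<^bsub>Frac\<^esub> n \<otimes>\<^bsub>Frac\<^esub> z \<in> frac_image R"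
    if m: "m \<in> nonunits Frac (frac_image R)" "m \<noteq> \<zero>\<^bsub>Frac\<^esub>" and z: "z \<in> carrier Frac" for m z
  proof -
    obtain a where a: "a \<in> carrier R" "a \<notin> Units R" "m = embed a" using m unfolding nonunits_frac_image by blast
    obtain b s where bs: "b \<in> carrier R" "s \<in> carrier R" "s \<noteq> \<zero>" "embed s \<otimes>\<^bsub>Frac\<^esub> z = embed b"
      using Frac_denominator[OF z] .
    obtain n :: nat where "a [^] n \<in> PIdl s" using one_dimensional_power[OF ql dim bs(2,3) a(1,2)] by blast
    then obtain k where k: "k \<in> carrier R" "a [^] n = k \<otimes> s" unfolding PIdl_iff by blast
    have "m [^]\<^bsub>Frac\<^esub> n \<otimes>\<^bsub>Frac\<^esub> z = embed (a [^] n) \<otimes>\<^bsub>Frac\<^esub> z" using a by simp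
    also have "\<dots> = embed k \<otimes>\<^bsub>Frac\<^esub> (embed s \<otimes>\<^bsub>Frac\<^esub> z)"
      unfolding k(2) using k(1) bs(2) z by (simp add: Fr.m_assoc)
    also have "\<dots> = embed (k \<otimes> b)" unfolding bs(4) using k(1) bs(1) by simp
    finally show ?thesis unfolding frac_image_eq using k(1) bs(1) by blast
  qed
  obtain m where m: "m \<in> carrier R" "m \<notin> Units R" "m \<noteq> \<zero>" by (rule one_dimensional_nonunit[OF dim])
  then have "embed m \<in> nonunits Frac (frac_image R)" unfolding nonunits_frac_image by blast
  moreover have "embed m \<noteq> \<zero>\<^bsub>Frac\<^esub>" using embed_inj[of m \<zero>] m by simp
  ultimately show "nonunits Frac (frac_image R) \<noteq> {\<zero>\<^bsub>Frac\<^esub>}" by blast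
qed

end

lemma (in domain_fractions) bad_stable_imp_square_zero_prime:
  assumes bad: "bad_stable_ring R"
  shows "\<exists>P. primeideal P (completion R) \<and> P \<noteq> {\<zero>\<^bsub>completion R\<^esub>} \<and>
    P \<cdot>\<^bsub>completion R\<^esub> P = {\<zero>\<^bsub>completion R\<^esub>} \<and> dvr (completion R Quot P)"
proof -
  have ql: "quasilocal R" and st: "stable_domain R" and dim: "krull_dim R = 1"
    and nf: "\<not> finite_normalization R" using bad by (auto simp: bad_stable_ring_def)
  interpret SS: stable_subring Frac "frac_image R"
    by (rule stable_subring_frac_image[OF st ql dim])
  obtain t where t: "t \<in> SS.M" "\<And>m. m \<in> SS.M \<Longrightarrow> \<exists>e\<in>SS.E. m = t \<otimes>\<^bsub>Frac\<^esub> e"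
    using SS.M_principal_always unfolding SS.M_principal_def by blast
  interpret BS: bad_subring Frac "frac_image R" "frac_image R" t
    by unfold_locales (use t nf finite_normalizationI in auto)
  obtain \<tau> where \<tau>: "\<tau> \<in> carrier R" "\<tau> \<notin> Units R" "t = embed \<tau>"
    using t(1) unfolding nonunits_frac_image by blast
  have \<tau>0: "\<tau> \<noteq> \<zero>" using BS.t_zero \<tau>(3) by auto
  have pow: "t [^]\<^bsub>Frac\<^esub> n = embed (\<tau> [^] n)" for n :: nat using \<tau> by simp
  \<comment> \<open>The ideals of the chain, pulled back along the embedding of the ring in its
    field of fractions.\<close>
  define I where "I n = {a \<in> carrier R. embed a \<in> BS.I n}" for n
  have I_iff: "a \<in> I n \<longleftrightarrow> a \<in> carrier R \<and> embed a \<in> BS.I n" for a n by (simp add: I_def)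
  have mem: "embed a \<in> frac_image R" if "a \<in> carrier R" for a using that by (simp add: frac_image_eq)
  have emb_mem: "embed a \<in> embed ` A \<longleftrightarrow> a \<in> A" if "a \<in> carrier R" "A \<subseteq> carrier R" for a A
    using that embed_inj by blast
  have pow_c: "\<tau> [^] n \<in> carrier R" for n :: nat using \<tau>(1) by simp
  have "ideal_filtration R \<tau> I"
  proof (intro ideal_filtration.intro ideal_filtration_axioms.intro)
    show "domain R" by (rule domain_axioms)
    show "\<tau> \<in> nz" using \<tau>(1) \<tau>0 unfolding nz_iff by blast
    show "\<exists>n::nat. \<tau> [^] n \<in> PIdl s" if "s \<in> nz" for s
      using one_dimensional_power[OF ql dim _ _ \<tau>(1,2)] that unfolding nz_iff by blast
    show "a \<oplus> b \<in> I n" if "a \<in> I n" "b \<in> I n" for a b n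
      using that BS.I_add[of "embed a" n "embed b"] by (simp add: I_iff)
    show "r \<otimes> a \<in> I n" if "r \<in> carrier R" "a \<in> I n" for r a n
      using that BS.I_smult[OF mem[OF that(1)], of "embed a" n] by (simp add: I_iff)
    show "I 0 = carrier R"
      using mem by (auto simp: I_iff BS.I_0)
    show "I (Suc 0) = carrier R - Units R"
      unfolding I_def BS.I_1 nonunits_frac_image using emb_mem[of _ "carrier R - Units R"] by blast
    show "I (Suc n) \<subseteq> I n" for n using BS.I_Suc unfolding I_def by blast
    show "\<tau> [^] n \<in> I n" for n using BS.t_power_I[of n] pow_c unfolding I_iff pow by blast
    show "\<tau> [^] n \<notin> I (Suc n)" for n using BS.t_power_not_I[of n] unfolding I_iff pow by blast
    show "\<tau> \<otimes> a \<in> I (Suc n)" if "a \<in> I n" for a n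
      using that BS.I_t[of "embed a" n] \<tau> by (simp add: I_iff)
    show "a \<otimes> b \<in> PIdl (\<tau> [^] n)" if ab: "a \<in> I n" "b \<in> I n" for a b n
    proof -
      have c: "a \<in> carrier R" "b \<in> carrier R" "embed a \<in> BS.I n" "embed b \<in> BS.I n" using ab by (auto simp: I_iff)
      obtain s where s: "s \<in> carrier R" "embed a \<otimes>\<^bsub>Frac\<^esub> embed b = t [^]\<^bsub>Frac\<^esub> n \<otimes>\<^bsub>Frac\<^esub> embed s"
        using BS.I_mult[OF c(3,4)] unfolding frac_image_eq by blast
      have "embed (a \<otimes> b) = embed (\<tau> [^] n \<otimes> s)" using s c(1,2) pow_c unfolding pow by simp
      then have "a \<otimes> b = \<tau> [^] n \<otimes> s"
        using embed_inj[OF m_closed[OF c(1,2)] m_closed[OF pow_c s(1)]] by blast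
      then show ?thesis using PIdl_mult_left[OF s(1) pow_c] by simp
    qed
    show "\<exists>c\<in>carrier R. a \<ominus> \<tau> [^] n \<otimes> c \<in> I (Suc n)" if a: "a \<in> I n" for a n
    proof -
      have c: "a \<in> carrier R" "embed a \<in> BS.I n" using a by (auto simp: I_iff)
      obtain s where s: "s \<in> carrier R" "embed a \<ominus>\<^bsub>Frac\<^esub> t [^]\<^bsub>Frac\<^esub> n \<otimes>\<^bsub>Frac\<^esub> embed s \<in> BS.I (Suc n)"
        using BS.I_step[OF c(2)] unfolding frac_image_eq by blast
      have "embed (a \<ominus> \<tau> [^] n \<otimes> s) = embed a \<ominus>\<^bsub>Frac\<^esub> t [^]\<^bsub>Frac\<^esub> n \<otimes>\<^bsub>Frac\<^esub> embed s"
        using s(1) c(1) pow_c unfolding pow by (simp add: minus_eq Fr.minus_eq)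
      then have "a \<ominus> \<tau> [^] n \<otimes> s \<in> I (Suc n)" using s c(1) pow_c by (simp add: I_iff)
      then show ?thesis using s(1) by blast
    qed
    \<comment> \<open>The nonvanishing of \<open>P\<close> comes from a nonunit of the ring that
      \<open>t\<close> does not divide there.\<close>
    obtain m where m: "m \<in> SS.M" "\<And>s. s \<in> frac_image R \<Longrightarrow> m \<noteq> t \<otimes>\<^bsub>Frac\<^esub> s"
      using BS.M_not_generated by blast
    obtain a where a: "a \<in> carrier R" "m = embed a" using m(1) unfolding nonunits_frac_image by blast
    have "a \<in> I (Suc 0)" using a m(1) BS.I_1 by (simp add: I_iff)
    moreover have "a \<notin> PIdl \<tau>"
    proof
      assume "a \<in> PIdl \<tau>"
      then obtain k where k: "k \<in> carrier R" "a = k \<otimes> \<tau>" unfolding PIdl_iff by blast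
      have "m = t \<otimes>\<^bsub>Frac\<^esub> embed k" unfolding a(2) k(2) \<tau>(3) using k(1) \<tau>(1) by (simp add: Fr.m_comm)
      then show False using m(2)[OF mem[OF k(1)]] by blast
    qed
    ultimately show "\<exists>a\<in>I (Suc 0). a \<notin> PIdl \<tau>" by blast
  qed
  then show ?thesis by (rule ideal_filtration.square_zero_prime)
qed

theorem theorem3p4:
  fixes R :: "('a, 'm) ring_scheme"
  assumes "domain R" and "quasilocal R" and "krull_dim R = 1"
  shows "bad_stable_ring R \<longleftrightarrow>
    (\<exists>P. primeideal P (completion R) \<and> P \<noteq> {\<zero>\<^bsub>completion R\<^esub>} \<and>
         P \<cdot>\<^bsub>completion R\<^esub> P = {\<zero>\<^bsub>completion R\<^esub>} \<and> dvr (completion R Quot P))"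
proof
  assume "bad_stable_ring R"
  then show "\<exists>P. primeideal P (completion R) \<and> P \<noteq> {\<zero>\<^bsub>completion R\<^esub>} \<and>
         P \<cdot>\<^bsub>completion R\<^esub> P = {\<zero>\<^bsub>completion R\<^esub>} \<and> dvr (completion R Quot P)"
    by (rule domain_fractions.bad_stable_imp_square_zero_prime[OF domain_fractions.intro[OF assms(1)]])
next
  assume "\<exists>P. primeideal P (completion R) \<and> P \<noteq> {\<zero>\<^bsub>completion R\<^esub>} \<and>
         P \<cdot>\<^bsub>completion R\<^esub> P = {\<zero>\<^bsub>completion R\<^esub>} \<and> dvr (completion R Quot P)"
  then obtain P where "square_zero_prime R P"
    using assms(1) by (auto intro!: square_zero_prime.intro square_zero_prime_axioms.intro)
  then show "bad_stable_ring R" using square_zero_prime.bad_stable assms(2,3) by blast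
qed

end
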